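(* Let $(M,E)$ be a Finsler manifold of dimension $n$ and let $\overset{*}{R}$ be the h-curvature tensor of its Chern connection. Let the nullity index $\mu_{R^*}$ be constant on an open subset $U$ of $\mathcal{T}M$ (with $\mu_{R^*}\neq 0$ and $\mu_{R^*}\neq n$). Then the nullity distribution $z\mapsto \mathcal{N}_{R^*}(z)$ is completely integrable on $U$.
   Context: Setting (Klein–Grifone formalism). $M$ is a smooth $n$-manifold, $\mathcal{T}M$ is the bundle of nonzero tangent vectors with projection $\pi:\mathcal{T}M\to M$, $J$ is the vertical endomorphism ($J\,\partial_{x^i}=\partial_{y^i}$, $J\,\partial_{y^i}=0$), $C$ is the Liouville field, $V(TM)$ is the vertical bundle. A Finslerian energy is a function $E:TM\to\mathbb{R}$ that is $C^1$ on $TM$, $C^\infty$ on $\mathcal{T}M$, positive on $\mathcal{T}M$ with $E(0)=0$, satisfying $C\cdot E=2E$, and such that $\Omega:=dd_JE$ has maximal rank; here $d_JE=dE\circ J$. Then $(M,E)$ is a Finsler manifold. The canonical spray $S$ is the unique spray with $i_S\Omega=-dE$. The Barthel connection is $G=[J,S]$ (Frölicher–Nijenhuis bracket), with projectors $h=\frac12(I+G)$, $v=\frac12(I-G)$. Put $H(TM)=\operatorname{Im}h$. The almost complex structure $\mathbf{F}$ is given by $\mathbf{F}J=h$, $\mathbf{F}h=-J$. The metric is $g(X,Y)=\Omega(X,\mathbf{F}Y)$ on $T(\mathcal{T}M)$. The Landsberg tensor $\mathcal{C}'$ is the semibasic vector 2-tensor with $J\circ\mathcal{C}'=0$ and $\Omega(\mathcal{C}'(X,Y),Z)=\frac12(\mathcal{L}_{hX}g)(JY,JZ)$.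 The Chern connection $\overset{*}{D}$ is the linear connection on $\mathcal{T}M$ given by $\overset{*}{D}_{JX}JY=J[JX,Y]$, $\overset{*}{D}_{hX}JY=v[hX,JY]+\mathcal{C}'(X,Y)$, $\overset{*}{D}\mathbf{F}=0$. With $\overset{*}{K}(X,Y)Z=\overset{*}{D}_X\overset{*}{D}_YZ-\overset{*}{D}_Y\overset{*}{D}_XZ-\overset{*}{D}_{[X,Y]}Z$ its curvature, the h-curvature is $\overset{*}{R}(X,Y)Z=\overset{*}{K}(hX,hY)JZ$. Nullity: $\mathcal{N}_{R^*}(z)=\{v\in H_z(TM): \overset{*}{R}_z(v,w)=0 \text{ for all } w\in H_z(TM)\}$ and $\mu_{R^*}(z)=\dim\mathcal{N}_{R^*}(z)$. Where the index is constant, $z\mapsto\mathcal{N}_{R^*}(z)$ is a distribution. Completely integrable means that the Lie bracket of any two sections of the distribution is again a section (Frobenius). *)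

theory Defs
  imports "HOL-Analysis.Analysis" "HOL-Library.Function_Algebras"
begin

section \<open>Differentiability classes on open subsets of a normed space\<close>

primrec Ck_on :: "nat \<Rightarrow> ('a::real_normed_vector \<Rightarrow> 'b::real_normed_vector) \<Rightarrow> 'a set \<Rightarrow> bool" where
  "Ck_on 0 f S \<longleftrightarrow> continuous_on S f"
| "Ck_on (Suc k) f S \<longleftrightarrow>
     (\<exists>f'. (\<forall>x\<in>S. (f has_derivative f' x) (at x)) \<and> (\<forall>v. Ck_on k (\<lambda>x. f' x v) S))"

definition smooth_on :: "('a::real_normed_vector \<Rightarrow> 'b::real_normed_vector) \<Rightarrow> 'a set \<Rightarrow> bool" where
  "smooth_on f S \<longleftrightarrow> (\<forall>k. Ck_on k f S)"


section \<open>Smooth manifolds\<close>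

text \<open>A chart is a pair of a domain and a coordinate map. The manifold topology is the one
  induced by the charts, so that the same notions apply to a manifold and to its tangent bundle.\<close>

type_synonym ('a, 'e) chart = "'a set \<times> ('a \<Rightarrow> 'e)"

definition carrier :: "('a, 'e) chart set \<Rightarrow> 'a set" where
  "carrier A = (\<Union>c\<in>A. fst c)"

definition charts_at :: "('a, 'e) chart set \<Rightarrow> 'a \<Rightarrow> ('a, 'e) chart set" where
  "charts_at A p = {c \<in> A. p \<in> fst c}"

definition chart_inv :: "('a, 'e) chart \<Rightarrow> 'e \<Rightarrow> 'a" where
  "chart_inv c = inv_into (fst c) (snd c)"

definition smooth_atlas :: "('a, 'e::euclidean_space) chart set \<Rightarrow> bool" where
  "smooth_atlas A \<longleftrightarrow>
     (\<forall>c\<in>A. inj_on (snd c) (fst c)) \<and>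
     (\<forall>c\<in>A. \<forall>c'\<in>A. open (snd c ` (fst c \<inter> fst c')) \<and>
        smooth_on (snd c' \<circ> chart_inv c) (snd c ` (fst c \<inter> fst c')))"

definition manifold_topology :: "('a, 'e::euclidean_space) chart set \<Rightarrow> 'a topology" where
  "manifold_topology A =
     topology (\<lambda>W. W \<subseteq> carrier A \<and> (\<forall>c\<in>A. open (snd c ` (W \<inter> fst c))))"

lemma openin_manifold_topology:
  assumes "smooth_atlas A"
  shows "openin (manifold_topology A) W \<longleftrightarrow>
           W \<subseteq> carrier A \<and> (\<forall>c\<in>A. open (snd c ` (W \<inter> fst c)))"
proof -
  let ?L = "\<lambda>W. W \<subseteq> carrier A \<and> (\<forall>c\<in>A. open (snd c ` (W \<inter> fst c)))"
  have "?L (S \<inter> T)" if "?L S" "?L T" for S T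
  proof (intro conjI ballI)
    fix c assume c: "c \<in> A"
    have "inj_on (snd c) (fst c)"
      using assms c by (auto simp: smooth_atlas_def)
    then have "snd c ` (S \<inter> T \<inter> fst c) = snd c ` (S \<inter> fst c) \<inter> snd c ` (T \<inter> fst c)"
      by (auto simp: inj_on_def)
    then show "open (snd c ` (S \<inter> T \<inter> fst c))"
      using that c by (simp add: open_Int)
  qed (use that in auto)
  moreover have "?L (\<Union>\<K>)" if "\<forall>K\<in>\<K>. ?L K" for \<K>
  proof (intro conjI ballI)
    fix c assume c: "c \<in> A"
    have "snd c ` (\<Union>\<K> \<inter> fst c) = (\<Union>K\<in>\<K>. snd c ` (K \<inter> fst c))"
      by auto
    then show "open (snd c ` (\<Union>\<K> \<inter> fst c))"
      using that c by auto
  qed (use that in auto)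
  ultimately have "istopology ?L"
    unfolding istopology_def by blast
  then show ?thesis
    by (simp add: manifold_topology_def topology_inverse')
qed

definition smooth_manifold :: "('a, 'e::euclidean_space) chart set \<Rightarrow> bool" where
  "smooth_manifold A \<longleftrightarrow>
     smooth_atlas A \<and> Hausdorff_space (manifold_topology A) \<and> second_countable (manifold_topology A)"

definition smooth_function ::
    "('a, 'e::euclidean_space) chart set \<Rightarrow> 'a set \<Rightarrow> ('a \<Rightarrow> real) \<Rightarrow> bool" where
  "smooth_function A W f \<longleftrightarrow> (\<forall>c\<in>A. smooth_on (f \<circ> chart_inv c) (snd c ` (W \<inter> fst c)))"


section \<open>Tangent vectors and vector fields\<close>

text \<open>A tangent vector at \<open>p\<close> is the family of its coordinate vectors with respect to all charts
  of the atlas around \<open>p\<close>, related by the derivatives of the coordinate changes. Off the charts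
  around \<open>p\<close> the family is set to zero, so that the tangent space is a linear subspace.\<close>

type_synonym ('a, 'e) tvec = "('a, 'e) chart \<Rightarrow> 'e"

instantiation "fun" :: (type, real_vector) real_vector
begin

definition "r *\<^sub>R f = (\<lambda>x. r *\<^sub>R f x)"

instance
  by standard (simp_all add: scaleR_fun_def fun_eq_iff scaleR_add_right scaleR_add_left)

end

definition tangent_space :: "('a, 'e::euclidean_space) chart set \<Rightarrow> 'a \<Rightarrow> ('a, 'e) tvec set" where
  "tangent_space A p =
     {u. (\<forall>c. c \<notin> charts_at A p \<longrightarrow> u c = 0) \<and>
         (\<forall>c\<in>charts_at A p. \<forall>c'\<in>charts_at A p.
            u c' = frechet_derivative (snd c' \<circ> chart_inv c) (at (snd c p)) (u c))}"

definition vector_field ::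
    "('a, 'e::euclidean_space) chart set \<Rightarrow> 'a set \<Rightarrow> ('a \<Rightarrow> ('a, 'e) tvec) \<Rightarrow> bool" where
  "vector_field A W X \<longleftrightarrow>
     (\<forall>p\<in>W. X p \<in> tangent_space A p) \<and>
     (\<forall>c\<in>A. smooth_on (\<lambda>x. X (chart_inv c x) c) (snd c ` (W \<inter> fst c)))"

text \<open>The derivative of \<open>f\<close> along \<open>u \<in> T\<^sub>pM\<close>; the value does not depend on the chart chosen.\<close>

definition dir_deriv ::
    "('a, 'e::euclidean_space) chart set \<Rightarrow> 'a \<Rightarrow> ('a, 'e) tvec \<Rightarrow> ('a \<Rightarrow> real) \<Rightarrow> real" where
  "dir_deriv A p u f =
     (let c = (SOME c. c \<in> charts_at A p)
      in frechet_derivative (f \<circ> chart_inv c) (at (snd c p)) (u c))"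

definition lie_bracket ::
    "('a, 'e::euclidean_space) chart set \<Rightarrow> ('a \<Rightarrow> ('a, 'e) tvec) \<Rightarrow> ('a \<Rightarrow> ('a, 'e) tvec) \<Rightarrow>
       'a \<Rightarrow> ('a, 'e) tvec" where
  "lie_bracket A X Y p =
     (\<lambda>c. if c \<in> charts_at A p
          then frechet_derivative (\<lambda>x. Y (chart_inv c x) c) (at (snd c p)) (X p c)
             - frechet_derivative (\<lambda>x. X (chart_inv c x) c) (at (snd c p)) (Y p c)
          else 0)"

text \<open>Tensor fields below are given by their values on vector fields. Their value at a point on
  tangent vectors is the common value on all local extensions of these vectors.\<close>

definition local_ext ::
    "('a, 'e::euclidean_space) chart set \<Rightarrow> 'a \<Rightarrow> ('a, 'e) tvec \<Rightarrow> ('a \<Rightarrow> ('a, 'e) tvec) set" where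
  "local_ext A p u =
     {X. \<exists>W. openin (manifold_topology A) W \<and> p \<in> W \<and> vector_field A W X \<and> X p = u}"

text \<open>\<open>d\<theta>(X, Y) = X(\<theta>(Y)) - Y(\<theta>(X)) - \<theta>([X, Y])\<close> for a 1-form \<open>\<theta>\<close>.\<close>

definition ext_deriv ::
    "('a, 'e::euclidean_space) chart set \<Rightarrow> ('a \<Rightarrow> ('a, 'e) tvec \<Rightarrow> real) \<Rightarrow>
       'a \<Rightarrow> ('a, 'e) tvec \<Rightarrow> ('a, 'e) tvec \<Rightarrow> real" where
  "ext_deriv A \<theta> p u w =
     (THE r. \<forall>X\<in>local_ext A p u. \<forall>Y\<in>local_ext A p w.
        r = dir_deriv A p (X p) (\<lambda>q. \<theta> q (Y q)) - dir_deriv A p (Y p) (\<lambda>q. \<theta> q (X q))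
            - \<theta> p (lie_bracket A X Y p))"

text \<open>The Froelicher-Nijenhuis bracket of a vector-valued 1-form \<open>K\<close> and a vector field \<open>S\<close>:
  \<open>[K, S]X = [KX, S] - K[X, S]\<close>.\<close>

definition fn_bracket ::
    "('a, 'e::euclidean_space) chart set \<Rightarrow> ('a \<Rightarrow> ('a, 'e) tvec \<Rightarrow> ('a, 'e) tvec) \<Rightarrow>
       ('a \<Rightarrow> ('a, 'e) tvec) \<Rightarrow> 'a \<Rightarrow> ('a, 'e) tvec \<Rightarrow> ('a, 'e) tvec" where
  "fn_bracket A K S p u =
     (THE r. \<forall>X\<in>local_ext A p u.
        r = lie_bracket A (\<lambda>q. K q (X q)) S p - K p (lie_bracket A X S p))"

text \<open>\<open>(\<L>\<^sub>X g)(Y, Z)\<close> for a covariant 2-tensor \<open>g\<close>.\<close>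

definition lie_deriv2 ::
    "('a, 'e::euclidean_space) chart set \<Rightarrow> ('a \<Rightarrow> ('a, 'e) tvec) \<Rightarrow>
       ('a \<Rightarrow> ('a, 'e) tvec \<Rightarrow> ('a, 'e) tvec \<Rightarrow> real) \<Rightarrow>
       ('a \<Rightarrow> ('a, 'e) tvec) \<Rightarrow> ('a \<Rightarrow> ('a, 'e) tvec) \<Rightarrow> 'a \<Rightarrow> real" where
  "lie_deriv2 A X g Y Z p =
     dir_deriv A p (X p) (\<lambda>q. g q (Y q) (Z q))
       - g p (lie_bracket A X Y p) (Z p) - g p (Y p) (lie_bracket A X Z p)"

text \<open>A linear connection on the open submanifold \<open>V\<close>, acting on vector fields defined on
  arbitrary open subsets \<open>W\<close> of \<open>V\<close> compatibly with restriction (first clause).\<close>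

definition linear_connection ::
    "('a, 'e::euclidean_space) chart set \<Rightarrow> 'a set \<Rightarrow>
       (('a \<Rightarrow> ('a, 'e) tvec) \<Rightarrow> ('a \<Rightarrow> ('a, 'e) tvec) \<Rightarrow> 'a \<Rightarrow> ('a, 'e) tvec) \<Rightarrow> bool" where
  "linear_connection A V D \<longleftrightarrow>
     (\<forall>W X Y. openin (manifold_topology A) W \<longrightarrow> W \<subseteq> V \<longrightarrow>
        vector_field A W X \<longrightarrow> vector_field A W Y \<longrightarrow>
        (\<forall>X' Y'. (\<forall>p\<in>W. X' p = X p \<and> Y' p = Y p) \<longrightarrow> (\<forall>p\<in>W. D X' Y' p = D X Y p)) \<and>
        vector_field A W (D X Y) \<and>
        (\<forall>X'. vector_field A W X' \<longrightarrow> (\<forall>p\<in>W. D (X + X') Y p = D X Y p + D X' Y p)) \<and>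
        (\<forall>Y'. vector_field A W Y' \<longrightarrow> (\<forall>p\<in>W. D X (Y + Y') p = D X Y p + D X Y' p)) \<and>
        (\<forall>f. smooth_function A W f \<longrightarrow>
           (\<forall>p\<in>W. D (\<lambda>q. f q *\<^sub>R X q) Y p = f p *\<^sub>R D X Y p \<and>
              D X (\<lambda>q. f q *\<^sub>R Y q) p = dir_deriv A p (X p) f *\<^sub>R Y p + f p *\<^sub>R D X Y p)))"

definition curvature ::
    "('a, 'e::euclidean_space) chart set \<Rightarrow>
       (('a \<Rightarrow> ('a, 'e) tvec) \<Rightarrow> ('a \<Rightarrow> ('a, 'e) tvec) \<Rightarrow> 'a \<Rightarrow> ('a, 'e) tvec) \<Rightarrow>
       ('a \<Rightarrow> ('a, 'e) tvec) \<Rightarrow> ('a \<Rightarrow> ('a, 'e) tvec) \<Rightarrow> ('a \<Rightarrow> ('a, 'e) tvec) \<Rightarrow> 'a \<Rightarrow> ('a, 'e) tvec"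
  where
  "curvature A D X Y Z p = D X (D Y Z) p - D Y (D X Z) p - D (lie_bracket A X Y) Z p"

definition section_of ::
    "('a, 'e::euclidean_space) chart set \<Rightarrow> ('a \<Rightarrow> ('a, 'e) tvec set) \<Rightarrow> 'a set \<Rightarrow>
       ('a \<Rightarrow> ('a, 'e) tvec) \<Rightarrow> bool" where
  "section_of A N W X \<longleftrightarrow> vector_field A W X \<and> (\<forall>p\<in>W. X p \<in> N p)"

definition completely_integrable ::
    "('a, 'e::euclidean_space) chart set \<Rightarrow> 'a set \<Rightarrow> ('a \<Rightarrow> ('a, 'e) tvec set) \<Rightarrow> bool" where
  "completely_integrable A U N \<longleftrightarrow>
     (\<forall>W X Y. openin (manifold_topology A) W \<longrightarrow> W \<subseteq> U \<longrightarrow>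
        section_of A N W X \<longrightarrow> section_of A N W Y \<longrightarrow> section_of A N W (lie_bracket A X Y))"


section \<open>The tangent bundle\<close>

type_synonym ('m, 'e) tpoint = "'m \<times> ('m, 'e) tvec"
type_synonym ('m, 'e) ttvec = "(('m, 'e) tpoint, 'e \<times> 'e) tvec"
type_synonym ('m, 'e) tfield = "('m, 'e) tpoint \<Rightarrow> ('m, 'e) ttvec"

text \<open>The chart \<open>(U, x)\<close> of \<open>M\<close> induces the chart \<open>(\<pi>\<^sup>-\<^sup>1(U), (x, y))\<close> of \<open>TM\<close>.\<close>

definition tangent_atlas ::
    "('m, 'e::euclidean_space) chart set \<Rightarrow> (('m, 'e) tpoint, 'e \<times> 'e) chart set" where
  "tangent_atlas A =
     (\<lambda>c. ({(p, u). p \<in> fst c \<and> u \<in> tangent_space A p}, \<lambda>(p, u). (snd c p, u c))) ` A"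

definition slit :: "('m, 'e::euclidean_space) chart set \<Rightarrow> ('m, 'e) tpoint set" where
  "slit A = {(p, u). p \<in> carrier A \<and> u \<in> tangent_space A p \<and> u \<noteq> 0}"

text \<open>In each induced chart a vector \<open>w \<in> T\<^sub>z(TM)\<close> has a component pair \<open>(a, b)\<close>, meaning
  \<open>a\<^sup>i \<partial>/\<partial>x\<^sup>i + b\<^sup>i \<partial>/\<partial>y\<^sup>i\<close>; \<open>J\<close> sends it to \<open>(0, a)\<close>.\<close>

definition vert :: "('m, 'e::euclidean_space) ttvec \<Rightarrow> ('m, 'e) ttvec" where
  "vert w = (\<lambda>c. (0, fst (w c)))"

definition liouville :: "('m, 'e::euclidean_space) chart set \<Rightarrow> ('m, 'e) tfield" where
  "liouville A z =
     (\<lambda>c. if c \<in> charts_at (tangent_atlas A) z then (0, snd (snd c z)) else 0)"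


section \<open>Finsler manifolds\<close>

text \<open>\<open>\<Omega> = dd\<^sub>JE\<close> with \<open>d\<^sub>JE = dE \<circ> J\<close>.\<close>

definition Omega ::
    "('m, 'e::euclidean_space) chart set \<Rightarrow> (('m, 'e) tpoint \<Rightarrow> real) \<Rightarrow>
       ('m, 'e) tpoint \<Rightarrow> ('m, 'e) ttvec \<Rightarrow> ('m, 'e) ttvec \<Rightarrow> real" where
  "Omega A E =
     ext_deriv (tangent_atlas A) (\<lambda>z w. dir_deriv (tangent_atlas A) z (vert w) E)"

definition finsler_energy ::
    "('m, 'e::euclidean_space) chart set \<Rightarrow> (('m, 'e) tpoint \<Rightarrow> real) \<Rightarrow> bool" where
  "finsler_energy A E \<longleftrightarrow>
     (\<forall>c\<in>tangent_atlas A. Ck_on 1 (E \<circ> chart_inv c) (snd c ` fst c)) \<and>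
     smooth_function (tangent_atlas A) (slit A) E \<and>
     (\<forall>z\<in>slit A. E z > 0) \<and>
     (\<forall>p\<in>carrier A. E (p, 0) = 0) \<and>
     (\<forall>z\<in>carrier (tangent_atlas A).
        dir_deriv (tangent_atlas A) z (liouville A z) E = 2 * E z) \<and>
     (\<forall>z\<in>slit A. \<forall>u\<in>tangent_space (tangent_atlas A) z.
        (\<forall>w\<in>tangent_space (tangent_atlas A) z. Omega A E z u w = 0) \<longrightarrow> u = 0)"

text \<open>A spray satisfies \<open>JS = C\<close> and \<open>[C, S] = S\<close>; only its values on the slit tangent bundle
  matter here.\<close>

definition spray :: "('m, 'e::euclidean_space) chart set \<Rightarrow> ('m, 'e) tfield \<Rightarrow> bool" where
  "spray A S \<longleftrightarrow>
     vector_field (tangent_atlas A) (slit A) S \<and>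
     (\<forall>z\<in>slit A. vert (S z) = liouville A z) \<and>
     (\<forall>z\<in>slit A. lie_bracket (tangent_atlas A) (liouville A) S z = S z)"

definition canonical_spray ::
    "('m, 'e::euclidean_space) chart set \<Rightarrow> (('m, 'e) tpoint \<Rightarrow> real) \<Rightarrow> ('m, 'e) tfield \<Rightarrow> bool" where
  "canonical_spray A E S \<longleftrightarrow>
     spray A S \<and>
     (\<forall>z\<in>slit A. \<forall>w\<in>tangent_space (tangent_atlas A) z.
        Omega A E z (S z) w = - dir_deriv (tangent_atlas A) z w E)"

definition barthel ::
    "('m, 'e::euclidean_space) chart set \<Rightarrow> ('m, 'e) tfield \<Rightarrow>
       ('m, 'e) tpoint \<Rightarrow> ('m, 'e) ttvec \<Rightarrow> ('m, 'e) ttvec" where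
  "barthel A S = fn_bracket (tangent_atlas A) (\<lambda>_. vert) S"

definition hproj ::
    "('m, 'e::euclidean_space) chart set \<Rightarrow> ('m, 'e) tfield \<Rightarrow>
       ('m, 'e) tpoint \<Rightarrow> ('m, 'e) ttvec \<Rightarrow> ('m, 'e) ttvec" where
  "hproj A S z u = (1 / 2) *\<^sub>R (u + barthel A S z u)"

definition vproj ::
    "('m, 'e::euclidean_space) chart set \<Rightarrow> ('m, 'e) tfield \<Rightarrow>
       ('m, 'e) tpoint \<Rightarrow> ('m, 'e) ttvec \<Rightarrow> ('m, 'e) ttvec" where
  "vproj A S z u = (1 / 2) *\<^sub>R (u - barthel A S z u)"

definition horizontal ::
    "('m, 'e::euclidean_space) chart set \<Rightarrow> ('m, 'e) tfield \<Rightarrow>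
       ('m, 'e) tpoint \<Rightarrow> ('m, 'e) ttvec set" where
  "horizontal A S z = hproj A S z ` tangent_space (tangent_atlas A) z"

text \<open>The linear map with \<open>F J = h\<close> and \<open>F h = -J\<close>, i.e. \<open>F (Ja + hb) = ha - Jb\<close>.\<close>

definition acs ::
    "('m, 'e::euclidean_space) chart set \<Rightarrow> ('m, 'e) tfield \<Rightarrow>
       ('m, 'e) tpoint \<Rightarrow> ('m, 'e) ttvec \<Rightarrow> ('m, 'e) ttvec" where
  "acs A S z u =
     (THE r. \<exists>a\<in>tangent_space (tangent_atlas A) z. \<exists>b\<in>tangent_space (tangent_atlas A) z.
        u = vert a + hproj A S z b \<and> r = hproj A S z a - vert b)"

definition finsler_metric ::
    "('m, 'e::euclidean_space) chart set \<Rightarrow> (('m, 'e) tpoint \<Rightarrow> real) \<Rightarrow> ('m, 'e) tfield \<Rightarrow>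
       ('m, 'e) tpoint \<Rightarrow> ('m, 'e) ttvec \<Rightarrow> ('m, 'e) ttvec \<Rightarrow> real" where
  "finsler_metric A E S z u w = Omega A E z u (acs A S z w)"

definition landsberg ::
    "('m, 'e::euclidean_space) chart set \<Rightarrow> (('m, 'e) tpoint \<Rightarrow> real) \<Rightarrow> ('m, 'e) tfield \<Rightarrow>
       ('m, 'e) tpoint \<Rightarrow> ('m, 'e) ttvec \<Rightarrow> ('m, 'e) ttvec \<Rightarrow> ('m, 'e) ttvec" where
  "landsberg A E S z u w =
     (THE r. r \<in> tangent_space (tangent_atlas A) z \<and> vert r = 0 \<and>
        (\<forall>t\<in>tangent_space (tangent_atlas A) z.
         \<forall>X\<in>local_ext (tangent_atlas A) z u.
         \<forall>Y\<in>local_ext (tangent_atlas A) z w.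
         \<forall>Z\<in>local_ext (tangent_atlas A) z t.
           Omega A E z r t =
             (1 / 2) * lie_deriv2 (tangent_atlas A) (\<lambda>q. hproj A S q (X q)) (finsler_metric A E S)
               (\<lambda>q. vert (Y q)) (\<lambda>q. vert (Z q)) z))"

definition chern_connection ::
    "('m, 'e::euclidean_space) chart set \<Rightarrow> (('m, 'e) tpoint \<Rightarrow> real) \<Rightarrow> ('m, 'e) tfield \<Rightarrow>
       (('m, 'e) tfield \<Rightarrow> ('m, 'e) tfield \<Rightarrow> ('m, 'e) tfield) \<Rightarrow> bool" where
  "chern_connection A E S D \<longleftrightarrow>
     linear_connection (tangent_atlas A) (slit A) D \<and>
     (\<forall>W X Y. openin (manifold_topology (tangent_atlas A)) W \<longrightarrow> W \<subseteq> slit A \<longrightarrow>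
        vector_field (tangent_atlas A) W X \<longrightarrow> vector_field (tangent_atlas A) W Y \<longrightarrow>
        (\<forall>z\<in>W.
           D (\<lambda>q. vert (X q)) (\<lambda>q. vert (Y q)) z
             = vert (lie_bracket (tangent_atlas A) (\<lambda>q. vert (X q)) Y z) \<and>
           D (\<lambda>q. hproj A S q (X q)) (\<lambda>q. vert (Y q)) z
             = vproj A S z
                 (lie_bracket (tangent_atlas A) (\<lambda>q. hproj A S q (X q)) (\<lambda>q. vert (Y q)) z)
               + landsberg A E S z (X z) (Y z) \<and>
           D X (\<lambda>q. acs A S q (Y q)) z = acs A S z (D X Y z)))"

text \<open>The h-curvature \<open>R(X, Y)Z = K(hX, hY)JZ\<close> as a tensor at \<open>z\<close>.\<close>

definition h_curvature ::
    "('m, 'e::euclidean_space) chart set \<Rightarrow> ('m, 'e) tfield \<Rightarrow>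
       (('m, 'e) tfield \<Rightarrow> ('m, 'e) tfield \<Rightarrow> ('m, 'e) tfield) \<Rightarrow>
       ('m, 'e) tpoint \<Rightarrow> ('m, 'e) ttvec \<Rightarrow> ('m, 'e) ttvec \<Rightarrow> ('m, 'e) ttvec \<Rightarrow> ('m, 'e) ttvec" where
  "h_curvature A S D z u w t =
     (THE r. \<forall>X\<in>local_ext (tangent_atlas A) z u.
             \<forall>Y\<in>local_ext (tangent_atlas A) z w.
             \<forall>Z\<in>local_ext (tangent_atlas A) z t.
        r = curvature (tangent_atlas A) D
              (\<lambda>q. hproj A S q (X q)) (\<lambda>q. hproj A S q (Y q)) (\<lambda>q. vert (Z q)) z)"

definition nullity ::
    "('m, 'e::euclidean_space) chart set \<Rightarrow> ('m, 'e) tfield \<Rightarrow>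
       (('m, 'e) tfield \<Rightarrow> ('m, 'e) tfield \<Rightarrow> ('m, 'e) tfield) \<Rightarrow>
       ('m, 'e) tpoint \<Rightarrow> ('m, 'e) ttvec set" where
  "nullity A S D z =
     {u \<in> horizontal A S z.
        \<forall>w\<in>horizontal A S z. \<forall>t\<in>tangent_space (tangent_atlas A) z. h_curvature A S D z u w t = 0}"

definition nullity_index ::
    "('m, 'e::euclidean_space) chart set \<Rightarrow> ('m, 'e) tfield \<Rightarrow>
       (('m, 'e) tfield \<Rightarrow> ('m, 'e) tfield \<Rightarrow> ('m, 'e) tfield) \<Rightarrow> ('m, 'e) tpoint \<Rightarrow> nat" where
  "nullity_index A S D z = dim (nullity A S D z)"

end

theory Submission
  imports Defs
begin

text \<open>Write \<open>K\<close> for the curvature of the Chern connection \<open>D\<close> and \<open>C = JS\<close> for the Liouville field. Since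
  the Barthel connection is homogeneous, conservative (\<open>dE \<circ> h = 0\<close>) and has a Lagrangian horizontal
  bundle, the Landsberg tensor vanishes on the spray \<open>S\<close>, whence \<open>D\<^sub>h\<^sub>X C = 0\<close> and \<open>D\<^sub>J\<^sub>X C = JX\<close>. Therefore \<open>K(X, Y)C = -v[X, Y]\<close> for
  horizontal \<open>X\<close>, \<open>Y\<close>, and \<open>[X, Y]\<close> is horizontal as soon as \<open>X\<close> is in the nullity. Moreover
  \<open>K(X, Y)J = 0\<close> forces \<open>K(X, Y) = 0\<close> because \<open>D\<^bold>F = 0\<close>. For nullity fields \<open>X\<close>, \<open>Y\<close> and horizontal \<open>Z\<close> the
  Jacobi identity of the operators \<open>D\<^sub>X\<close>, \<open>D\<^sub>Y\<close>, \<open>D\<^sub>Z\<close> reads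
  \<open>K(X, [Y, Z]) + K(Y, [Z, X]) + K(Z, [X, Y]) = 0\<close>; its first two terms vanish, so \<open>K(Z, [X, Y]) = 0\<close>.\<close>

section \<open>Calculus of smooth maps\<close>

text \<open>Most tensors here are definite descriptions over all local extensions of tangent
  vectors, so they have no usable value until independence of the extension is proved. For
  \<open>Omega\<close> and the Barthel connection this is a coordinate computation, for the
  h-curvature it is linearity over functions; the Landsberg tensor is evaluated only with the spray
  as second argument, where its value is 0. In an induced chart of the tangent bundle the spray is
  (y, s), a horizontal vector is (a, N a) with N half the fiber derivative of s, and the required
  properties of the Barthel connection are relations between second and third derivatives of E,
  found by differentiating Euler's relation and the Euler-Lagrange equations. The Liouville field is
  the decisive probe: it has the form JZ, which is all that the h-curvature sees, and yet K(X, Y)C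
  is the curvature of the Barthel connection. Flatness of a pair X, Y thus controls v[X, Y] as well;
  this keeps [Y, Z] and [Z, X] horizontal, so that the nullity condition applies to them in the
  Jacobi identity.\<close>

abbreviation fderiv :: "('a::real_normed_vector \<Rightarrow> 'b::real_normed_vector) \<Rightarrow> 'a \<Rightarrow> 'a \<Rightarrow> 'b" where
  "fderiv f x \<equiv> frechet_derivative f (at x)"

lemma fderiv_eq: "(f has_derivative f') (at x) \<Longrightarrow> fderiv f x = f'"
  by (metis frechet_derivative_at)

text \<open>No differentiability is assumed: functions that agree near x have the same candidate
  derivatives at x, so the description in \<open>frechet_derivative\<close> selects the same map for
  both, whatever it is.\<close>

lemma fderiv_cong:
  assumes "open S" "x \<in> S" "\<And>y. y \<in> S \<Longrightarrow> f y = g y"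
  shows "fderiv f x = fderiv g x"
proof -
  have "(f has_derivative D) (at x) \<longleftrightarrow> (g has_derivative D) (at x)" for D
    using assms by (auto intro: has_derivative_transform_within_open[OF _ assms(1,2)] simp: assms(3))
  then show ?thesis
    by (simp add: frechet_derivative_def)
qed

section \<open>Maps of class C^k\<close>

lemma Ck_on_mono: "Ck_on k f S \<Longrightarrow> T \<subseteq> S \<Longrightarrow> Ck_on k f T"
proof (induction k arbitrary: f)
  case 0
  then show ?case by (auto intro: continuous_on_subset)
next
  case (Suc k)
  then obtain f' where "\<forall>x\<in>S. (f has_derivative f' x) (at x)" "\<forall>v. Ck_on k (\<lambda>x. f' x v) S"
    by auto
  then show ?case using Suc by (auto intro!: exI[of _ f'])
qed

lemma Ck_on_cong:
  assumes "open S" "Ck_on k f S" "\<And>x. x \<in> S \<Longrightarrow> f x = g x"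
  shows "Ck_on k g S"
proof (cases k)
  case 0
  then show ?thesis using assms by (simp cong: continuous_on_cong)
next
  case (Suc m)
  then obtain f' where f': "\<And>x. x \<in> S \<Longrightarrow> (f has_derivative f' x) (at x)"
      "\<And>v. Ck_on m (\<lambda>x. f' x v) S"
    using assms(2) by auto
  have "(g has_derivative f' x) (at x)" if "x \<in> S" for x
    by (rule has_derivative_transform_within_open[OF f'(1)[OF that] assms(1) that]) (simp add: assms(3))
  then show ?thesis using f'(2) Suc by auto
qed

text \<open>Replaces the existentially quantified derivative of the definition by the canonical
  \<open>fderiv\<close>; openness allows the exchange at the next level through
  \<open>Ck_on_cong\<close>.\<close>

lemma Ck_on_Suc_iff:
  assumes "open S"
  shows "Ck_on (Suc k) f S \<longleftrightarrow>
    (\<forall>x\<in>S. f differentiable (at x)) \<and> (\<forall>v. Ck_on k (\<lambda>x. fderiv f x v) S)"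
proof
  assume "Ck_on (Suc k) f S"
  then obtain f' where f': "\<And>x. x \<in> S \<Longrightarrow> (f has_derivative f' x) (at x)"
      "\<And>v. Ck_on k (\<lambda>x. f' x v) S"
    by auto
  have "Ck_on k (\<lambda>x. fderiv f x v) S" for v
    by (rule Ck_on_cong[OF assms f'(2)]) (simp add: fderiv_eq[OF f'(1)])
  then show "(\<forall>x\<in>S. f differentiable (at x)) \<and> (\<forall>v. Ck_on k (\<lambda>x. fderiv f x v) S)"
    using f'(1) by (auto simp: differentiable_def)
next
  assume "(\<forall>x\<in>S. f differentiable (at x)) \<and> (\<forall>v. Ck_on k (\<lambda>x. fderiv f x v) S)"
  then show "Ck_on (Suc k) f S"
    by (auto intro!: exI[of _ "\<lambda>x. fderiv f x"] simp: frechet_derivative_works[symmetric])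
qed

lemma Ck_on_SucD: "Ck_on (Suc k) f S \<Longrightarrow> Ck_on k f S"
proof (induction k arbitrary: f)
  case 0
  then show ?case
    using has_derivative_continuous by (auto intro!: continuous_at_imp_continuous_on; blast)
next
  case (Suc k)
  then show ?case by (metis Ck_on.simps(2))
qed

lemma Ck_on_const: "Ck_on k (\<lambda>x. c) S"
proof (induction k arbitrary: c)
  case (Suc k)
  then show ?case by (auto intro!: exI[of _ "\<lambda>x v. 0"] has_derivative_const)
qed simp

lemma Ck_on_bounded_linear:
  assumes "bounded_linear f"
  shows "Ck_on k f S"
proof (cases k)
  case 0
  then show ?thesis using assms by (simp add: linear_continuous_on)
next
  case (Suc m)
  then show ?thesis
    using bounded_linear_imp_has_derivative[OF assms] Ck_on_const by (auto intro!: exI[of _ "\<lambda>x. f"])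
qed

lemma Ck_on_add: "Ck_on k f S \<Longrightarrow> Ck_on k g S \<Longrightarrow> Ck_on k (\<lambda>x. f x + g x) S"
proof (induction k arbitrary: f g)
  case 0
  then show ?case by (simp add: continuous_on_add)
next
  case (Suc k)
  then obtain f' g' where
    "\<And>x. x \<in> S \<Longrightarrow> (f has_derivative f' x) (at x)" "\<And>v. Ck_on k (\<lambda>x. f' x v) S"
    "\<And>x. x \<in> S \<Longrightarrow> (g has_derivative g' x) (at x)" "\<And>v. Ck_on k (\<lambda>x. g' x v) S"
    by (simp only: Ck_on.simps) metis
  then show ?case
    using Suc.IH by (auto intro!: exI[of _ "\<lambda>x v. f' x v + g' x v"] has_derivative_add)
qed

lemma Ck_on_sum:
  "(\<And>i. i \<in> I \<Longrightarrow> Ck_on k (f i) S) \<Longrightarrow> Ck_on k (\<lambda>x. \<Sum>i\<in>I. f i x) S"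
  by (induction I rule: infinite_finite_induct) (auto simp: Ck_on_const intro: Ck_on_add)

lemma Ck_on_bilinear:
  assumes "bounded_bilinear pr"
  shows "Ck_on k f S \<Longrightarrow> Ck_on k g S \<Longrightarrow> Ck_on k (\<lambda>x. pr (f x) (g x)) S"
proof (induction k arbitrary: f g)
  case 0
  then show ?case using bounded_bilinear.continuous_on[OF assms] by simp
next
  case (Suc k)
  then obtain f' g' where *:
    "\<And>x. x \<in> S \<Longrightarrow> (f has_derivative f' x) (at x)" "\<And>v. Ck_on k (\<lambda>x. f' x v) S"
    "\<And>x. x \<in> S \<Longrightarrow> (g has_derivative g' x) (at x)" "\<And>v. Ck_on k (\<lambda>x. g' x v) S"
    by (simp only: Ck_on.simps) metis
  \<comment> \<open>Leibniz' rule pairs each derivative with the other function itself, so the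
    induction hypothesis is needed for f and g at the lower level too.\<close>
  have "Ck_on k f S" "Ck_on k g S"
    using Suc.prems Ck_on_SucD by blast+
  then have "Ck_on k (\<lambda>x. pr (f x) (g' x v) + pr (f' x v) (g x)) S" for v
    using Suc.IH * by (intro Ck_on_add) auto
  moreover have "((\<lambda>x. pr (f x) (g x)) has_derivative (\<lambda>v. pr (f x) (g' x v) + pr (f' x v) (g x))) (at x)"
    if "x \<in> S" for x
    using bounded_bilinear.FDERIV[OF assms *(1,3)] that by blast
  ultimately show ?case
    by (auto intro!: exI[of _ "\<lambda>x v. pr (f x) (g' x v) + pr (f' x v) (g x)"])
qed

lemma linear_eq_sum_Basis:
  fixes L :: "'b::euclidean_space \<Rightarrow> 'c::real_vector"
  assumes "linear L"
  shows "L v = (\<Sum>b\<in>Basis. (v \<bullet> b) *\<^sub>R L b)"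
proof -
  have "L v = L (\<Sum>b\<in>Basis. (v \<bullet> b) *\<^sub>R b)"
    by (simp add: euclidean_representation)
  also have "\<dots> = (\<Sum>b\<in>Basis. (v \<bullet> b) *\<^sub>R L b)"
    using assms by (simp add: linear_sum linear_cmul)
  finally show ?thesis .
qed

text \<open>\<open>Ck_on\<close> controls a derivative only in a fixed direction, whereas the chain
  rule gives g'(f x) applied to a direction that moves with x. Expanding that direction in a basis
  reduces to fixed directions with varying scalar coefficients; hence the Euclidean space in the
  middle.\<close>

lemma Ck_on_compose:
  fixes g :: "'b::euclidean_space \<Rightarrow> 'c::real_normed_vector" and f :: "'a::real_normed_vector \<Rightarrow> 'b"
  shows "Ck_on k g T \<Longrightarrow> Ck_on k f S \<Longrightarrow> f ` S \<subseteq> T \<Longrightarrow> Ck_on k (\<lambda>x. g (f x)) S"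
proof (induction k arbitrary: g)
  case 0
  then show ?case
    using continuous_on_compose2[of T g S f] by simp
next
  case (Suc k)
  then obtain f' g' where *:
    "\<And>x. x \<in> S \<Longrightarrow> (f has_derivative f' x) (at x)" "\<And>v. Ck_on k (\<lambda>x. f' x v) S"
    "\<And>x. x \<in> T \<Longrightarrow> (g has_derivative g' x) (at x)" "\<And>v. Ck_on k (\<lambda>x. g' x v) T"
    by (simp only: Ck_on.simps) metis
  have f: "Ck_on k f S"
    using Suc.prems Ck_on_SucD by blast
  have "Ck_on k (\<lambda>x. \<Sum>b\<in>Basis. (f' x v \<bullet> b) *\<^sub>R g' (f x) b) S" for v
  proof (intro Ck_on_sum Ck_on_bilinear[OF bounded_bilinear_scaleR] Ck_on_bilinear[OF bounded_bilinear_inner])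
    show "Ck_on k (\<lambda>x. g' (f x) b) S" for b
      using Suc.IH[OF *(4) f Suc.prems(3)] .
  qed (simp_all add: * Ck_on_const)
  moreover have "((\<lambda>x. g (f x)) has_derivative (\<lambda>v. \<Sum>b\<in>Basis. (f' x v \<bullet> b) *\<^sub>R g' (f x) b)) (at x)"
    if "x \<in> S" for x
  proof -
    have "f x \<in> T" using Suc.prems that by blast
    then have "((\<lambda>x. g (f x)) has_derivative (\<lambda>v. g' (f x) (f' x v))) (at x)"
      using diff_chain_at[OF *(1)[OF that] *(3)] by (simp add: o_def)
    moreover have "linear (g' (f x))"
      using *(3)[OF \<open>f x \<in> T\<close>] has_derivative_linear by blast
    then have "(\<lambda>v. g' (f x) (f' x v)) = (\<lambda>v. \<Sum>b\<in>Basis. (f' x v \<bullet> b) *\<^sub>R g' (f x) b)"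
      using linear_eq_sum_Basis by blast
    ultimately show ?thesis by simp
  qed
  ultimately show ?case
    by (auto intro!: exI[of _ "\<lambda>x v. \<Sum>b\<in>Basis. (f' x v \<bullet> b) *\<^sub>R g' (f x) b"])
qed

section \<open>Smooth maps\<close>

lemma smooth_on_mono: "smooth_on f S \<Longrightarrow> T \<subseteq> S \<Longrightarrow> smooth_on f T"
  by (auto simp: smooth_on_def intro: Ck_on_mono)

lemma smooth_on_cong: "open S \<Longrightarrow> smooth_on f S \<Longrightarrow> (\<And>x. x \<in> S \<Longrightarrow> f x = g x) \<Longrightarrow> smooth_on g S"
  unfolding smooth_on_def using Ck_on_cong by blast

lemma smooth_on_differentiable: "smooth_on f S \<Longrightarrow> x \<in> S \<Longrightarrow> f differentiable (at x)"
  unfolding smooth_on_def differentiable_def by (metis Ck_on.simps(2))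

lemma smooth_on_has_derivative: "smooth_on f S \<Longrightarrow> x \<in> S \<Longrightarrow> (f has_derivative fderiv f x) (at x)"
  using smooth_on_differentiable frechet_derivative_works by blast

lemma smooth_on_imp_continuous_on: "smooth_on f S \<Longrightarrow> continuous_on S f"
  unfolding smooth_on_def by (metis Ck_on.simps(1))

lemma smooth_on_fderiv: "open S \<Longrightarrow> smooth_on f S \<Longrightarrow> smooth_on (\<lambda>x. fderiv f x v) S"
  unfolding smooth_on_def by (metis Ck_on_Suc_iff)

lemma smooth_on_const: "smooth_on (\<lambda>x. c) S"
  by (simp add: smooth_on_def Ck_on_const)

lemma smooth_on_bounded_linear: "bounded_linear f \<Longrightarrow> smooth_on f S"
  by (simp add: smooth_on_def Ck_on_bounded_linear)

lemma smooth_on_add: "smooth_on f S \<Longrightarrow> smooth_on g S \<Longrightarrow> smooth_on (\<lambda>x. f x + g x) S"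
  by (simp add: smooth_on_def Ck_on_add)

lemma smooth_on_bilinear:
  "bounded_bilinear pr \<Longrightarrow> smooth_on f S \<Longrightarrow> smooth_on g S \<Longrightarrow> smooth_on (\<lambda>x. pr (f x) (g x)) S"
  by (simp add: smooth_on_def Ck_on_bilinear)

lemma smooth_on_sum:
  "(\<And>i. i \<in> I \<Longrightarrow> smooth_on (f i) S) \<Longrightarrow> smooth_on (\<lambda>x. \<Sum>i\<in>I. f i x) S"
  by (simp add: smooth_on_def Ck_on_sum)

lemma smooth_on_compose:
  fixes g :: "'b::euclidean_space \<Rightarrow> 'c::real_normed_vector"
  shows "smooth_on g T \<Longrightarrow> smooth_on f S \<Longrightarrow> f ` S \<subseteq> T \<Longrightarrow> smooth_on (\<lambda>x. g (f x)) S"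
  unfolding smooth_on_def using Ck_on_compose[of _ g T f S] by blast

lemma smooth_on_linear_compose:
  fixes f :: "'a::real_normed_vector \<Rightarrow> 'b::euclidean_space"
  shows "bounded_linear L \<Longrightarrow> smooth_on f S \<Longrightarrow> smooth_on (\<lambda>x. L (f x)) S"
  using smooth_on_compose[OF smooth_on_bounded_linear[of L UNIV]] by blast

lemma smooth_on_scaleR:
  "smooth_on f S \<Longrightarrow> smooth_on g S \<Longrightarrow> smooth_on (\<lambda>x. f x *\<^sub>R g x) S"
  by (rule smooth_on_bilinear[OF bounded_bilinear_scaleR])

lemma smooth_on_diff: "smooth_on f S \<Longrightarrow> smooth_on g S \<Longrightarrow> smooth_on (\<lambda>x. f x - g x) S"
  using smooth_on_add[of f S "\<lambda>x. (-1) *\<^sub>R g x"] smooth_on_scaleR[OF smooth_on_const, of g S "-1"] by simp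

lemma smooth_on_fst:
  fixes f :: "'a::real_normed_vector \<Rightarrow> 'b::euclidean_space \<times> 'c::euclidean_space"
  shows "smooth_on f S \<Longrightarrow> smooth_on (\<lambda>x. fst (f x)) S"
  by (rule smooth_on_linear_compose[OF bounded_linear_fst])

lemma smooth_on_snd:
  fixes f :: "'a::real_normed_vector \<Rightarrow> 'b::euclidean_space \<times> 'c::euclidean_space"
  shows "smooth_on f S \<Longrightarrow> smooth_on (\<lambda>x. snd (f x)) S"
  by (rule smooth_on_linear_compose[OF bounded_linear_snd])

lemma smooth_on_Pair:
  fixes f :: "'a::real_normed_vector \<Rightarrow> 'b::euclidean_space" and g :: "'a \<Rightarrow> 'c::euclidean_space"
  assumes "smooth_on f S" "smooth_on g S"
  shows "smooth_on (\<lambda>x. (f x, g x)) S"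
proof -
  have "bounded_linear (\<lambda>x::'b. (x, 0::'c))" "bounded_linear (\<lambda>x::'c. (0::'b, x))"
    by (simp_all add: bounded_linear_Pair bounded_linear_ident bounded_linear_zero)
  then have "smooth_on (\<lambda>x. (f x, 0) + (0, g x)) S"
    using smooth_on_linear_compose[of "\<lambda>x::'b. (x, 0::'c)" f] smooth_on_linear_compose[of "\<lambda>x::'c. (0::'b, x)" g]
    assms by (intro smooth_on_add) auto
  then show ?thesis by simp
qed

lemma linear_fderiv: "smooth_on f S \<Longrightarrow> x \<in> S \<Longrightarrow> linear (fderiv f x)"
  using smooth_on_differentiable linear_frechet_derivative by blast

lemma smooth_on_fderiv_apply:
  fixes f :: "'a::euclidean_space \<Rightarrow> 'b::real_normed_vector"
  assumes "open S" "smooth_on f S" "smooth_on g S"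
  shows "smooth_on (\<lambda>x. fderiv f x (g x)) S"
proof (rule smooth_on_cong[OF assms(1)])
  show "smooth_on (\<lambda>x. \<Sum>b\<in>Basis. (g x \<bullet> b) *\<^sub>R fderiv f x b) S"
    using assms
    by (intro smooth_on_sum smooth_on_scaleR smooth_on_fderiv smooth_on_bilinear[OF bounded_bilinear_inner]
        smooth_on_const)
next
  fix x assume "x \<in> S"
  then show "(\<Sum>b\<in>Basis. (g x \<bullet> b) *\<^sub>R fderiv f x b) = fderiv f x (g x)"
    using linear_eq_sum_Basis[OF linear_fderiv[OF assms(2)], of x "g x"] by simp
qed

section \<open>Rules for first and second derivatives\<close>

lemma fderiv_const: "fderiv (\<lambda>x. c) x v = 0"
  by (simp add: fderiv_eq[OF has_derivative_const])

lemma fderiv_add: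
  "f differentiable (at x) \<Longrightarrow> g differentiable (at x) \<Longrightarrow>
    fderiv (\<lambda>x. f x + g x) x v = fderiv f x v + fderiv g x v"
  by (simp add: frechet_derivative_works fderiv_eq[OF has_derivative_add])

lemma fderiv_diff:
  "f differentiable (at x) \<Longrightarrow> g differentiable (at x) \<Longrightarrow>
    fderiv (\<lambda>x. f x - g x) x v = fderiv f x v - fderiv g x v"
  by (simp add: frechet_derivative_works fderiv_eq[OF has_derivative_diff])

lemma fderiv_scaleR:
  "f differentiable (at x) \<Longrightarrow> g differentiable (at x) \<Longrightarrow>
    fderiv (\<lambda>x. f x *\<^sub>R g x) x v = f x *\<^sub>R fderiv g x v + fderiv f x v *\<^sub>R g x"
  by (simp add: frechet_derivative_works fderiv_eq[OF has_derivative_scaleR])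

lemma fderiv_linear:
  "bounded_linear L \<Longrightarrow> f differentiable (at x) \<Longrightarrow> fderiv (\<lambda>x. L (f x)) x v = L (fderiv f x v)"
  by (simp add: frechet_derivative_works fderiv_eq[OF bounded_linear.has_derivative])

lemma fderiv_compose:
  "g differentiable (at x) \<Longrightarrow> f differentiable (at (g x)) \<Longrightarrow>
    fderiv (\<lambda>x. f (g x)) x v = fderiv f (g x) (fderiv g x v)"
  using frechet_derivative_compose[of g x f] by (simp add: o_def fun_eq_iff)

lemma fderiv_fst:
  "f differentiable (at x) \<Longrightarrow> fderiv (\<lambda>x. fst (f x)) x v = fst (fderiv f x v)"
  by (rule fderiv_linear[OF bounded_linear_fst])

lemma fderiv_Pair:
  "f differentiable (at x) \<Longrightarrow> g differentiable (at x) \<Longrightarrow>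
    fderiv (\<lambda>x. (f x, g x)) x v = (fderiv f x v, fderiv g x v)"
  by (simp add: frechet_derivative_works fderiv_eq[OF has_derivative_Pair])

text \<open>Product rule for a derivative applied to a moving vector: first the base point varies
  with the vector frozen, then the vector with the base point frozen. The inner map \<phi> is kept
  general for the tangent bundle, where it is the projection \<open>fst\<close> to the base
  coordinates.\<close>

lemma fderiv_fderiv_apply:
  fixes f :: "'a::euclidean_space \<Rightarrow> 'b::real_normed_vector" and w :: "'c::real_normed_vector \<Rightarrow> 'a"
  assumes S: "open S" "smooth_on f S" "smooth_on \<phi> T" "open T" "x \<in> T" "\<phi> ` T \<subseteq> S"
    and w: "w differentiable (at x)"
  shows "fderiv (\<lambda>q. fderiv f (\<phi> q) (w q)) x v =
    fderiv (\<lambda>q. fderiv f (\<phi> q) (w x)) x v + fderiv f (\<phi> x) (fderiv w x v)"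
proof -
  have \<phi>x: "\<phi> x \<in> S" using S by blast
  have lin: "fderiv f (\<phi> y) u = (\<Sum>b\<in>Basis. (u \<bullet> b) *\<^sub>R fderiv f (\<phi> y) b)" if "y \<in> T" for y u
    using linear_eq_sum_Basis[OF linear_fderiv[OF S(2)]] S that by blast
  have sm: "smooth_on (\<lambda>q. fderiv f (\<phi> q) b) T" for b
    using smooth_on_compose[OF smooth_on_fderiv[OF S(1,2)] S(3) S(6)] by simp
  have D: "((\<lambda>q. fderiv f (\<phi> q) b) has_derivative fderiv (\<lambda>q. fderiv f (\<phi> q) b) x) (at x)" for b
    using smooth_on_has_derivative[OF sm S(5)] .
  have W: "(w has_derivative fderiv w x) (at x)"
    using w frechet_derivative_works by blast
  have *: "((\<lambda>q. \<Sum>b\<in>Basis. (w' q \<bullet> b) *\<^sub>R fderiv f (\<phi> q) b) has_derivative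
      (\<lambda>v. \<Sum>b\<in>Basis. (w' x \<bullet> b) *\<^sub>R fderiv (\<lambda>q. fderiv f (\<phi> q) b) x v + (W' v \<bullet> b) *\<^sub>R fderiv f (\<phi> x) b)) (at x)"
    if "(w' has_derivative W') (at x)" for w' W'
    by (intro has_derivative_sum has_derivative_scaleR has_derivative_inner_left that D)
  have **: "fderiv (\<lambda>q. fderiv f (\<phi> q) (w' q)) x v =
      (\<Sum>b\<in>Basis. (w' x \<bullet> b) *\<^sub>R fderiv (\<lambda>q. fderiv f (\<phi> q) b) x v) + fderiv f (\<phi> x) (W' v)"
    if "(w' has_derivative W') (at x)" for w' W'
  proof -
    have "fderiv (\<lambda>q. fderiv f (\<phi> q) (w' q)) x v =
      fderiv (\<lambda>q. \<Sum>b\<in>Basis. (w' q \<bullet> b) *\<^sub>R fderiv f (\<phi> q) b) x v"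
      by (rule arg_cong[where f="\<lambda>g. g v"], rule fderiv_cong[OF S(4,5)]) (rule lin)
    then show ?thesis
      using fderiv_eq[OF *[OF that]] lin[OF S(5), of "W' v"] by (simp add: sum.distrib)
  qed
  show ?thesis
    using **[OF W] **[OF has_derivative_const[of "w x"]] linear_0[OF linear_fderiv[OF S(2) \<phi>x]] by simp
qed

lemma fderiv_fderiv_apply_id:
  fixes f :: "'a::euclidean_space \<Rightarrow> 'b::real_normed_vector"
  assumes "open S" "smooth_on f S" "x \<in> S" "w differentiable (at x)"
  shows "fderiv (\<lambda>q. fderiv f q (w q)) x v =
    fderiv (\<lambda>q. fderiv f q (w x)) x v + fderiv f x (fderiv w x v)"
  using fderiv_fderiv_apply[of S f "\<lambda>x. x" S x w v] assms
    smooth_on_bounded_linear[OF bounded_linear_ident, of S]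
  by simp

lemma fderiv_symmetric_real:
  fixes f :: "'a::real_normed_vector \<Rightarrow> real"
  assumes S: "open S" "x \<in> S" and f: "smooth_on f S"
  shows "fderiv (\<lambda>q. fderiv f q u) x v = fderiv (\<lambda>q. fderiv f q v) x u"
proof -
  \<comment> \<open>both mixed derivatives are limits of the same second difference quotient\<close>
  have second_diff: "\<exists>a b. 0 < a \<and> a < t \<and> 0 < b \<and> b < t \<and>
      f (x + t *\<^sub>R u + t *\<^sub>R v) - f (x + t *\<^sub>R u) - (f (x + t *\<^sub>R v) - f x) =
      t * (t * fderiv (\<lambda>q. fderiv f q u) (x + a *\<^sub>R u + b *\<^sub>R v) v)"
    if t: "0 < t" and in_S: "\<And>a b. 0 \<le> a \<Longrightarrow> a \<le> t \<Longrightarrow> 0 \<le> b \<Longrightarrow> b \<le> t \<Longrightarrow> x + a *\<^sub>R u + b *\<^sub>R v \<in> S"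
    for t u v
  proof -
    have line: "((\<lambda>s. p + s *\<^sub>R w) has_derivative (\<lambda>h. h *\<^sub>R w)) (at s)" for p w :: 'a and s :: real
      by (auto intro!: derivative_eq_intros)
    have "\<exists>a. 0 < a \<and> a < t \<and> (f (x + t *\<^sub>R u + t *\<^sub>R v) - f (x + t *\<^sub>R u)) -
        (f (x + 0 *\<^sub>R u + t *\<^sub>R v) - f (x + 0 *\<^sub>R u)) =
        (t - 0) * (fderiv f (x + a *\<^sub>R u + t *\<^sub>R v) u - fderiv f (x + a *\<^sub>R u) u)"
    proof (rule MVT2[OF t])
      fix s assume s: "0 \<le> s" "s \<le> t"
      have 1: "x + s *\<^sub>R u + t *\<^sub>R v \<in> S" and 2: "x + s *\<^sub>R u \<in> S"
        using in_S[OF s, of t] in_S[OF s, of 0] t by auto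
      have 3: "((\<lambda>s. x + s *\<^sub>R u + t *\<^sub>R v) has_derivative (\<lambda>h. h *\<^sub>R u)) (at s)"
        by (auto intro!: derivative_eq_intros)
      have "((\<lambda>s. f (x + s *\<^sub>R u + t *\<^sub>R v) - f (x + s *\<^sub>R u)) has_derivative
          (\<lambda>h. fderiv f (x + s *\<^sub>R u + t *\<^sub>R v) (h *\<^sub>R u) - fderiv f (x + s *\<^sub>R u) (h *\<^sub>R u))) (at s)"
        using diff_chain_at[OF 3 smooth_on_has_derivative[OF f 1]]
          diff_chain_at[OF line smooth_on_has_derivative[OF f 2]]
        by (intro has_derivative_diff) (simp_all add: o_def)
      moreover have "fderiv f (x + s *\<^sub>R u + t *\<^sub>R v) (h *\<^sub>R u) - fderiv f (x + s *\<^sub>R u) (h *\<^sub>R u) =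
          (fderiv f (x + s *\<^sub>R u + t *\<^sub>R v) u - fderiv f (x + s *\<^sub>R u) u) * h" for h
        using linear_cmul[OF linear_fderiv[OF f 1], of h u] linear_cmul[OF linear_fderiv[OF f 2], of h u]
        by (simp add: algebra_simps)
      ultimately show "((\<lambda>s. f (x + s *\<^sub>R u + t *\<^sub>R v) - f (x + s *\<^sub>R u)) has_real_derivative
          (fderiv f (x + s *\<^sub>R u + t *\<^sub>R v) u - fderiv f (x + s *\<^sub>R u) u)) (at s)"
        by (simp add: has_field_derivative_def)
    qed
    then obtain a where a: "0 < a" "a < t" "f (x + t *\<^sub>R u + t *\<^sub>R v) - f (x + t *\<^sub>R u) - (f (x + t *\<^sub>R v) - f x) =
        t * (fderiv f (x + a *\<^sub>R u + t *\<^sub>R v) u - fderiv f (x + a *\<^sub>R u) u)"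
      by auto
    have g: "smooth_on (\<lambda>q. fderiv f q u) S"
      using smooth_on_fderiv S f by blast
    have "\<exists>b. 0 < b \<and> b < t \<and> fderiv f (x + a *\<^sub>R u + t *\<^sub>R v) u - fderiv f (x + a *\<^sub>R u + 0 *\<^sub>R v) u =
        (t - 0) * fderiv (\<lambda>q. fderiv f q u) (x + a *\<^sub>R u + b *\<^sub>R v) v"
    proof (rule MVT2[OF t])
      fix s assume s: "0 \<le> s" "s \<le> t"
      have 1: "x + a *\<^sub>R u + s *\<^sub>R v \<in> S"
        using in_S a s by auto
      show "((\<lambda>s. fderiv f (x + a *\<^sub>R u + s *\<^sub>R v) u) has_real_derivative
          fderiv (\<lambda>q. fderiv f q u) (x + a *\<^sub>R u + s *\<^sub>R v) v) (at s)"
        using diff_chain_at[OF line smooth_on_has_derivative[OF g 1]]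
          linear_cmul[OF linear_fderiv[OF g 1]]
        by (simp add: has_field_derivative_def o_def mult.commute[of _ "fderiv _ _ _"])
    qed
    then show ?thesis using a by auto
  qed
  define F where "F = (\<lambda>u v q. fderiv (\<lambda>q. fderiv f q u) q v)"
  have cont: "continuous (at x) (F u v)" for u v
    using smooth_on_imp_continuous_on[OF smooth_on_fderiv[OF S(1) smooth_on_fderiv[OF S(1) f]]] S
    by (simp add: F_def continuous_on_eq_continuous_at)
  have close: "\<exists>d>0. \<forall>q. dist q x < d \<longrightarrow> dist (F u v q) (F u v x) < e" if "e > 0" for u v e
    using cont that unfolding continuous_at by (simp add: LIM_def) (metis dist_self)
  have "\<bar>F u v x - F v u x\<bar> < e" if e: "e > 0" for e
  proof -
    obtain d1 d2 d3 where d: "d1 > 0" "d2 > 0" "d3 > 0"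
      "\<And>q. dist q x < d1 \<Longrightarrow> dist (F u v q) (F u v x) < e / 2"
      "\<And>q. dist q x < d2 \<Longrightarrow> dist (F v u q) (F v u x) < e / 2"
      "\<And>q. dist q x < d3 \<Longrightarrow> q \<in> S"
      using close[of "e/2"] e S by (metis half_gt_zero open_dist)
    define d where "d = min d1 (min d2 d3)"
    \<comment> \<open>Every point of the parallelogram spanned by t u and t v is then within d of x;
      the summand 1 keeps the denominator positive when u and v vanish.\<close>
    define t where "t = d / (2 * (norm u + norm v + 1))"
    have dpos: "d > 0" using d by (simp add: d_def)
    have n: "norm u + norm v + 1 > 0"
      using norm_ge_zero[of u] norm_ge_zero[of v] by linarith
    have tpos: "t > 0" using dpos n by (simp add: t_def)
    have near: "dist (x + a *\<^sub>R u + b *\<^sub>R v) x < d" if "0 \<le> a" "a \<le> t" "0 \<le> b" "b \<le> t" for a b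
    proof -
      have "dist (x + a *\<^sub>R u + b *\<^sub>R v) x \<le> a * norm u + b * norm v"
        using norm_triangle_ineq[of "a *\<^sub>R u" "b *\<^sub>R v"] that by (simp add: dist_norm)
      also have "\<dots> \<le> t * norm u + t * norm v"
        using that by (intro add_mono mult_right_mono) auto
      also have "\<dots> < t * (2 * (norm u + norm v + 1))"
        using tpos n by (simp add: algebra_simps add_nonneg_pos)
      also have "\<dots> = d" using n by (simp add: t_def)
      finally show ?thesis .
    qed
    have near': "dist (x + a *\<^sub>R v + b *\<^sub>R u) x < d" if "0 \<le> a" "a \<le> t" "0 \<le> b" "b \<le> t" for a b
      using near[of b a] that by (simp add: ac_simps)
    have inS: "x + a *\<^sub>R u + b *\<^sub>R v \<in> S" "x + a *\<^sub>R v + b *\<^sub>R u \<in> S"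
      if "0 \<le> a" "a \<le> t" "0 \<le> b" "b \<le> t" for a b
      using near near' that d by (auto simp: d_def)
    obtain a b where ab: "0 < a" "a < t" "0 < b" "b < t"
      "f (x + t *\<^sub>R u + t *\<^sub>R v) - f (x + t *\<^sub>R u) - (f (x + t *\<^sub>R v) - f x) =
        t * (t * F u v (x + a *\<^sub>R u + b *\<^sub>R v))"
      using second_diff[OF tpos inS(1)] unfolding F_def by blast
    obtain a' b' where ab': "0 < a'" "a' < t" "0 < b'" "b' < t"
      "f (x + t *\<^sub>R v + t *\<^sub>R u) - f (x + t *\<^sub>R v) - (f (x + t *\<^sub>R u) - f x) =
        t * (t * F v u (x + a' *\<^sub>R v + b' *\<^sub>R u))"
      using second_diff[OF tpos inS(2)] unfolding F_def by blast
    have "t * (t * F u v (x + a *\<^sub>R u + b *\<^sub>R v)) = t * (t * F v u (x + a' *\<^sub>R v + b' *\<^sub>R u))"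
      using ab(5) ab'(5) by (simp add: algebra_simps)
    then have "F u v (x + a *\<^sub>R u + b *\<^sub>R v) = F v u (x + a' *\<^sub>R v + b' *\<^sub>R u)"
      using tpos by simp
    moreover have "dist (F u v (x + a *\<^sub>R u + b *\<^sub>R v)) (F u v x) < e / 2"
      using d(4)[of "x + a *\<^sub>R u + b *\<^sub>R v"] near[of a b] ab by (simp add: d_def)
    moreover have "dist (F v u (x + a' *\<^sub>R v + b' *\<^sub>R u)) (F v u x) < e / 2"
      using d(5)[of "x + a' *\<^sub>R v + b' *\<^sub>R u"] near'[of a' b'] ab' by (simp add: d_def)
    ultimately show ?thesis
      unfolding dist_real_def by linarith
  qed
  then have "\<bar>F u v x - F v u x\<bar> \<le> 0"
    by (meson dense_ge less_imp_le)
  then show ?thesis by (simp add: F_def)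
qed

lemma fderiv_symmetric:
  fixes f :: "'a::real_normed_vector \<Rightarrow> 'b::euclidean_space"
  assumes S: "open S" "x \<in> S" and f: "smooth_on f S"
  shows "fderiv (\<lambda>q. fderiv f q u) x v = fderiv (\<lambda>q. fderiv f q v) x u"
proof (rule euclidean_eqI)
  fix b :: 'b assume "b \<in> Basis"
  have fb: "smooth_on (\<lambda>q. f q \<bullet> b) S"
    using f by (intro smooth_on_linear_compose[OF bounded_linear_inner_left])
  have 1: "fderiv (\<lambda>q. f q \<bullet> b) q u = fderiv f q u \<bullet> b" if "q \<in> S" for q u
    using fderiv_linear[OF bounded_linear_inner_left smooth_on_differentiable[OF f that]] by simp
  have 2: "fderiv (\<lambda>q. fderiv (\<lambda>q. f q \<bullet> b) q u) x v = fderiv (\<lambda>q. fderiv f q u) x v \<bullet> b" for u v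
  proof -
    have "fderiv (\<lambda>q. fderiv (\<lambda>q. f q \<bullet> b) q u) x v = fderiv (\<lambda>q. fderiv f q u \<bullet> b) x v"
      by (rule arg_cong[where f="\<lambda>g. g v"], rule fderiv_cong[OF S]) (rule 1)
    also have "\<dots> = fderiv (\<lambda>q. fderiv f q u) x v \<bullet> b"
      by (rule fderiv_linear[OF bounded_linear_inner_left])
        (rule smooth_on_differentiable[OF smooth_on_fderiv[OF S(1) f] S(2)])
    finally show ?thesis .
  qed
  show "fderiv (\<lambda>q. fderiv f q u) x v \<bullet> b = fderiv (\<lambda>q. fderiv f q v) x u \<bullet> b"
    using fderiv_symmetric_real[OF S fb] 2 by metis
qed

section \<open>Brackets in coordinates\<close>

definition br :: "('a::real_normed_vector \<Rightarrow> 'a) \<Rightarrow> ('a \<Rightarrow> 'a) \<Rightarrow> 'a \<Rightarrow> 'a" where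
  "br X Y x = fderiv Y x (X x) - fderiv X x (Y x)"

lemma br_cong:
  assumes "open S" "x \<in> S" "\<And>y. y \<in> S \<Longrightarrow> X y = X' y" "\<And>y. y \<in> S \<Longrightarrow> Y y = Y' y"
  shows "br X Y x = br X' Y' x"
  using fderiv_cong[OF assms(1,2,3)] fderiv_cong[OF assms(1,2,4)] assms
  by (simp add: br_def)

lemma smooth_on_br:
  fixes X :: "'a::euclidean_space \<Rightarrow> 'a"
  assumes "open S" "smooth_on X S" "smooth_on Y S"
  shows "smooth_on (br X Y) S"
  unfolding br_def[abs_def] using assms by (intro smooth_on_diff smooth_on_fderiv_apply)

text \<open>Related fields have related brackets, for any smooth \<phi>, invertible or not:
  differentiating the two relations produces the second derivative of \<phi> on the pair X x, Y x,
  which is symmetric and drops out of the commutator.\<close>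

lemma br_transform:
  fixes \<phi> :: "'a::euclidean_space \<Rightarrow> 'b::euclidean_space"
  assumes S: "open S" "x \<in> S" and smooth: "smooth_on \<phi> S" "smooth_on X S" "smooth_on Y S"
    and diff: "X' differentiable (at (\<phi> x))" "Y' differentiable (at (\<phi> x))"
    and rel: "\<And>q. q \<in> S \<Longrightarrow> X' (\<phi> q) = fderiv \<phi> q (X q)" "\<And>q. q \<in> S \<Longrightarrow> Y' (\<phi> q) = fderiv \<phi> q (Y q)"
  shows "br X' Y' (\<phi> x) = fderiv \<phi> x (br X Y x)"
proof -
  have *: "fderiv Y' (\<phi> x) (fderiv \<phi> x v) = fderiv (\<lambda>q. fderiv \<phi> q (Y x)) x v + fderiv \<phi> x (fderiv Y x v)"
    if "smooth_on Y S" "Y' differentiable (at (\<phi> x))" "\<And>q. q \<in> S \<Longrightarrow> Y' (\<phi> q) = fderiv \<phi> q (Y q)"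
    for Y Y' v
  proof -
    have "fderiv Y' (\<phi> x) (fderiv \<phi> x v) = fderiv (\<lambda>q. Y' (\<phi> q)) x v"
      using fderiv_compose[OF smooth_on_differentiable[OF smooth(1) S(2)] that(2)] by simp
    also have "\<dots> = fderiv (\<lambda>q. fderiv \<phi> q (Y q)) x v"
      by (rule arg_cong[where f="\<lambda>g. g v"], rule fderiv_cong[OF S]) (rule that(3))
    finally show ?thesis
      using fderiv_fderiv_apply_id[OF S(1) smooth(1) S(2) smooth_on_differentiable[OF that(1) S(2)]] by simp
  qed
  show ?thesis
    using *[OF smooth(3) diff(2) rel(2), of "X x"] *[OF smooth(2) diff(1) rel(1), of "Y x"]
      fderiv_symmetric[OF S smooth(1), of "X x" "Y x"] linear_diff[OF linear_fderiv[OF smooth(1) S(2)]]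
    by (simp add: br_def rel S)
qed

text \<open>After expansion each field occurs with its second derivative twice and with opposite
  signs, equal by symmetry; the compositions of first derivatives cancel by linearity.\<close>

lemma br_Jacobi:
  fixes X Y Z :: "'a::euclidean_space \<Rightarrow> 'a"
  assumes S: "open S" "x \<in> S" and smooth: "smooth_on X S" "smooth_on Y S" "smooth_on Z S"
  shows "br X (br Y Z) x + br Y (br Z X) x + br Z (br X Y) x = 0"
proof -
  have d: "fderiv (br Y Z) x v =
      fderiv (\<lambda>q. fderiv Z q (Y x)) x v + fderiv Z x (fderiv Y x v)
      - (fderiv (\<lambda>q. fderiv Y q (Z x)) x v + fderiv Y x (fderiv Z x v))"
    if "smooth_on Y S" "smooth_on Z S" for Y Z v
  proof -
    have "fderiv (br Y Z) x v = fderiv (\<lambda>x. fderiv Z x (Y x)) x v - fderiv (\<lambda>x. fderiv Y x (Z x)) x v"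
      unfolding br_def[abs_def] using that S
      by (intro fderiv_diff smooth_on_differentiable[of _ S] smooth_on_fderiv_apply) auto
    then show ?thesis
      using fderiv_fderiv_apply_id[OF S(1) that(1) S(2) smooth_on_differentiable[OF that(2) S(2)]]
        fderiv_fderiv_apply_id[OF S(1) that(2) S(2) smooth_on_differentiable[OF that(1) S(2)]] by simp
  qed
  note lin = linear_diff[OF linear_fderiv[OF smooth(1) S(2)]] linear_diff[OF linear_fderiv[OF smooth(2) S(2)]]
    linear_diff[OF linear_fderiv[OF smooth(3) S(2)]]
  have "br X (br Y Z) x = fderiv (br Y Z) x (X x) - fderiv X x (fderiv Z x (Y x) - fderiv Y x (Z x))"
       "br Y (br Z X) x = fderiv (br Z X) x (Y x) - fderiv Y x (fderiv X x (Z x) - fderiv Z x (X x))"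
       "br Z (br X Y) x = fderiv (br X Y) x (Z x) - fderiv Z x (fderiv Y x (X x) - fderiv X x (Y x))"
    by (simp_all add: br_def)
  then show ?thesis
    using fderiv_symmetric[OF S smooth(1), of "Y x" "Z x"] fderiv_symmetric[OF S smooth(2), of "X x" "Z x"]
      fderiv_symmetric[OF S smooth(3), of "X x" "Y x"]
    by (simp add: d smooth lin)
qed

section \<open>Tangent vectors and vector fields on a manifold\<close>

locale atlas =
  fixes A :: "('a, 'e::euclidean_space) chart set"
  assumes smooth_atlas: "smooth_atlas A"
begin

abbreviation chart_image :: "('a, 'e) chart \<Rightarrow> 'a set \<Rightarrow> 'e set" where
  "chart_image c W \<equiv> snd c ` (W \<inter> fst c)"

abbreviation transition :: "('a, 'e) chart \<Rightarrow> ('a, 'e) chart \<Rightarrow> 'e \<Rightarrow> 'e" where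
  "transition c c' \<equiv> snd c' \<circ> chart_inv c"

abbreviation coord_rep :: "('a, 'e) chart \<Rightarrow> ('a \<Rightarrow> ('a, 'e) tvec) \<Rightarrow> 'e \<Rightarrow> 'e" where
  "coord_rep c X \<equiv> (\<lambda>x. X (chart_inv c x) c)"

abbreviation open_in :: "'a set \<Rightarrow> bool" where
  "open_in W \<equiv> openin (manifold_topology A) W"

text \<open>Inverse of the coordinate reading of tangent vectors in the chart c: one member of the
  family determines all the others through the coordinate changes.\<close>

definition tangent_lift :: "('a, 'e) chart \<Rightarrow> 'a \<Rightarrow> 'e \<Rightarrow> ('a, 'e) tvec" where
  "tangent_lift c p e = (\<lambda>c'. if c' \<in> charts_at A p then fderiv (transition c c') (snd c p) e else 0)"

section \<open>Charts, open sets and coordinate changes\<close>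

lemma charts_at_iff: "c \<in> charts_at A p \<longleftrightarrow> c \<in> A \<and> p \<in> fst c"
  by (simp add: charts_at_def)

lemma chart_inv_chart [simp]: "c \<in> A \<Longrightarrow> p \<in> fst c \<Longrightarrow> chart_inv c (snd c p) = p"
  using smooth_atlas by (simp add: smooth_atlas_def chart_inv_def)

lemma chart_imageD:
  assumes "c \<in> A" "x \<in> chart_image c W"
  shows "chart_inv c x \<in> W" "chart_inv c x \<in> fst c" "snd c (chart_inv c x) = x"
  using assms by auto

lemma openin_iff: "open_in W \<longleftrightarrow> W \<subseteq> carrier A \<and> (\<forall>c\<in>A. open (chart_image c W))"
  using openin_manifold_topology[OF smooth_atlas] by simp

lemma open_chart_image: "open_in W \<Longrightarrow> c \<in> A \<Longrightarrow> open (chart_image c W)"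
  by (simp add: openin_iff)

lemma open_in_chart_domain: "c \<in> A \<Longrightarrow> open_in (fst c)"
  using smooth_atlas unfolding openin_iff smooth_atlas_def carrier_def
  by (auto simp: Int_commute)

lemma chart_exists: "open_in W \<Longrightarrow> p \<in> W \<Longrightarrow> \<exists>c. c \<in> A \<and> p \<in> fst c"
  unfolding openin_iff carrier_def by blast

lemma smooth_transition:
  "c \<in> A \<Longrightarrow> c' \<in> A \<Longrightarrow> open (snd c ` (fst c \<inter> fst c')) \<and> smooth_on (transition c c') (snd c ` (fst c \<inter> fst c'))"
  using smooth_atlas by (simp add: smooth_atlas_def)

text \<open>The chain rule for f read in c as the composite of a transition with f read in c'. It
  makes directional derivatives independent of the selected chart, and with a third coordinate map
  as f it gives the cocycle rule for derivatives of transitions.\<close>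

lemma change_of_chart:
  fixes f :: "'a \<Rightarrow> 'b::real_normed_vector"
  assumes c: "c \<in> A" "c' \<in> A" "p \<in> fst c" "p \<in> fst c'"
    and diff: "(f \<circ> chart_inv c') differentiable (at (snd c' p))"
  shows "(f \<circ> chart_inv c) differentiable (at (snd c p))"
    and "fderiv (f \<circ> chart_inv c') (snd c' p) (fderiv (transition c c') (snd c p) e) =
      fderiv (f \<circ> chart_inv c) (snd c p) e"
proof -
  let ?S = "snd c ` (fst c \<inter> fst c')"
  have S: "open ?S" "snd c p \<in> ?S"
    using smooth_transition[OF c(1,2)] c by auto
  have tr: "transition c c' differentiable (at (snd c p))" "transition c c' (snd c p) = snd c' p"
    using smooth_on_differentiable smooth_transition[OF c(1,2)] S c by auto
  have eq: "(f \<circ> chart_inv c') (transition c c' x) = (f \<circ> chart_inv c) x" if "x \<in> ?S" for x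
    using that c by auto
  have "((\<lambda>x. (f \<circ> chart_inv c') (transition c c' x)) has_derivative
      (\<lambda>e. fderiv (f \<circ> chart_inv c') (snd c' p) (fderiv (transition c c') (snd c p) e))) (at (snd c p))"
    using diff_chain_at[of "transition c c'" "fderiv (transition c c') (snd c p)" "snd c p" "f \<circ> chart_inv c'"]
      diff tr unfolding frechet_derivative_works by (simp add: o_def)
  then have D: "((f \<circ> chart_inv c) has_derivative
      (\<lambda>e. fderiv (f \<circ> chart_inv c') (snd c' p) (fderiv (transition c c') (snd c p) e))) (at (snd c p))"
    by (rule has_derivative_transform_within_open[OF _ S]) (rule eq)
  show "(f \<circ> chart_inv c) differentiable (at (snd c p))"
    using D by (auto simp: differentiable_def)
  show "fderiv (f \<circ> chart_inv c') (snd c' p) (fderiv (transition c c') (snd c p) e) =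
      fderiv (f \<circ> chart_inv c) (snd c p) e"
    using fderiv_eq[OF D] by simp
qed

lemma transition_differentiable:
  "c \<in> A \<Longrightarrow> c' \<in> A \<Longrightarrow> p \<in> fst c \<Longrightarrow> p \<in> fst c' \<Longrightarrow> transition c c' differentiable (at (snd c p))"
  using smooth_on_differentiable smooth_transition by blast

lemma fderiv_transition_transition:
  assumes "c \<in> A" "c' \<in> A" "c'' \<in> A" "p \<in> fst c" "p \<in> fst c'" "p \<in> fst c''"
  shows "fderiv (transition c' c'') (snd c' p) (fderiv (transition c c') (snd c p) e) =
    fderiv (transition c c'') (snd c p) e"
  using change_of_chart(2)[of c c' p "snd c''"] transition_differentiable assms by blast

lemma fderiv_transition_self:
  assumes "c \<in> A" "p \<in> fst c"
  shows "fderiv (transition c c) (snd c p) e = e"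
proof -
  have "fderiv (transition c c) (snd c p) = fderiv (\<lambda>x. x) (snd c p)"
    using assms open_chart_image[OF open_in_chart_domain, of c c]
    by (intro fderiv_cong[of "chart_image c (fst c)"]) auto
  then show ?thesis by simp
qed

lemma linear_fderiv_transition:
  "c \<in> A \<Longrightarrow> c' \<in> A \<Longrightarrow> p \<in> fst c \<Longrightarrow> p \<in> fst c' \<Longrightarrow> linear (fderiv (transition c c') (snd c p))"
  using transition_differentiable linear_frechet_derivative by blast

section \<open>Tangent spaces\<close>

lemma tangent_off: "u \<in> tangent_space A p \<Longrightarrow> c \<notin> charts_at A p \<Longrightarrow> u c = 0"
  unfolding tangent_space_def by blast

lemma tangent_transform:
  "u \<in> tangent_space A p \<Longrightarrow> c \<in> charts_at A p \<Longrightarrow> c' \<in> charts_at A p \<Longrightarrow>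
    u c' = fderiv (transition c c') (snd c p) (u c)"
  unfolding tangent_space_def by blast

lemma tangentI:
  assumes "\<And>c. c \<notin> charts_at A p \<Longrightarrow> u c = 0"
    and "\<And>c c'. c \<in> charts_at A p \<Longrightarrow> c' \<in> charts_at A p \<Longrightarrow>
      u c' = fderiv (transition c c') (snd c p) (u c)"
  shows "u \<in> tangent_space A p"
  unfolding tangent_space_def using assms by blast

lemma tangent_lift_tangent:
  assumes "c \<in> charts_at A p"
  shows "tangent_lift c p e \<in> tangent_space A p"
proof (rule tangentI)
  show "tangent_lift c p e c'' = fderiv (transition c' c'') (snd c' p) (tangent_lift c p e c')"
    if "c' \<in> charts_at A p" "c'' \<in> charts_at A p" for c' c''
    using assms that fderiv_transition_transition[of c c' c'' p e] by (simp add: tangent_lift_def charts_at_iff)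
qed (simp add: tangent_lift_def)

lemma tangent_lift_chart: "c \<in> charts_at A p \<Longrightarrow> tangent_lift c p e c = e"
  using fderiv_transition_self by (simp add: tangent_lift_def charts_at_iff)

lemma tangent_eqI:
  assumes "u \<in> tangent_space A p" "w \<in> tangent_space A p" "c \<in> charts_at A p" "u c = w c"
  shows "u = w"
proof
  fix c'
  show "u c' = w c'"
    using tangent_transform[OF assms(1,3), of c'] tangent_transform[OF assms(2,3), of c'] assms(4)
      tangent_off[OF assms(1)] tangent_off[OF assms(2)] by (cases "c' \<in> charts_at A p") simp_all
qed

lemma tangent_lift_eq: "u \<in> tangent_space A p \<Longrightarrow> c \<in> charts_at A p \<Longrightarrow> tangent_lift c p (u c) = u"
  by (rule tangent_eqI[OF tangent_lift_tangent _ _ tangent_lift_chart]) auto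

lemma tangent_add:
  assumes "u \<in> tangent_space A p" "w \<in> tangent_space A p"
  shows "u + w \<in> tangent_space A p"
proof (rule tangentI)
  show "(u + w) c' = fderiv (transition c c') (snd c p) ((u + w) c)"
    if "c \<in> charts_at A p" "c' \<in> charts_at A p" for c c'
    using tangent_transform[OF assms(1) that] tangent_transform[OF assms(2) that] that
      linear_add[OF linear_fderiv_transition[of c c' p]] by (simp add: charts_at_iff)
qed (simp add: tangent_off[OF assms(1)] tangent_off[OF assms(2)])

lemma tangent_scaleR:
  assumes "u \<in> tangent_space A p"
  shows "r *\<^sub>R u \<in> tangent_space A p"
proof (rule tangentI)
  show "(r *\<^sub>R u) c' = fderiv (transition c c') (snd c p) ((r *\<^sub>R u) c)"
    if "c \<in> charts_at A p" "c' \<in> charts_at A p" for c c'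
    using tangent_transform[OF assms(1) that] that
      linear_cmul[OF linear_fderiv_transition[of c c' p]] by (simp add: charts_at_iff scaleR_fun_def)
qed (simp add: tangent_off[OF assms] scaleR_fun_def)

lemma tangent_zero: "0 \<in> tangent_space A p"
  using linear_0[OF linear_fderiv_transition] by (intro tangentI) (simp_all add: charts_at_iff)

lemma tangent_diff: "u \<in> tangent_space A p \<Longrightarrow> w \<in> tangent_space A p \<Longrightarrow> u - w \<in> tangent_space A p"
  using tangent_add[of u p "(-1) *\<^sub>R w"] tangent_scaleR[of w p "-1"] by simp

section \<open>Smooth vector fields and functions\<close>

lemma vector_field_tangent: "vector_field A W X \<Longrightarrow> p \<in> W \<Longrightarrow> X p \<in> tangent_space A p"
  by (simp add: vector_field_def)

lemma vector_field_smooth: "vector_field A W X \<Longrightarrow> c \<in> A \<Longrightarrow> smooth_on (coord_rep c X) (chart_image c W)"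
  by (simp add: vector_field_def)

lemma vector_fieldI:
  "(\<And>p. p \<in> W \<Longrightarrow> X p \<in> tangent_space A p) \<Longrightarrow>
    (\<And>c. c \<in> A \<Longrightarrow> smooth_on (coord_rep c X) (chart_image c W)) \<Longrightarrow> vector_field A W X"
  by (simp add: vector_field_def)

lemma vector_field_mono: "vector_field A W X \<Longrightarrow> V \<subseteq> W \<Longrightarrow> vector_field A V X"
  unfolding vector_field_def using smooth_on_mono[of _ "chart_image _ W" "chart_image _ V"] by blast

lemma vector_field_add: "vector_field A W X \<Longrightarrow> vector_field A W Y \<Longrightarrow> vector_field A W (\<lambda>p. X p + Y p)"
  by (auto simp: vector_field_def tangent_add intro: smooth_on_add)

lemma vector_field_scale:
  assumes "smooth_function A W f" "vector_field A W X"
  shows "vector_field A W (\<lambda>p. f p *\<^sub>R X p)"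
proof (rule vector_fieldI)
  show "smooth_on (coord_rep c (\<lambda>p. f p *\<^sub>R X p)) (chart_image c W)" if "c \<in> A" for c
    using smooth_on_scaleR[of "f \<circ> chart_inv c" "chart_image c W" "coord_rep c X"]
      vector_field_smooth[OF assms(2) that] assms(1) that
    by (simp add: smooth_function_def scaleR_fun_def)
qed (rule tangent_scaleR[OF vector_field_tangent[OF assms(2)]])

lemma smooth_function_const: "smooth_function A W (\<lambda>p. r)"
  by (simp add: smooth_function_def o_def smooth_on_const)

lemma vector_field_zero: "vector_field A W (\<lambda>p. 0)"
  by (simp add: vector_field_def tangent_zero smooth_on_const)

lemma vector_field_diff: "vector_field A W X \<Longrightarrow> vector_field A W Y \<Longrightarrow> vector_field A W (\<lambda>p. X p - Y p)"
  by (auto simp: vector_field_def tangent_diff intro: smooth_on_diff)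

lemma smooth_function_mono: "smooth_function A W f \<Longrightarrow> V \<subseteq> W \<Longrightarrow> smooth_function A V f"
  unfolding smooth_function_def using smooth_on_mono[of _ "chart_image _ W" "chart_image _ V"] by blast

lemma smooth_on_transition:
  assumes "c \<in> A" "c' \<in> A" "W \<subseteq> fst c'"
  shows "smooth_on (transition c c') (chart_image c W)" "transition c c' ` chart_image c W \<subseteq> chart_image c' W"
proof -
  show "smooth_on (transition c c') (chart_image c W)"
    by (rule smooth_on_mono[OF conjunct2[OF smooth_transition]]) (use assms in auto)
  show "transition c c' ` chart_image c W \<subseteq> chart_image c' W"
    using assms by auto
qed

lemma smooth_function_chartI:
  assumes W: "open_in W" "W \<subseteq> fst c" and c: "c \<in> A" and f: "smooth_on (f \<circ> chart_inv c) (chart_image c W)"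
  shows "smooth_function A W f"
  unfolding smooth_function_def
proof
  fix c' assume c': "c' \<in> A"
  have "smooth_on (\<lambda>x. (f \<circ> chart_inv c) (transition c' c x)) (chart_image c' W)"
    by (rule smooth_on_compose[OF f smooth_on_transition[OF c' c W(2)]])
  then show "smooth_on (f \<circ> chart_inv c') (chart_image c' W)"
    by (rule smooth_on_cong[OF open_chart_image[OF W(1) c']]) (use W c c' in auto)
qed

text \<open>In another chart the components are the derivative of the transition applied to F, both
  read through the transition back to c, so smoothness of F in the one chart c suffices.\<close>

lemma vector_field_tangent_lift:
  assumes W: "open_in W" "W \<subseteq> fst c" and c: "c \<in> A" and F: "smooth_on F (chart_image c W)"
  shows "vector_field A W (\<lambda>p. tangent_lift c p (F (snd c p)))"
proof (rule vector_fieldI)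
  show "tangent_lift c p (F (snd c p)) \<in> tangent_space A p" if "p \<in> W" for p
    using that W c by (intro tangent_lift_tangent) (auto simp: charts_at_iff)
next
  fix c' assume c': "c' \<in> A"
  let ?S = "chart_image c' W"
  have tr: "smooth_on (transition c' c) ?S" "transition c' c ` ?S \<subseteq> chart_image c W"
    using smooth_on_transition[OF c' c W(2)] by auto
  let ?V = "W \<inter> fst c'"
  have V: "open_in ?V"
    using W(1) open_in_chart_domain[OF c'] by blast
  have "smooth_on (\<lambda>q. fderiv (transition c c') q (F q)) (chart_image c ?V)"
    using smooth_on_transition[OF c c', of ?V] open_chart_image[OF V c]
    by (intro smooth_on_fderiv_apply smooth_on_mono[OF F]) auto
  moreover have "transition c' c ` ?S \<subseteq> chart_image c ?V"
    using W c c' by auto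
  ultimately have "smooth_on (\<lambda>x. fderiv (transition c c') (transition c' c x) (F (transition c' c x))) ?S"
    using smooth_on_compose[of "\<lambda>q. fderiv (transition c c') q (F q)"] tr(1) by blast
  then show "smooth_on (coord_rep c' (\<lambda>p. tangent_lift c p (F (snd c p)))) ?S"
    by (rule smooth_on_cong[OF open_chart_image[OF W(1) c']])
      (use c c' W in \<open>auto simp: tangent_lift_def charts_at_iff\<close>)
qed

section \<open>Directional derivatives and Lie brackets\<close>

lemma dir_deriv_chart:
  assumes c: "c \<in> charts_at A p" and u: "u \<in> tangent_space A p"
    and f: "(f \<circ> chart_inv c) differentiable (at (snd c p))"
  shows "dir_deriv A p u f = fderiv (f \<circ> chart_inv c) (snd c p) (u c)"
proof -
  define c' where "c' = (SOME c. c \<in> charts_at A p)"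
  have c': "c' \<in> charts_at A p"
    unfolding c'_def using c by (rule someI)
  have "fderiv (f \<circ> chart_inv c) (snd c p) (u c) =
      fderiv (f \<circ> chart_inv c) (snd c p) (fderiv (transition c' c) (snd c' p) (u c'))"
    using tangent_transform[OF u c' c] by simp
  also have "\<dots> = fderiv (f \<circ> chart_inv c') (snd c' p) (u c')"
    using c c' f by (intro change_of_chart(2)) (auto simp: charts_at_iff)
  finally show ?thesis
    by (simp add: dir_deriv_def c'_def[symmetric])
qed

lemma lie_bracket_chart:
  assumes "c \<in> charts_at A p"
  shows "lie_bracket A X Y p c = br (coord_rep c X) (coord_rep c Y) (snd c p)"
  using assms by (simp add: lie_bracket_def br_def charts_at_iff)

lemma lie_bracket_off: "c \<notin> charts_at A p \<Longrightarrow> lie_bracket A X Y p c = 0"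
  by (simp add: lie_bracket_def)

lemma lie_bracket_cong:
  assumes "open_in W" "p \<in> W" "\<And>q. q \<in> W \<Longrightarrow> X q = X' q" "\<And>q. q \<in> W \<Longrightarrow> Y q = Y' q"
  shows "lie_bracket A X Y p = lie_bracket A X' Y' p"
proof
  fix c
  show "lie_bracket A X Y p c = lie_bracket A X' Y' p c"
  proof (cases "c \<in> charts_at A p")
    case True
    have "br (coord_rep c X) (coord_rep c Y) (snd c p) = br (coord_rep c X') (coord_rep c Y') (snd c p)"
      by (rule br_cong[of "chart_image c W"])
        (use assms True open_chart_image[OF assms(1)] in \<open>auto simp: charts_at_iff\<close>)
    then show ?thesis using True by (simp add: lie_bracket_chart)
  qed (simp add: lie_bracket_off)
qed

text \<open>The representations of a field in two charts are related by the transition map, so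
  \<open>br_transform\<close> assembles the chartwise brackets into one tangent vector.\<close>

lemma vector_field_lie_bracket:
  assumes W: "open_in W" and X: "vector_field A W X" and Y: "vector_field A W Y"
  shows "vector_field A W (lie_bracket A X Y)"
proof (rule vector_fieldI)
  fix p assume p: "p \<in> W"
  have "lie_bracket A X Y p c' = fderiv (transition c c') (snd c p) (lie_bracket A X Y p c)"
    if c: "c \<in> charts_at A p" and c': "c' \<in> charts_at A p" for c c'
  proof -
    have cc: "c \<in> A" "c' \<in> A" "p \<in> fst c" "p \<in> fst c'"
      using c c' by (auto simp: charts_at_iff)
    let ?W = "W \<inter> fst c'"
    let ?S = "chart_image c ?W"
    have S: "open ?S" "snd c p \<in> ?S"
      using open_chart_image[of ?W c] W open_in_chart_domain[OF cc(2)] cc p by auto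
    have rel: "coord_rep c' Z (transition c c' q) = fderiv (transition c c') q (coord_rep c Z q)"
      if "q \<in> ?S" "vector_field A W Z" for q Z
      using that cc tangent_transform[OF vector_field_tangent[OF that(2)], of "chart_inv c q" c c']
      by (auto simp: charts_at_iff)
    have diff: "coord_rep c' Z differentiable (at (transition c c' (snd c p)))" if "vector_field A W Z" for Z
      using vector_field_smooth[OF that cc(2)] cc p by (intro smooth_on_differentiable) auto
    have "br (coord_rep c' X) (coord_rep c' Y) (transition c c' (snd c p)) =
        fderiv (transition c c') (snd c p) (br (coord_rep c X) (coord_rep c Y) (snd c p))"
    proof (rule br_transform[OF S])
      show "smooth_on (transition c c') ?S"
        using smooth_on_transition cc by simp
      show "smooth_on (coord_rep c X) ?S" "smooth_on (coord_rep c Y) ?S"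
        by (rule smooth_on_mono[OF vector_field_smooth[OF _ cc(1)]], rule X Y, blast)+
      show "coord_rep c' X differentiable (at (transition c c' (snd c p)))"
        "coord_rep c' Y differentiable (at (transition c c' (snd c p)))"
        by (rule diff, rule X, rule diff, rule Y)
    qed (rule rel[OF _ X] rel[OF _ Y], assumption)+
    then show ?thesis
      using c c' cc by (simp add: lie_bracket_chart)
  qed
  then show "lie_bracket A X Y p \<in> tangent_space A p"
    using lie_bracket_off by (intro tangentI)
next
  fix c assume c: "c \<in> A"
  show "smooth_on (coord_rep c (lie_bracket A X Y)) (chart_image c W)"
  proof (rule smooth_on_cong[OF open_chart_image[OF W c]])
    show "smooth_on (br (coord_rep c X) (coord_rep c Y)) (chart_image c W)"
      using open_chart_image[OF W c] vector_field_smooth c X Y by (intro smooth_on_br) auto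
  qed (use c in \<open>auto simp: lie_bracket_chart charts_at_iff\<close>)
qed

lemma vector_field_differentiable:
  assumes "vector_field A W X" "c \<in> charts_at A p" "p \<in> W"
  shows "coord_rep c X differentiable (at (snd c p))"
  using vector_field_smooth[OF assms(1)] assms(2,3)
  by (intro smooth_on_differentiable[of _ "chart_image c W"]) (auto simp: charts_at_iff)

lemma lie_bracket_add:
  assumes "vector_field A W X" "vector_field A W X'" "vector_field A W Y" "p \<in> W"
  shows "lie_bracket A (\<lambda>q. X q + X' q) Y p = lie_bracket A X Y p + lie_bracket A X' Y p"
proof
  fix c
  show "lie_bracket A (\<lambda>q. X q + X' q) Y p c = (lie_bracket A X Y p + lie_bracket A X' Y p) c"
  proof (cases "c \<in> charts_at A p")
    case True
    note d = vector_field_differentiable[OF _ True assms(4)]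
    have "linear (fderiv (coord_rep c Y) (snd c p))"
      using d[OF assms(3)] linear_frechet_derivative by blast
    then show ?thesis
      using True fderiv_add[OF d[OF assms(1)] d[OF assms(2)]]
      by (simp add: lie_bracket_chart br_def linear_add charts_at_iff)
  qed (simp add: lie_bracket_off)
qed

lemma lie_bracket_anticommute: "lie_bracket A Y X p = (-1) *\<^sub>R lie_bracket A X Y p"
  by (rule ext) (simp add: lie_bracket_def scaleR_fun_def)

lemma smooth_function_differentiable:
  assumes "smooth_function A W f" "c \<in> charts_at A p" "p \<in> W"
  shows "(f \<circ> chart_inv c) differentiable (at (snd c p))"
  using assms by (intro smooth_on_differentiable[of _ "chart_image c W"]) (auto simp: charts_at_iff smooth_function_def)

lemma lie_bracket_scale:
  assumes "open_in W" "smooth_function A W f" "vector_field A W X" "vector_field A W Y" "p \<in> W"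
  shows "lie_bracket A (\<lambda>q. f q *\<^sub>R X q) Y p =
    f p *\<^sub>R lie_bracket A X Y p + (- dir_deriv A p (Y p) f) *\<^sub>R X p"
proof
  fix c
  show "lie_bracket A (\<lambda>q. f q *\<^sub>R X q) Y p c =
    (f p *\<^sub>R lie_bracket A X Y p + (- dir_deriv A p (Y p) f) *\<^sub>R X p) c"
  proof (cases "c \<in> charts_at A p")
    case True
    note d = vector_field_differentiable[OF _ True assms(5)]
    have f: "(\<lambda>x. f (chart_inv c x)) differentiable (at (snd c p))"
      using smooth_function_differentiable[OF assms(2) True assms(5)] by (simp add: o_def)
    have "linear (fderiv (coord_rep c Y) (snd c p))"
      using d[OF assms(4)] linear_frechet_derivative by blast
    moreover have "dir_deriv A p (Y p) f = fderiv (\<lambda>x. f (chart_inv c x)) (snd c p) (Y p c)"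
      using dir_deriv_chart[OF True vector_field_tangent[OF assms(4,5)]] f by (simp add: o_def)
    ultimately show ?thesis
      using True fderiv_scaleR[OF f d[OF assms(3)]]
      by (simp add: lie_bracket_chart br_def linear_cmul charts_at_iff scaleR_fun_def algebra_simps)
  next
    case False
    then show ?thesis
      using tangent_off[OF vector_field_tangent[OF assms(3,5)]] by (simp add: lie_bracket_off scaleR_fun_def)
  qed
qed

lemma lie_bracket_Jacobi:
  assumes W: "open_in W" "p \<in> W" and vf: "vector_field A W X" "vector_field A W Y" "vector_field A W Z"
  shows "lie_bracket A X (lie_bracket A Y Z) p + lie_bracket A Y (lie_bracket A Z X) p
    + lie_bracket A Z (lie_bracket A X Y) p = 0"
proof
  fix c
  show "(lie_bracket A X (lie_bracket A Y Z) p + lie_bracket A Y (lie_bracket A Z X) p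
    + lie_bracket A Z (lie_bracket A X Y) p) c = 0 c"
  proof (cases "c \<in> charts_at A p")
    case True
    then have c: "c \<in> A" "p \<in> fst c" by (auto simp: charts_at_iff)
    have S: "open (chart_image c W)" "snd c p \<in> chart_image c W"
      using open_chart_image[OF W(1) c(1)] W c by auto
    have "br (coord_rep c X) (coord_rep c (lie_bracket A Y Z)) (snd c p) =
        br (coord_rep c X) (br (coord_rep c Y) (coord_rep c Z)) (snd c p)" for X Y Z
      by (rule br_cong[OF S]) (use c in \<open>auto simp: lie_bracket_chart charts_at_iff\<close>)
    then show ?thesis
      using br_Jacobi[OF S vector_field_smooth[OF vf(1) c(1)] vector_field_smooth[OF vf(2) c(1)]
          vector_field_smooth[OF vf(3) c(1)]] True
      by (simp add: lie_bracket_chart)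
  qed (simp add: lie_bracket_off)
qed

lemma smooth_function_dir_deriv:
  assumes W: "open_in W" and f: "smooth_function A W f" and X: "vector_field A W X"
  shows "smooth_function A W (\<lambda>p. dir_deriv A p (X p) f)"
  unfolding smooth_function_def
proof
  fix c assume c: "c \<in> A"
  show "smooth_on ((\<lambda>p. dir_deriv A p (X p) f) \<circ> chart_inv c) (chart_image c W)"
  proof (rule smooth_on_cong[OF open_chart_image[OF W c]])
    show "smooth_on (\<lambda>x. fderiv (f \<circ> chart_inv c) x (coord_rep c X x)) (chart_image c W)"
      using open_chart_image[OF W c] f c vector_field_smooth[OF X c]
      by (intro smooth_on_fderiv_apply) (auto simp: smooth_function_def)
    fix x assume x: "x \<in> chart_image c W"
    note xD = chart_imageD[OF c x]
    have "c \<in> charts_at A (chart_inv c x)"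
      using c xD by (simp add: charts_at_iff)
    from dir_deriv_chart[OF this vector_field_tangent[OF X xD(1)]
        smooth_function_differentiable[OF f this xD(1)]]
    show "fderiv (f \<circ> chart_inv c) x (coord_rep c X x) = ((\<lambda>p. dir_deriv A p (X p) f) \<circ> chart_inv c) x"
      using xD by simp
  qed
qed

text \<open>The second derivatives of f cancel by symmetry. This identity is what makes the
  curvature linear over functions in its third argument.\<close>

lemma dir_deriv_lie_bracket:
  assumes W: "open_in W" "p \<in> W" and f: "smooth_function A W f"
    and X: "vector_field A W X" and Y: "vector_field A W Y"
  shows "dir_deriv A p (X p) (\<lambda>q. dir_deriv A q (Y q) f) - dir_deriv A p (Y p) (\<lambda>q. dir_deriv A q (X q) f)
    = dir_deriv A p (lie_bracket A X Y p) f"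
proof -
  obtain c where c: "c \<in> A" "p \<in> fst c"
    using chart_exists W by blast
  then have cp: "c \<in> charts_at A p" by (simp add: charts_at_iff)
  define S where "S = chart_image c W"
  have S: "open S" "snd c p \<in> S"
    using open_chart_image[OF W(1) c(1)] W c by (auto simp: S_def)
  let ?f = "f \<circ> chart_inv c"
  have sf: "smooth_on ?f S"
    using f c by (simp add: smooth_function_def S_def)
  have step: "dir_deriv A p (X p) (\<lambda>q. dir_deriv A q (Y q) f) =
      fderiv (\<lambda>x. fderiv ?f x (Y p c)) (snd c p) (X p c)
      + fderiv ?f (snd c p) (fderiv (coord_rep c Y) (snd c p) (X p c))"
    if X: "vector_field A W X" and Y: "vector_field A W Y" for X Y
  proof -
    have "dir_deriv A p (X p) (\<lambda>q. dir_deriv A q (Y q) f) =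
        fderiv ((\<lambda>q. dir_deriv A q (Y q) f) \<circ> chart_inv c) (snd c p) (X p c)"
      by (rule dir_deriv_chart[OF cp vector_field_tangent[OF X W(2)]
            smooth_function_differentiable[OF smooth_function_dir_deriv[OF W(1) f Y] cp W(2)]])
    also have "fderiv ((\<lambda>q. dir_deriv A q (Y q) f) \<circ> chart_inv c) (snd c p) =
        fderiv (\<lambda>x. fderiv ?f x (coord_rep c Y x)) (snd c p)"
    proof (rule fderiv_cong[OF S])
      fix x assume x: "x \<in> S"
      note xD = chart_imageD[OF c(1) x[unfolded S_def]]
      have "c \<in> charts_at A (chart_inv c x)"
        using c xD by (simp add: charts_at_iff)
      from dir_deriv_chart[OF this vector_field_tangent[OF Y xD(1)]
          smooth_function_differentiable[OF f this xD(1)]]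
      show "((\<lambda>q. dir_deriv A q (Y q) f) \<circ> chart_inv c) x = fderiv ?f x (coord_rep c Y x)"
        using xD by simp
    qed
    finally show ?thesis
      using fderiv_fderiv_apply_id[OF S(1) sf S(2) vector_field_differentiable[OF Y cp W(2)]] c by simp
  qed
  have "dir_deriv A p (lie_bracket A X Y p) f = fderiv ?f (snd c p) (lie_bracket A X Y p c)"
    by (rule dir_deriv_chart[OF cp vector_field_tangent[OF vector_field_lie_bracket[OF W(1) X Y] W(2)]
          smooth_function_differentiable[OF f cp W(2)]])
  then show ?thesis
    using step[OF X Y] step[OF Y X] fderiv_symmetric[OF S sf, of "X p c" "Y p c"] c cp
      linear_diff[OF linear_fderiv[OF sf S(2)]]
    by (simp add: lie_bracket_chart br_def)
qed

section \<open>Local extensions and tensoriality\<close>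

lemma local_extI: "open_in W \<Longrightarrow> p \<in> W \<Longrightarrow> vector_field A W X \<Longrightarrow> X p = u \<Longrightarrow> X \<in> local_ext A p u"
  by (auto simp: local_ext_def)

lemma local_extE:
  assumes "X \<in> local_ext A p u" "open_in V" "p \<in> V"
  obtains W where "open_in W" "p \<in> W" "W \<subseteq> V" "vector_field A W X" "X p = u"
proof -
  obtain W where "open_in W" "p \<in> W" "vector_field A W X" "X p = u"
    using assms(1) by (auto simp: local_ext_def)
  then show thesis
    using that[of "W \<inter> V"] assms vector_field_mono[of W X "W \<inter> V"] openin_Int[of "manifold_topology A"] by auto
qed

lemma constant_extension:
  assumes "c \<in> charts_at A p" "u \<in> tangent_space A p"
  shows "vector_field A (fst c) (\<lambda>q. tangent_lift c q (u c))" "tangent_lift c p (u c) = u"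
    "(\<lambda>q. tangent_lift c q (u c)) \<in> local_ext A p u"
proof -
  have c: "c \<in> A" "p \<in> fst c" using assms by (auto simp: charts_at_iff)
  show 1: "vector_field A (fst c) (\<lambda>q. tangent_lift c q (u c))"
    using vector_field_tangent_lift[OF open_in_chart_domain subset_refl c(1) smooth_on_const] c by blast
  show 2: "tangent_lift c p (u c) = u"
    using tangent_lift_eq assms by simp
  show "(\<lambda>q. tangent_lift c q (u c)) \<in> local_ext A p u"
    using local_extI[OF open_in_chart_domain[OF c(1)] c(2) 1 2] .
qed

text \<open>Inside a chart X is a combination of the coordinate frame \<open>\<Delta>\<close>, so T
  X is determined by the coefficients at p and the values of T on the frame. No cut-off functions
  are required, because \<open>loc\<close> lets T be evaluated on arbitrarily small domains; the
  same frame serves both extensions even though their domains differ.\<close>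

lemma tensorial:
  fixes T :: "('a \<Rightarrow> ('a, 'e) tvec) \<Rightarrow> 'v::real_vector"
  assumes V: "open_in V" "p \<in> V"
    and loc: "\<And>W X Y. open_in W \<Longrightarrow> W \<subseteq> V \<Longrightarrow> p \<in> W \<Longrightarrow> vector_field A W X \<Longrightarrow> vector_field A W Y \<Longrightarrow>
      (\<And>q. q \<in> W \<Longrightarrow> X q = Y q) \<Longrightarrow> T X = T Y"
    and add: "\<And>W X Y. open_in W \<Longrightarrow> W \<subseteq> V \<Longrightarrow> p \<in> W \<Longrightarrow> vector_field A W X \<Longrightarrow> vector_field A W Y \<Longrightarrow>
      T (\<lambda>q. X q + Y q) = T X + T Y"
    and scale: "\<And>W f X. open_in W \<Longrightarrow> W \<subseteq> V \<Longrightarrow> p \<in> W \<Longrightarrow> smooth_function A W f \<Longrightarrow> vector_field A W X \<Longrightarrow>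
      T (\<lambda>q. f q *\<^sub>R X q) = f p *\<^sub>R T X"
    and X: "X \<in> local_ext A p u" and Y: "Y \<in> local_ext A p u"
  shows "T X = T Y"
proof -
  obtain c where c: "c \<in> A" "p \<in> fst c"
    using chart_exists V by blast
  define \<Delta> where "\<Delta> b q = tangent_lift c q b" for b q
  have "T X = (\<Sum>b\<in>Basis. (u c \<bullet> b) *\<^sub>R T (\<Delta> b))" if X: "X \<in> local_ext A p u" for X
  proof -
    have "open_in (V \<inter> fst c)"
      using V(1) open_in_chart_domain[OF c(1)] by blast
    then obtain W where W: "open_in W" "p \<in> W" "W \<subseteq> V" "W \<subseteq> fst c" "vector_field A W X" "X p = u"
      by (rule local_extE[OF X]) (use V c in auto)
    define f where "f b q = X q c \<bullet> b" for b q
    have f: "smooth_function A W (f b)" for b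
      using vector_field_smooth[OF W(5) c(1)]
      by (intro smooth_function_chartI[OF W(1,4) c(1)])
        (simp add: f_def o_def smooth_on_linear_compose[OF bounded_linear_inner_left])
    have \<Delta>: "vector_field A W (\<Delta> b)" for b
      using vector_field_tangent_lift[OF W(1,4) c(1) smooth_on_const] by (simp add: \<Delta>_def[abs_def])
    have sum: "vector_field A W (\<lambda>q. \<Sum>b\<in>B. f b q *\<^sub>R \<Delta> b q) \<and>
        T (\<lambda>q. \<Sum>b\<in>B. f b q *\<^sub>R \<Delta> b q) = (\<Sum>b\<in>B. f b p *\<^sub>R T (\<Delta> b))" if "finite B" for B
      using that
    proof induction
      \<comment> \<open>That T annihilates the zero field is homogeneity for the constant function
        0.\<close>
      case empty
      show ?case
        using scale[OF W(1,3,2) smooth_function_const[of W 0] vector_field_zero] vector_field_zero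
        by (simp add: zero_fun_def)
    next
      case (insert b B)
      have term_b: "vector_field A W (\<lambda>q. f b q *\<^sub>R \<Delta> b q)"
        using vector_field_scale f \<Delta> by blast
      show ?case
        unfolding sum.insert[OF insert(1,2)]
        using vector_field_add[OF term_b conjunct1[OF insert(3)]] conjunct2[OF insert(3)]
          add[OF W(1,3,2) term_b conjunct1[OF insert(3)]] scale[OF W(1,3,2) f \<Delta>]
        by (intro conjI) (assumption, simp only:)
    qed
    have "X q = (\<Sum>b\<in>Basis. f b q *\<^sub>R \<Delta> b q)" if q: "q \<in> W" for q
    proof (rule tangent_eqI)
      show "X q \<in> tangent_space A q" "(\<Sum>b\<in>Basis. f b q *\<^sub>R \<Delta> b q) \<in> tangent_space A q"
        using vector_field_tangent[OF W(5) q] vector_field_tangent[OF conjunct1[OF sum[OF finite_Basis]] q] by auto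
      show cq: "c \<in> charts_at A q"
        using c q W by (auto simp: charts_at_iff)
      have "(\<Sum>b\<in>B. f b q *\<^sub>R \<Delta> b q) c = (\<Sum>b\<in>B. f b q *\<^sub>R b)" if "finite B" for B
        using that by induction (simp_all add: scaleR_fun_def \<Delta>_def tangent_lift_chart[OF cq])
      then show "X q c = (\<Sum>b\<in>Basis. f b q *\<^sub>R \<Delta> b q) c"
        by (simp add: f_def euclidean_representation)
    qed
    then have "T X = T (\<lambda>q. \<Sum>b\<in>Basis. f b q *\<^sub>R \<Delta> b q)"
      using sum[OF finite_Basis] by (intro loc[OF W(1,3,2,5)]) auto
    then show ?thesis
      using sum[OF finite_Basis] W by (simp add: f_def)
  qed
  then show ?thesis using X Y by simp
qed

end

lemma fderiv_Pair_const:
  "f differentiable (at x) \<Longrightarrow> fderiv (\<lambda>x. (c, f x)) x v = (0, fderiv f x v)"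
  using fderiv_Pair[of "\<lambda>x. c" x f v] by simp

section \<open>The tangent bundle\<close>

lemma smooth_on_fderiv_apply2:
  fixes f :: "'a::euclidean_space \<Rightarrow> 'b::real_normed_vector" and \<phi> :: "'c::real_normed_vector \<Rightarrow> 'a"
  assumes "open S" "smooth_on f S" "open T" "smooth_on \<phi> T" "\<phi> ` T \<subseteq> S" "smooth_on w T"
  shows "smooth_on (\<lambda>q. fderiv f (\<phi> q) (w q)) T"
proof (rule smooth_on_cong[OF assms(3)])
  have "smooth_on (\<lambda>q. fderiv f (\<phi> q) b) T" for b
    by (rule smooth_on_compose[OF smooth_on_fderiv[OF assms(1,2)] assms(4,5)])
  then show "smooth_on (\<lambda>q. \<Sum>b\<in>Basis. (w q \<bullet> b) *\<^sub>R fderiv f (\<phi> q) b) T"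
    using assms(6)
    by (intro smooth_on_sum smooth_on_scaleR smooth_on_bilinear[OF bounded_bilinear_inner] smooth_on_const)
next
  fix q assume "q \<in> T"
  then show "(\<Sum>b\<in>Basis. (w q \<bullet> b) *\<^sub>R fderiv f (\<phi> q) b) = fderiv f (\<phi> q) (w q)"
    using linear_eq_sum_Basis[OF linear_fderiv[OF assms(2), of "\<phi> q"], of "w q"] assms(5) by auto
qed

lemma smooth_on_fst_id: "smooth_on (fst :: 'a::euclidean_space \<times> 'b::euclidean_space \<Rightarrow> _) S"
  and smooth_on_snd_id: "smooth_on (snd :: 'a::euclidean_space \<times> 'b::euclidean_space \<Rightarrow> _) S"
  by (rule smooth_on_bounded_linear, rule bounded_linear_fst bounded_linear_snd)+

locale tangent_bundle =
  fixes A :: "('m, 'e::euclidean_space) chart set"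
  assumes base_atlas: "smooth_atlas A"
begin

sublocale base: atlas A
  by unfold_locales (rule base_atlas)

section \<open>Induced charts and their transitions\<close>

definition induced :: "('m, 'e) chart \<Rightarrow> (('m, 'e) tpoint, 'e \<times> 'e) chart" where
  "induced c = ({(p, u). p \<in> fst c \<and> u \<in> tangent_space A p}, \<lambda>(p, u). (snd c p, u c))"

lemma tangent_atlas_eq: "tangent_atlas A = induced ` A"
  by (simp add: tangent_atlas_def induced_def[abs_def])

lemma induced_mem: "(p, u) \<in> fst (induced c) \<longleftrightarrow> p \<in> fst c \<and> u \<in> tangent_space A p"
  and induced_chart: "snd (induced c) (p, u) = (snd c p, u c)"
  by (simp_all add: induced_def)

lemma inj_induced:
  assumes "c \<in> A"
  shows "inj_on (snd (induced c)) (fst (induced c))"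
proof (rule inj_onI)
  fix z z' assume "z \<in> fst (induced c)" "z' \<in> fst (induced c)" "snd (induced c) z = snd (induced c) z'"
  moreover obtain p u p' u' where z: "z = (p, u)" "z' = (p', u')" by fastforce
  ultimately have *: "p \<in> fst c" "p' \<in> fst c" "u \<in> tangent_space A p" "u' \<in> tangent_space A p'"
      "snd c p = snd c p'" "u c = u' c"
    by (auto simp: induced_mem induced_chart)
  then have "p = p'"
    using base.chart_inv_chart[OF assms] by metis
  moreover have "u = u'"
    using base.tangent_eqI[of u p u' c] * assms \<open>p = p'\<close> by (simp add: base.charts_at_iff)
  ultimately show "z = z'" by (simp add: z)
qed

lemma induced_inv:
  assumes "c \<in> A" "p \<in> fst c"
  shows "chart_inv (induced c) (snd c p, y) = (p, base.tangent_lift c p y)"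
proof -
  have c: "c \<in> charts_at A p" using assms by (simp add: base.charts_at_iff)
  have "(p, base.tangent_lift c p y) \<in> fst (induced c)"
    using base.tangent_lift_tangent[OF c] assms by (simp add: induced_mem)
  moreover have "snd (induced c) (p, base.tangent_lift c p y) = (snd c p, y)"
    using base.tangent_lift_chart[OF c] by (simp add: induced_chart)
  ultimately show ?thesis
    unfolding chart_inv_def using inv_into_f_f[OF inj_induced[OF assms(1)]] by metis
qed

lemma induced_overlap:
  assumes "c \<in> A" "c' \<in> A"
  shows "snd (induced c) ` (fst (induced c) \<inter> fst (induced c')) = (snd c ` (fst c \<inter> fst c')) \<times> UNIV"
proof
  show "snd (induced c) ` (fst (induced c) \<inter> fst (induced c')) \<subseteq> (snd c ` (fst c \<inter> fst c')) \<times> UNIV"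
    by (auto simp: induced_def)
  show "(snd c ` (fst c \<inter> fst c')) \<times> UNIV \<subseteq> snd (induced c) ` (fst (induced c) \<inter> fst (induced c'))"
  proof clarify
    fix p y assume p: "p \<in> fst c" "p \<in> fst c'"
    then have c: "c \<in> charts_at A p" using assms by (simp add: base.charts_at_iff)
    show "(snd c p, y) \<in> snd (induced c) ` (fst (induced c) \<inter> fst (induced c'))"
      using p base.tangent_lift_tangent[OF c] base.tangent_lift_chart[OF c]
      by (intro image_eqI[of _ _ "(p, base.tangent_lift c p y)"]) (simp_all add: induced_mem induced_chart)
  qed
qed

lemma induced_transition:
  assumes "c \<in> A" "c' \<in> A" "x \<in> snd c ` (fst c \<inter> fst c')"
  shows "(snd (induced c') \<circ> chart_inv (induced c)) (x, y) =
    (base.transition c c' x, fderiv (base.transition c c') x y)"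
proof -
  obtain p where p: "p \<in> fst c" "p \<in> fst c'" "x = snd c p" using assms by auto
  then show ?thesis
    using assms induced_inv[of c p y] by (simp add: induced_chart base.tangent_lift_def base.charts_at_iff)
qed

lemma smooth_tangent_atlas: "smooth_atlas (tangent_atlas A)"
  unfolding smooth_atlas_def tangent_atlas_eq
proof (intro conjI ballI; elim imageE; hypsubst)
  show "inj_on (snd (induced c)) (fst (induced c))" if "c \<in> A" for c
    using inj_induced that .
  fix c c' assume c: "c \<in> A" "c' \<in> A"
  let ?S = "snd c ` (fst c \<inter> fst c')"
  have S: "open ?S" "smooth_on (base.transition c c') ?S"
    using base.smooth_transition[OF c] by auto
  then have o: "open (?S \<times> (UNIV :: 'e set))" by (simp add: open_Times)
  then show "open (snd (induced c) ` (fst (induced c) \<inter> fst (induced c')))"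
    by (simp add: induced_overlap[OF c])
  have "smooth_on (\<lambda>q. (base.transition c c' (fst q), fderiv (base.transition c c') (fst q) (snd q)))
      (?S \<times> (UNIV :: 'e set))"
  proof (rule smooth_on_Pair)
    show "smooth_on (\<lambda>q. base.transition c c' (fst q)) (?S \<times> (UNIV :: 'e set))"
      by (rule smooth_on_compose[OF S(2) smooth_on_fst_id]) auto
    show "smooth_on (\<lambda>q. fderiv (base.transition c c') (fst q) (snd q)) (?S \<times> (UNIV :: 'e set))"
      by (rule smooth_on_fderiv_apply2[OF S o smooth_on_fst_id _ smooth_on_snd_id]) auto
  qed
  then have "smooth_on (snd (induced c') \<circ> chart_inv (induced c)) (?S \<times> (UNIV :: 'e set))"
    by (rule smooth_on_cong[OF o]) (use induced_transition[OF c] in force)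
  then show "smooth_on (snd (induced c') \<circ> chart_inv (induced c))
      (snd (induced c) ` (fst (induced c) \<inter> fst (induced c')))"
    by (simp add: induced_overlap[OF c])
qed

sublocale atlas "tangent_atlas A"
  by unfold_locales (rule smooth_tangent_atlas)

lemma charts_at_tangent_atlasE:
  assumes "C \<in> charts_at (tangent_atlas A) z"
  obtains c where "c \<in> A" "C = induced c" "fst z \<in> fst c" "snd z \<in> tangent_space A (fst z)"
proof -
  obtain c where c: "c \<in> A" "C = induced c" "z \<in> fst (induced c)"
    using assms unfolding charts_at_def tangent_atlas_eq by blast
  then show thesis
    using that[OF c(1,2)] induced_mem[of "fst z" "snd z" c] by simp
qed

text \<open>Differentiating (x, y) to (\<phi> x, D\<phi>(x) y) gives a block triangular map: the new
  base component involves the old base component only, and a vertical vector (0, b) goes to (0,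
  D\<phi>(x) b). This is why moving the base component into the fiber slot commutes with coordinate
  changes, that is, why \<open>vert\<close> preserves tangent vectors.\<close>

lemma fderiv_induced_transition:
  assumes "c \<in> A" "c' \<in> A" "x \<in> snd c ` (fst c \<inter> fst c')"
  shows "fderiv (snd (induced c') \<circ> chart_inv (induced c)) (x, y) w =
    (fderiv (base.transition c c') x (fst w),
     fderiv (\<lambda>q. fderiv (base.transition c c') q y) x (fst w) + fderiv (base.transition c c') x (snd w))"
proof -
  let ?\<phi> = "base.transition c c'"
  let ?S = "snd c ` (fst c \<inter> fst c')"
  let ?T = "?S \<times> (UNIV :: 'e set)"
  have S: "open ?S" "smooth_on ?\<phi> ?S"
    using base.smooth_transition[OF assms(1,2)] by auto
  have T: "open ?T" "(x, y) \<in> ?T"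
    using S assms(3) by (auto simp: open_Times)
  have d1: "(\<lambda>q. ?\<phi> (fst q)) differentiable (at (x, y))"
    by (rule smooth_on_differentiable[OF smooth_on_compose[OF S(2) smooth_on_fst_id] T(2)]) auto
  have sm: "smooth_on (\<lambda>q. fderiv ?\<phi> (fst q) (w q)) ?T" if "smooth_on w ?T" for w
    by (rule smooth_on_fderiv_apply2[OF S T(1) smooth_on_fst_id _ that]) auto
  have d2: "(\<lambda>q. fderiv ?\<phi> (fst q) (snd q)) differentiable (at (x, y))"
    by (rule smooth_on_differentiable[OF sm[OF smooth_on_snd_id] T(2)])
  have fst_d: "fst differentiable (at (x, y))" "snd differentiable (at (x, y))"
    using bounded_linear_imp_differentiable[OF bounded_linear_fst] bounded_linear_imp_differentiable[OF bounded_linear_snd]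
    by auto
  have fst_D: "fderiv fst (x, y) w = fst w" "fderiv snd (x, y) w = snd w"
    using fderiv_eq[OF bounded_linear_imp_has_derivative[OF bounded_linear_fst]]
      fderiv_eq[OF bounded_linear_imp_has_derivative[OF bounded_linear_snd]] by metis+
  have 1: "fderiv (\<lambda>q. ?\<phi> (fst q)) (x, y) w = fderiv ?\<phi> x (fst w)"
    using fderiv_compose[OF fst_d(1), of ?\<phi> w] smooth_on_differentiable[OF S(2) assms(3)] fst_D by simp
  have 2: "fderiv (\<lambda>q. fderiv ?\<phi> (fst q) y) (x, y) w = fderiv (\<lambda>q. fderiv ?\<phi> q y) x (fst w)"
    using fderiv_compose[OF fst_d(1), of "\<lambda>q. fderiv ?\<phi> q y" w]
      smooth_on_differentiable[OF smooth_on_fderiv[OF S] assms(3)] fst_D by simp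
  have 3: "fderiv (\<lambda>q. fderiv ?\<phi> (fst q) (snd q)) (x, y) w =
      fderiv (\<lambda>q. fderiv ?\<phi> (fst q) y) (x, y) w + fderiv ?\<phi> x (snd w)"
    using fderiv_fderiv_apply[OF S smooth_on_fst_id T _ fst_d(2), of w] fst_D by auto
  have "fderiv (snd (induced c') \<circ> chart_inv (induced c)) (x, y) =
      fderiv (\<lambda>q. (?\<phi> (fst q), fderiv ?\<phi> (fst q) (snd q))) (x, y)"
    by (rule fderiv_cong[OF T]) (use induced_transition[OF assms(1,2)] in force)
  then show ?thesis
    using fderiv_Pair[OF d1 d2, of w] 1 2 3 by simp
qed

lemma vert_tangent:
  assumes "u \<in> tangent_space (tangent_atlas A) z"
  shows "vert u \<in> tangent_space (tangent_atlas A) z"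
proof (rule tangentI)
  show "vert u C = 0" if "C \<notin> charts_at (tangent_atlas A) z" for C
    using tangent_off[OF assms that] by (simp add: vert_def zero_prod_def)
  fix C C' assume C: "C \<in> charts_at (tangent_atlas A) z" and C': "C' \<in> charts_at (tangent_atlas A) z"
  obtain c where c: "c \<in> A" "C = induced c" "fst z \<in> fst c" using charts_at_tangent_atlasE[OF C] .
  obtain c' where c': "c' \<in> A" "C' = induced c'" "fst z \<in> fst c'" using charts_at_tangent_atlasE[OF C'] .
  have z: "snd C z = (snd c (fst z), snd z c)"
    using induced_chart[of c "fst z" "snd z"] c by simp
  have x: "snd c (fst z) \<in> snd c ` (fst c \<inter> fst c')" using c c' by blast
  have "fderiv (base.transition c c') (snd c (fst z)) 0 = 0"
    "fderiv (\<lambda>q. fderiv (base.transition c c') q y) (snd c (fst z)) 0 = 0" for y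
    using base.smooth_transition[OF c(1) c'(1)] x linear_fderiv smooth_on_fderiv linear_0 by blast+
  then show "vert u C' = fderiv (transition C C') (snd C z) (vert u C)"
    using tangent_transform[OF assms C C']
    by (simp add: vert_def z[unfolded c(2)] c(2) c'(2) fderiv_induced_transition[OF c(1) c'(1) x])
qed

lemma vector_field_vert:
  assumes "vector_field (tangent_atlas A) W X"
  shows "vector_field (tangent_atlas A) W (\<lambda>q. vert (X q))"
proof (rule vector_fieldI)
  show "smooth_on (coord_rep C (\<lambda>q. vert (X q))) (chart_image C W)" if "C \<in> tangent_atlas A" for C
    using vector_field_smooth[OF assms that] unfolding vert_def
    by (intro smooth_on_Pair smooth_on_const smooth_on_fst)
qed (rule vert_tangent[OF vector_field_tangent[OF assms]])

lemma vert_add: "vert (u + w) = vert u + vert w"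
  and vert_vert: "vert (vert u) = 0"
  by (rule ext, simp add: vert_def scaleR_fun_def zero_prod_def)+

lemma vert_apply: "vert u C = (0, fst (u C))"
  by (simp add: vert_def)

end

section \<open>Spray and energy in a chart\<close>

text \<open>The data of a Finsler manifold in an induced chart with coordinates q = (x, y), the
  spray being (y, s). The assumption \<open>euler\<close> is C E = 2 E,
  \<open>spray_homogeneous\<close> is the fiber component of [C, S] = S, and
  \<open>canonical\<close> is the equation of the canonical spray with \<open>Omega\<close> written
  out.\<close>

locale energy_chart =
  fixes E :: "'e::euclidean_space \<times> 'e \<Rightarrow> real" and s :: "'e \<times> 'e \<Rightarrow> 'e" and D :: "('e \<times> 'e) set"
  assumes open_D: "open D" and smooth_E: "smooth_on E D" and smooth_s: "smooth_on s D"
    and euler: "\<And>q. q \<in> D \<Longrightarrow> fderiv E q (0, snd q) = 2 * E q"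
    and spray_homogeneous: "\<And>q. q \<in> D \<Longrightarrow> fderiv s q (0, snd q) = 2 *\<^sub>R s q"
    and canonical: "\<And>q a b. q \<in> D \<Longrightarrow> fderiv (\<lambda>x. fderiv E x (0, a)) q (snd q, s q)
      - fderiv (\<lambda>x. fderiv E x (0, snd q)) q (a, b) = - fderiv E q (a, b)"
begin

text \<open>The horizontal lift of a base vector a is (a, N q a). If the spray coefficients are
  written s = -2 G as is customary, N is the negative of the usual connection coefficients
  dG/dy.\<close>

definition N :: "'e \<times> 'e \<Rightarrow> 'e \<Rightarrow> 'e" where
  "N q a = (1/2) *\<^sub>R fderiv s q (0, a)"

definition hess :: "'e \<times> 'e \<Rightarrow> 'e \<times> 'e \<Rightarrow> 'e \<times> 'e \<Rightarrow> real" where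
  "hess q u v = fderiv (\<lambda>x. fderiv E x u) q v"

text \<open>Since (0, fst w) is J w, this is the exterior derivative of d_J E evaluated on constant
  coordinate fields, whose bracket vanishes.\<close>

definition \<omega> :: "'e \<times> 'e \<Rightarrow> 'e \<times> 'e \<Rightarrow> 'e \<times> 'e \<Rightarrow> real" where
  "\<omega> q u w = hess q (0, fst w) u - hess q (0, fst u) w"

section \<open>Second derivatives of the energy and the connection coefficients\<close>

lemma smooth_dE: "smooth_on (\<lambda>x. fderiv E x u) D"
  by (rule smooth_on_fderiv[OF open_D smooth_E])

lemma smooth_hess: "smooth_on (\<lambda>x. hess x u v) D"
  unfolding hess_def by (rule smooth_on_fderiv[OF open_D smooth_dE])

lemma hess_sym: "q \<in> D \<Longrightarrow> hess q u v = hess q v u"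
  unfolding hess_def by (rule fderiv_symmetric[OF open_D _ smooth_E])

lemma linear_dE: "q \<in> D \<Longrightarrow> linear (fderiv E q)"
  by (rule linear_fderiv[OF smooth_E])

lemma linear_hess2: "q \<in> D \<Longrightarrow> linear (hess q u)"
  unfolding hess_def[abs_def] using linear_fderiv[OF smooth_dE] .

lemma linear_hess1: "q \<in> D \<Longrightarrow> linear (\<lambda>u. hess q u v)"
  using linear_hess2[of q v] hess_sym[of q _ v] by (metis (no_types, lifting) ext)

lemma linear_N: "q \<in> D \<Longrightarrow> linear (N q)"
proof -
  assume q: "q \<in> D"
  have lin: "linear (\<lambda>a::'e. (0::'e, a))"
    by (simp add: linear_iff)
  show ?thesis
    unfolding N_def[abs_def]
    using linear_compose[OF lin linear_fderiv[OF smooth_s q]] by (auto intro!: linear_compose_scale_right simp: o_def)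
qed

lemma smooth_N: "smooth_on w D \<Longrightarrow> smooth_on (\<lambda>x. N x (w x)) D"
  unfolding N_def
  by (intro smooth_on_scaleR smooth_on_const smooth_on_fderiv_apply open_D smooth_s smooth_on_Pair)

lemma fderiv_N_apply:
  assumes "q \<in> D" "w differentiable (at q)"
  shows "fderiv (\<lambda>x. N x (w x)) q v = fderiv (\<lambda>x. N x (w q)) q v + N q (fderiv w q v)"
proof -
  have d: "(\<lambda>x. (0::'e, w x)) differentiable (at q)"
    using assms(2) by (intro differentiable_Pair) auto
  have smooth: "(\<lambda>x. fderiv s x (0, w q)) differentiable (at q)"
    by (rule smooth_on_differentiable[OF smooth_on_fderiv[OF open_D smooth_s] assms(1)])
  have "(\<lambda>x. fderiv s x (0, w x)) differentiable (at q)"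
  proof -
    have "(\<lambda>x. \<Sum>b\<in>Basis. ((0, w x) \<bullet> b) *\<^sub>R fderiv s x b) differentiable (at q)"
      using d smooth_on_differentiable[OF smooth_on_fderiv[OF open_D smooth_s] assms(1)]
      by (intro differentiable_sum differentiable_scaleR differentiable_inner) auto
    then obtain L where "((\<lambda>x. \<Sum>b\<in>Basis. ((0, w x) \<bullet> b) *\<^sub>R fderiv s x b) has_derivative L) (at q)"
      by (auto simp: differentiable_def)
    then have "((\<lambda>x. fderiv s x (0, w x)) has_derivative L) (at q)"
      by (rule has_derivative_transform_within_open[OF _ open_D assms(1)])
        (use linear_eq_sum_Basis[OF linear_fderiv[OF smooth_s]] in metis)
    then show ?thesis by (auto simp: differentiable_def)
  qed
  then have "fderiv (\<lambda>x. N x (w x)) q v = (1/2) *\<^sub>R fderiv (\<lambda>x. fderiv s x (0, w x)) q v"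
    unfolding N_def by (simp add: fderiv_linear[OF bounded_linear_scaleR_right])
  moreover have "fderiv (\<lambda>x. N x (w q)) q v = (1/2) *\<^sub>R fderiv (\<lambda>x. fderiv s x (0, w q)) q v"
    unfolding N_def using smooth by (simp add: fderiv_linear[OF bounded_linear_scaleR_right])
  ultimately show ?thesis
    using fderiv_fderiv_apply_id[OF open_D smooth_s assms(1) d, of v]
      fderiv_Pair_const[OF assms(2), where 'c='e]
    by (simp add: N_def scaleR_add_right)
qed

section \<open>Homogeneity and the Euler-Lagrange equations\<close>

lemma fderiv_snd_id: "fderiv (\<lambda>x. (0, snd x)) (q :: 'e \<times> 'e) v = (0, snd v)"
  and differentiable_snd_id: "(\<lambda>x. (0::'e, snd x)) differentiable (at (q :: 'e \<times> 'e))"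
proof -
  have "((\<lambda>x. (0, snd x)) has_derivative (\<lambda>v. (0, snd v))) (at q)"
    by (auto intro!: derivative_eq_intros)
  then show "fderiv (\<lambda>x. (0, snd x)) q v = (0, snd v)" "(\<lambda>x. (0::'e, snd x)) differentiable (at q)"
    using fderiv_eq by (metis, metis differentiable_def)
qed

text \<open>Differentiating the Euler relation of s in the direction (0, a) and interchanging the
  mixed derivatives lowers the degree of homogeneity in y from 2 to 1.\<close>

lemma N_homogeneous:
  assumes q: "q \<in> D"
  shows "fderiv (\<lambda>x. N x a) q (0, snd q) = N q a"
proof -
  have d: "(\<lambda>x. fderiv s x u) differentiable (at q)" for u
    by (rule smooth_on_differentiable[OF smooth_on_fderiv[OF open_D smooth_s] q])
  have "fderiv (\<lambda>x. fderiv s x (0, snd x)) q (0, a) = fderiv (\<lambda>x. 2 *\<^sub>R s x) q (0, a)"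
    by (rule arg_cong[where f="\<lambda>g. g _"], rule fderiv_cong[OF open_D q]) (rule spray_homogeneous)
  also have "\<dots> = 2 *\<^sub>R fderiv s q (0, a)"
    by (rule fderiv_linear[OF bounded_linear_scaleR_right smooth_on_differentiable[OF smooth_s q]])
  finally have "fderiv (\<lambda>x. fderiv s x (0, snd q)) q (0, a) = fderiv s q (0, a)"
    using fderiv_fderiv_apply_id[OF open_D smooth_s q differentiable_snd_id, of "(0, a)"]
    by (simp add: fderiv_snd_id scaleR_2)
  then have "fderiv (\<lambda>x. fderiv s x (0, a)) q (0, snd q) = fderiv s q (0, a)"
    using fderiv_symmetric[OF open_D q smooth_s] by metis
  then show ?thesis
    unfolding N_def using fderiv_linear[OF bounded_linear_scaleR_right d] by simp
qed

text \<open>Euler's relation for E differentiated along v; the subtracted term is the derivative of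
  the Liouville vector (0, y) itself.\<close>

lemma hess_liouville:
  assumes q: "q \<in> D"
  shows "hess q (0, snd q) v = 2 * fderiv E q v - fderiv E q (0, snd v)"
proof -
  have "fderiv (\<lambda>x. fderiv E x (0, snd x)) q v = fderiv (\<lambda>x. 2 * E x) q v"
    by (rule arg_cong[where f="\<lambda>g. g _"], rule fderiv_cong[OF open_D q]) (rule euler)
  also have "\<dots> = 2 * fderiv E q v"
    by (rule fderiv_linear[OF bounded_linear_mult_right smooth_on_differentiable[OF smooth_E q]])
  finally show ?thesis
    using fderiv_fderiv_apply_id[OF open_D smooth_E q differentiable_snd_id, of v]
    by (simp add: fderiv_snd_id hess_def)
qed

lemma hess_liouville_vertical:
  assumes q: "q \<in> D"
  shows "hess q (0, c) (0, snd q) = fderiv E q (0, c)"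
  using hess_liouville[OF q, of "(0, c)"] hess_sym[OF q] by simp

text \<open>The Euler-Lagrange equations S(dE/dy) = dE/dx. They are \<open>canonical\<close> tested
  on (a, 0), where homogeneity turns the term with the Liouville vector into 2 dE(a, 0).\<close>

lemma euler_lagrange:
  assumes q: "q \<in> D"
  shows "hess q (0, a) (snd q, s q) = fderiv E q (a, 0)"
  using canonical[OF q, of a 0] hess_liouville[OF q, of "(a, 0)"] linear_0[OF linear_dE[OF q]]
  by (simp add: hess_def zero_prod_def)

definition third :: "'e \<times> 'e \<Rightarrow> 'e \<times> 'e \<Rightarrow> 'e \<times> 'e \<Rightarrow> 'e \<times> 'e \<Rightarrow> real" where
  "third q u v w = fderiv (\<lambda>x. hess x u v) q w"

lemma third_sym12: "q \<in> D \<Longrightarrow> third q u v w = third q v u w"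
  unfolding third_def by (rule arg_cong[where f="\<lambda>g. g _"], rule fderiv_cong[OF open_D]) (auto intro: hess_sym)

lemma third_sym23: "q \<in> D \<Longrightarrow> third q u v w = third q u w v"
  unfolding third_def hess_def by (rule fderiv_symmetric[OF open_D _ smooth_dE])

lemma fderiv_hess_apply:
  assumes "q \<in> D" "w differentiable (at q)"
  shows "fderiv (\<lambda>x. hess x u (w x)) q v = third q u (w q) v + hess q u (fderiv w q v)"
  unfolding hess_def third_def by (rule fderiv_fderiv_apply_id[OF open_D smooth_dE assms])

lemma hess_add2: "q \<in> D \<Longrightarrow> hess q u (v + w) = hess q u v + hess q u w"
  using linear_add[OF linear_hess2] .

lemma hess_split: "q \<in> D \<Longrightarrow> hess q u (a, b) = hess q u (a, 0) + hess q u (0, b)"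
  using hess_add2[of q u "(a, 0)" "(0, b)"] by simp

lemma hess_scale_snd: "q \<in> D \<Longrightarrow> hess q u (0, r *\<^sub>R b) = r * hess q u (0, b)"
  using linear_cmul[OF linear_hess2, of q u r "(0, b)"] by simp

lemma dE_split: "q \<in> D \<Longrightarrow> fderiv E q (a, b) = fderiv E q (a, 0) + fderiv E q (0, b)"
  using linear_add[OF linear_dE, of q "(a, 0)" "(0, b)"] by simp

lemma dE_scale_snd: "q \<in> D \<Longrightarrow> fderiv E q (0, r *\<^sub>R b) = r * fderiv E q (0, b)"
  using linear_cmul[OF linear_dE, of q r "(0, b)"] by simp

text \<open>The Euler-Lagrange equations differentiated along the fiber direction (0, b). The spray
  vector (y, s) varies by (b, 2 N b), and this is how the connection coefficients become tied to
  E.\<close>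

lemma euler_lagrange_vertical:
  assumes q: "q \<in> D"
  shows "third q (0, a) (snd q, s q) (0, b) + hess q (0, a) (b, 2 *\<^sub>R N q b) = hess q (a, 0) (0, b)"
proof -
  have d: "(\<lambda>x. (snd x, s x)) differentiable (at q)"
    by (rule smooth_on_differentiable[OF smooth_on_Pair[OF smooth_on_snd_id smooth_s] q])
  have "fderiv (\<lambda>x. (snd x, s x)) q (0, b) = (fderiv snd q (0, b), fderiv s q (0, b))"
    by (rule fderiv_Pair[OF smooth_on_differentiable[OF smooth_on_snd_id q] smooth_on_differentiable[OF smooth_s q]])
  also have "fderiv snd q (0, b) = b"
    using fderiv_eq[OF bounded_linear_imp_has_derivative[OF bounded_linear_snd], of q] by simp
  finally have S': "fderiv (\<lambda>x. (snd x, s x)) q (0, b) = (b, 2 *\<^sub>R N q b)"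
    by (simp add: N_def)
  have "fderiv (\<lambda>x. hess x (0, a) (snd x, s x)) q (0, b) = fderiv (\<lambda>x. fderiv E x (a, 0)) q (0, b)"
    by (rule arg_cong[where f="\<lambda>g. g _"], rule fderiv_cong[OF open_D q]) (rule euler_lagrange)
  then show ?thesis
    using fderiv_hess_apply[OF q d, of "(0, a)" "(0, b)"] S' by (simp add: hess_def[of q "(a, 0)"])
qed

text \<open>In terms of \<open>\<omega>\<close>: the form vanishes on pairs of horizontal vectors.
  Exchanging a and b in \<open>euler_lagrange_vertical\<close> leaves the third derivative
  unchanged, and the difference of the two relations is twice the claim.\<close>

lemma horizontal_lagrangian:
  assumes q: "q \<in> D"
  shows "hess q (0, b) (a, N q a) = hess q (0, a) (b, N q b)"
proof -
  have "third q (0, a) (snd q, s q) (0, b) = third q (0, b) (snd q, s q) (0, a)"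
    using third_sym12[OF q] third_sym23[OF q] by metis
  then show ?thesis
    using euler_lagrange_vertical[OF q, of a b] euler_lagrange_vertical[OF q, of b a]
      hess_split[OF q, of "(0, a)" b "2 *\<^sub>R N q b"] hess_split[OF q, of "(0, b)" a "2 *\<^sub>R N q a"]
      hess_split[OF q, of "(0, a)" b "N q b"] hess_split[OF q, of "(0, b)" a "N q a"]
      hess_sym[OF q, of "(a, 0)" "(0, b)"] hess_sym[OF q, of "(b, 0)" "(0, a)"]
    by (simp add: hess_scale_snd[OF q])
qed

text \<open>A third derivative with the Liouville vector in one slot reduces to second derivatives,
  by differentiating \<open>hess_liouville_vertical\<close>.\<close>

lemma third_liouville:
  assumes q: "q \<in> D"
  shows "third q (0, b) (0, snd q) v + hess q (0, b) (0, snd v) = hess q (0, b) v"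
proof -
  have "fderiv (\<lambda>x. hess x (0, b) (0, snd x)) q v = fderiv (\<lambda>x. fderiv E x (0, b)) q v"
    by (rule arg_cong[where f="\<lambda>g. g _"], rule fderiv_cong[OF open_D q]) (rule hess_liouville_vertical)
  then show ?thesis
    using fderiv_hess_apply[OF q differentiable_snd_id, of "(0, b)" v]
    by (simp add: fderiv_snd_id hess_def[of q _ v])
qed

text \<open>Conservativity of the Barthel connection. Taking the test vector y in
  \<open>euler_lagrange_vertical\<close>, the third derivative reduces by
  \<open>third_liouville\<close> and cancels the right-hand side. What remains is the Hessian on the
  Liouville vector and (a, 2 N a), which is 2 dE(a, N a) by \<open>hess_liouville\<close>.\<close>

lemma dE_horizontal:
  assumes q: "q \<in> D"
  shows "fderiv E q (a, N q a) = 0"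
proof -
  have "third q (0, snd q) (snd q, s q) (0, a) = third q (0, a) (0, snd q) (snd q, s q)"
    using third_sym12[OF q] third_sym23[OF q] by metis
  then have "third q (0, snd q) (snd q, s q) (0, a) = hess q (0, a) (snd q, 0)"
    using third_liouville[OF q, of a "(snd q, s q)"] hess_split[OF q, of "(0, a)" "snd q" "s q"] by simp
  then have "hess q (0, snd q) (a, 2 *\<^sub>R N q a) = 0"
    using euler_lagrange_vertical[OF q, of "snd q" a] hess_sym[OF q, of "(0, a)" "(snd q, 0)"] by simp
  then show ?thesis
    using hess_liouville[OF q, of "(a, 2 *\<^sub>R N q a)"] dE_split[OF q, of a "2 *\<^sub>R N q a"]
      dE_split[OF q, of a "N q a"] dE_scale_snd[OF q, of 2 "N q a"] by simp
qed

text \<open>The vanishing of the Landsberg tensor on the spray: the vertical derivative of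
  \<open>dE \<circ> h = 0\<close>, rewritten with Euler's relation.\<close>

lemma landsberg_spray:
  assumes q: "q \<in> D"
  shows "third q (0, c) (0, snd q) (a, N q a) + hess q (0, c) (0, N q a)
    + hess q (0, fderiv (\<lambda>x. N x a) q (0, c)) (0, snd q) = 0"
proof -
  have d: "(\<lambda>x. N x a) differentiable (at q)"
    by (rule smooth_on_differentiable[OF smooth_N[OF smooth_on_const] q])
  have d': "(\<lambda>x. (a, N x a)) differentiable (at q)"
    using d by (intro differentiable_Pair) auto
  have "fderiv (\<lambda>x. fderiv E x (a, N x a)) q (0, c) = fderiv (\<lambda>x. 0) q (0, c)"
    by (rule arg_cong[where f="\<lambda>g. g _"], rule fderiv_cong[OF open_D q]) (rule dE_horizontal)
  then have "hess q (a, N q a) (0, c) + fderiv E q (0, fderiv (\<lambda>x. N x a) q (0, c)) = 0"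
    using fderiv_fderiv_apply_id[OF open_D smooth_E q d', of "(0, c)"]
      fderiv_Pair_const[OF d, of a "(0, c)"]
    by (simp add: hess_def)
  then show ?thesis
    using third_liouville[OF q, of c "(a, N q a)"] hess_liouville_vertical[OF q]
      hess_sym[OF q, of "(a, N q a)" "(0, c)"] by simp
qed

lemma fderiv_hess_apply2:
  assumes q: "q \<in> D" and d: "Y differentiable (at q)" "Z differentiable (at q)"
  shows differentiable_hess_apply2: "(\<lambda>x. hess x (0, Z x) (0, Y x)) differentiable (at q)"
    and "fderiv (\<lambda>x. hess x (0, Z x) (0, Y x)) q v =
    third q (0, Z q) (0, Y q) v + hess q (0, fderiv Z q v) (0, Y q) + hess q (0, Z q) (0, fderiv Y q v)"
proof -
  have lin0: "linear (\<lambda>a::'e. (0::'e, a))"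
    by (simp add: linear_iff)
  have lin: "hess x (0, a) w = (\<Sum>b\<in>Basis. (a \<bullet> b) * hess x (0, b) w)" if "x \<in> D" for x a w
    using linear_eq_sum_Basis[OF linear_compose[OF lin0 linear_hess1[OF that, where v=w]], where v=a] by (simp add: o_def)
  have dY: "(\<lambda>x. (0::'e, Y x)) differentiable (at q)"
    using d by (intro differentiable_Pair) auto
  have hess_d: "(\<lambda>x. hess x (0, b) (0, Y x)) differentiable (at q)" for b
  proof -
    have "(\<lambda>x. \<Sum>c\<in>Basis. (Y x \<bullet> c) * hess x (0, c) (0, b)) differentiable (at q)"
      using d smooth_on_differentiable[OF smooth_hess q]
      by (intro differentiable_sum differentiable_mult differentiable_inner) auto
    then obtain L where "((\<lambda>x. \<Sum>c\<in>Basis. (Y x \<bullet> c) * hess x (0, c) (0, b)) has_derivative L) (at q)"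
      by (auto simp: differentiable_def)
    then have "((\<lambda>x. hess x (0, b) (0, Y x)) has_derivative L) (at q)"
      by (rule has_derivative_transform_within_open[OF _ open_D q]) (use lin hess_sym in metis)
    then show ?thesis by (auto simp: differentiable_def)
  qed
  have Zb: "(\<lambda>x. Z x \<bullet> b) differentiable (at q)" for b
    using d by (intro differentiable_inner) auto
  have "(\<lambda>x. \<Sum>b\<in>Basis. (Z x \<bullet> b) * hess x (0, b) (0, Y x)) differentiable (at q)"
    using Zb hess_d by (intro differentiable_sum differentiable_mult) auto
  then obtain L where "((\<lambda>x. \<Sum>b\<in>Basis. (Z x \<bullet> b) * hess x (0, b) (0, Y x)) has_derivative L) (at q)"
    by (auto simp: differentiable_def)
  then have "((\<lambda>x. hess x (0, Z x) (0, Y x)) has_derivative L) (at q)"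
    by (rule has_derivative_transform_within_open[OF _ open_D q]) (use lin in metis)
  then show "(\<lambda>x. hess x (0, Z x) (0, Y x)) differentiable (at q)"
    by (auto simp: differentiable_def)
  have "fderiv (\<lambda>x. hess x (0, Z x) (0, Y x)) q v = fderiv (\<lambda>x. \<Sum>b\<in>Basis. (Z x \<bullet> b) * hess x (0, b) (0, Y x)) q v"
    by (rule arg_cong[where f="\<lambda>g. g _"], rule fderiv_cong[OF open_D q]) (rule lin)
  also have "\<dots> = (\<Sum>b\<in>Basis. (Z q \<bullet> b) * fderiv (\<lambda>x. hess x (0, b) (0, Y x)) q v
      + fderiv (\<lambda>x. Z x \<bullet> b) q v * hess q (0, b) (0, Y q))"
    by (rule arg_cong[where f="\<lambda>g. g v", OF fderiv_eq])
      (use hess_d Zb in \<open>auto intro!: has_derivative_sum has_derivative_mult simp: frechet_derivative_works[symmetric]\<close>)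
  also have "\<dots> = (\<Sum>b\<in>Basis. (Z q \<bullet> b) * third q (0, b) (0, Y q) v)
      + (\<Sum>b\<in>Basis. (Z q \<bullet> b) * hess q (0, b) (0, fderiv Y q v))
      + (\<Sum>b\<in>Basis. (fderiv Z q v \<bullet> b) * hess q (0, b) (0, Y q))"
    using fderiv_hess_apply[OF q dY] fderiv_Pair_const[OF d(1), where 'c='e]
      fderiv_linear[OF bounded_linear_inner_left d(2)]
    by (simp add: sum.distrib algebra_simps)
  also have "(\<Sum>b\<in>Basis. (Z q \<bullet> b) * third q (0, b) (0, Y q) v) = third q (0, Z q) (0, Y q) v"
  proof -
    have lt: "linear (\<lambda>a. third q a (0, Y q) v)"
      using linear_fderiv[OF smooth_hess q]
      by (smt (verit, best) linear_fderiv linear_iff q smooth_hess third_def third_sym12 third_sym23)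
    show ?thesis
      using linear_eq_sum_Basis[OF linear_compose[OF lin0 lt], of "Z q"] by (simp add: o_def)
  qed
  finally show "fderiv (\<lambda>x. hess x (0, Z x) (0, Y x)) q v =
    third q (0, Z q) (0, Y q) v + hess q (0, fderiv Z q v) (0, Y q) + hess q (0, Z q) (0, fderiv Y q v)"
    using lin[OF q, of "Z q" "(0, fderiv Y q v)"] lin[OF q, of "fderiv Z q v" "(0, Y q)"] by simp
qed

text \<open>The combination \<open>snd B - N q (fst B)\<close> is the fiber component of v B. The
  derivatives of X cancel in it, in accordance with v[hX, JY] being linear over functions in
  X.\<close>

lemma vertical_part_br:
  assumes q: "q \<in> D" and d: "X differentiable (at q)" "Y differentiable (at q)"
  defines "B \<equiv> br (\<lambda>x. (X x, N x (X x))) (\<lambda>x. (0, Y x)) q"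
  shows "snd B - N q (fst B) = fderiv Y q (X q, N q (X q)) - fderiv (\<lambda>x. N x (X q)) q (0, Y q)"
proof -
  have "(\<lambda>x. \<Sum>b\<in>Basis. (X x \<bullet> b) *\<^sub>R N x b) differentiable (at q)"
    using d smooth_on_differentiable[OF smooth_N[OF smooth_on_const] q]
    by (intro differentiable_sum differentiable_scaleR differentiable_inner) auto
  then obtain L where "((\<lambda>x. \<Sum>b\<in>Basis. (X x \<bullet> b) *\<^sub>R N x b) has_derivative L) (at q)"
    by (auto simp: differentiable_def)
  then have "((\<lambda>x. N x (X x)) has_derivative L) (at q)"
    by (rule has_derivative_transform_within_open[OF _ open_D q])
      (use linear_eq_sum_Basis[OF linear_N] in metis)
  then have "(\<lambda>x. N x (X x)) differentiable (at q)" by (auto simp: differentiable_def)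
  from fderiv_Pair[OF d(1) this] have "fderiv (\<lambda>x. (X x, N x (X x))) q v =
      (fderiv X q v, fderiv (\<lambda>x. N x (X q)) q v + N q (fderiv X q v))" for v
    using fderiv_N_apply[OF q d(1)] by simp
  then have "B = (- fderiv X q (0, Y q),
      fderiv Y q (X q, N q (X q)) - fderiv (\<lambda>x. N x (X q)) q (0, Y q) - N q (fderiv X q (0, Y q)))"
    using fderiv_Pair_const[OF d(2), where 'c='e] by (simp add: B_def br_def fderiv_const)
  then show ?thesis
    using linear_neg[OF linear_N[OF q]] by simp
qed

text \<open>This is v[hX, C] = 0: for Y = y the two terms of \<open>vertical_part_br\<close> are
  both N q (X q), the second because N is homogeneous of degree 1.\<close>

lemma vertical_part_br_liouville:
  assumes q: "q \<in> D" and d: "X differentiable (at q)"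
  defines "B \<equiv> br (\<lambda>x. (X x, N x (X x))) (\<lambda>x. (0, snd x)) q"
  shows "snd B - N q (fst B) = 0"
  using vertical_part_br[OF q d smooth_on_differentiable[OF smooth_on_snd_id q]] N_homogeneous[OF q]
    fderiv_eq[OF bounded_linear_imp_has_derivative[OF bounded_linear_snd], of q]
  by (simp add: B_def)

text \<open>The three terms are those of the Lie derivative of g along hX on JY and JZ, with Y equal
  to the spray at the point q alone, so derivatives of Y and Z have to drop out. The Lagrangian
  property reduces the term in \<open>\<omega>\<close> to the vertical part of the bracket; then
  these derivatives cancel and the rest is \<open>landsberg_spray\<close>.\<close>

lemma lie_derivative_metric_spray:
  assumes q: "q \<in> D" and d: "X differentiable (at q)" "Y differentiable (at q)" "Z differentiable (at q)"
    and Y: "Y q = snd q"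
  defines "hX \<equiv> \<lambda>x. (X x, N x (X x))"
  shows "fderiv (\<lambda>x. hess x (0, Z x) (0, Y x)) q (hX q)
    - \<omega> q (br hX (\<lambda>x. (0, Y x)) q) (Z q, N q (Z q))
    - hess q (0, snd (br hX (\<lambda>x. (0, Z x)) q) - N q (fst (br hX (\<lambda>x. (0, Z x)) q))) (0, Y q) = 0"
proof -
  have om: "\<omega> q w (Z q, N q (Z q)) = hess q (0, Z q) (0, snd w - N q (fst w))" for w
    using horizontal_lagrangian[OF q, of "Z q" "fst w"]
      linear_diff[OF linear_hess2[OF q], of "(0, Z q)" w "(fst w, N q (fst w))"]
    by (cases w) (simp add: \<omega>_def)
  have hess_d: "hess q (0, a - b) w = hess q (0, a) w - hess q (0, b) w"
    "hess q w (0, a - b) = hess q w (0, a) - hess q w (0, b)" for a b w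
    using linear_diff[OF linear_hess1[OF q, of w], of "(0, a)" "(0, b)"]
      linear_diff[OF linear_hess2[OF q], of w "(0, a)" "(0, b)"] by simp_all
  show ?thesis
    unfolding om hX_def vertical_part_br[OF q d(1,2)] vertical_part_br[OF q d(1,3)]
      fderiv_hess_apply2[OF q d(2,3)] hess_d
    using landsberg_spray[OF q, of "Z q" "X q"] N_homogeneous[OF q, of "X q"] Y
    by simp
qed

end

section \<open>The horizontal structure of a Finsler manifold\<close>

text \<open>The witness \<open>x\<^sub>0\<close> is what gives uniqueness: over an empty set of
  extensions every value would satisfy the description.\<close>

lemma the_constant: "x\<^sub>0 \<in> L \<Longrightarrow> (\<And>x. x \<in> L \<Longrightarrow> F x = k) \<Longrightarrow> (THE r. \<forall>x\<in>L. r = F x) = k"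
  by (rule the_equality) auto

lemma the_constant2:
  "x\<^sub>0 \<in> L \<Longrightarrow> y\<^sub>0 \<in> M \<Longrightarrow> (\<And>x y. x \<in> L \<Longrightarrow> y \<in> M \<Longrightarrow> F x y = k) \<Longrightarrow>
    (THE r. \<forall>x\<in>L. \<forall>y\<in>M. r = F x y) = k"
  by (rule the_equality) auto

lemma energy_chart_subset:
  assumes "energy_chart E s D" "open T" "T \<subseteq> D"
  shows "energy_chart E s T"
proof -
  interpret energy_chart E s D by fact
  show ?thesis
    using assms(2) smooth_on_mono[OF smooth_E assms(3)] smooth_on_mono[OF smooth_s assms(3)]
      euler spray_homogeneous canonical subsetD[OF assms(3)]
    by unfold_locales simp_all
qed

lemma scaleR_tvec_apply: "(r *\<^sub>R u) c = r *\<^sub>R (u :: ('a, 'e::euclidean_space) tvec) c"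
  by (simp add: scaleR_fun_def)

locale finsler_domain = tangent_bundle A
  for A :: "('m, 'e::euclidean_space) chart set" +
  fixes E :: "('m, 'e) tpoint \<Rightarrow> real" and S :: "('m, 'e) tfield" and U :: "('m, 'e) tpoint set"
  assumes energy: "finsler_energy A E" and can_spray: "canonical_spray A E S"
    and open_U: "openin (manifold_topology (tangent_atlas A)) U" and U_slit: "U \<subseteq> slit A"
begin

abbreviation "TM \<equiv> tangent_atlas A"
abbreviation "E\<^sub>c C \<equiv> E \<circ> chart_inv C"
abbreviation "s\<^sub>c C \<equiv> \<lambda>x. snd (coord_rep C S x)"
abbreviation "N\<^sub>c C \<equiv> energy_chart.N (s\<^sub>c C)"
abbreviation "bracket \<equiv> lie_bracket TM"

lemma chart_at_ex: "z \<in> U \<Longrightarrow> \<exists>C. C \<in> charts_at TM z"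
  using chart_exists[OF open_U] by (simp add: charts_at_iff)

lemma tangent_ext:
  assumes "z \<in> U" "u \<in> tangent_space TM z" "w \<in> tangent_space TM z"
    "\<And>C. C \<in> charts_at TM z \<Longrightarrow> u C = w C"
  shows "u = w"
  using chart_at_ex[OF assms(1)] tangent_eqI[OF assms(2,3)] assms(4) by blast

lemma chart_point: "C \<in> charts_at TM z \<Longrightarrow> z \<in> W \<Longrightarrow> snd C z \<in> chart_image C W"
  by (auto simp: charts_at_iff)

lemma chart_at_mem: "C \<in> charts_at TM z \<Longrightarrow> C \<in> TM"
  by (simp add: charts_at_iff)

lemma chart_point_inv [simp]: "C \<in> charts_at TM z \<Longrightarrow> chart_inv C (snd C z) = z"
  by (simp add: charts_at_iff)

lemma charts_at_chart_inv: "C \<in> TM \<Longrightarrow> x \<in> chart_image C W \<Longrightarrow> C \<in> charts_at TM (chart_inv C x)"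
  using chart_imageD(2) by (simp add: charts_at_iff)

lemma smooth_function_E: "smooth_function TM U E"
  using energy smooth_function_mono[OF _ U_slit] by (simp add: finsler_energy_def)

lemma smooth_E\<^sub>c: "C \<in> TM \<Longrightarrow> smooth_on (E\<^sub>c C) (chart_image C U)"
  using smooth_function_E by (simp add: smooth_function_def)

lemma vector_field_S: "vector_field TM U S"
  using can_spray vector_field_mono[OF _ U_slit] by (simp add: canonical_spray_def spray_def)

lemma local_ext_ex: "z \<in> U \<Longrightarrow> u \<in> tangent_space TM z \<Longrightarrow> \<exists>X. X \<in> local_ext TM z u"
  using chart_at_ex constant_extension(3) by blast

lemma local_ext_vector_field:
  assumes "X \<in> local_ext TM z u" "z \<in> U"
  obtains W where "open_in W" "z \<in> W" "W \<subseteq> U" "vector_field TM W X" "X z = u"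
  using local_extE[OF assms(1) open_U assms(2)] by blast

lemma dir_deriv_vert:
  assumes "W \<subseteq> U" "vector_field TM W Y" "z \<in> W" "C \<in> charts_at TM z"
  shows "dir_deriv TM z (vert (Y z)) E = fderiv (E\<^sub>c C) (snd C z) (0, fst (Y z C))"
  using dir_deriv_chart[OF assms(4) vert_tangent[OF vector_field_tangent[OF assms(2,3)]]
      smooth_function_differentiable[OF smooth_function_E assms(4) subsetD[OF assms(1,3)]]]
  by (simp add: vert_apply)

text \<open>The derivatives of the two extensions combine to dE(J[X, Y]), which the last term of
  \<open>ext_deriv\<close> removes. The rest depends on the vectors at z only, so the description
  has a value, and this is it.\<close>

lemma Omega_chart:
  assumes z: "z \<in> U" and C: "C \<in> charts_at TM z"
    and u: "u \<in> tangent_space TM z" and w: "w \<in> tangent_space TM z"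
  shows "Omega A E z u w =
    fderiv (\<lambda>x. fderiv (E\<^sub>c C) x (0, fst (w C))) (snd C z) (u C)
    - fderiv (\<lambda>x. fderiv (E\<^sub>c C) x (0, fst (u C))) (snd C z) (w C)"
proof -
  have CT: "C \<in> TM" using C chart_at_mem by blast
  have O: "open (chart_image C U)" using open_chart_image[OF open_U CT] .
  have step: "dir_deriv TM z (X z) (\<lambda>q. dir_deriv TM q (vert (Y q)) E) =
      fderiv (\<lambda>x. fderiv (E\<^sub>c C) x (0, fst (Y z C))) (snd C z) (X z C)
      + fderiv (E\<^sub>c C) (snd C z) (0, fst (fderiv (coord_rep C Y) (snd C z) (X z C)))"
    if W: "open_in W" "z \<in> W" "W \<subseteq> U" and X: "vector_field TM W X" and Y: "vector_field TM W Y" for W X Y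
  proof -
    note q = chart_point[OF C W(2)]
    have OW: "open (chart_image C W)" using open_chart_image[OF W(1) CT] .
    have sE: "smooth_on (E\<^sub>c C) (chart_image C W)"
      by (rule smooth_on_mono[OF smooth_E\<^sub>c[OF CT]]) (use W(3) in blast)
    have dY: "coord_rep C Y differentiable (at (snd C z))"
      using vector_field_differentiable[OF Y C W(2)] .
    then have dY1: "(\<lambda>x. fst (coord_rep C Y x)) differentiable (at (snd C z))"
      using smooth_on_differentiable[OF smooth_on_fst[OF vector_field_smooth[OF Y CT]] q] by simp
    have dY2: "(\<lambda>x. (0::'e, fst (coord_rep C Y x))) differentiable (at (snd C z))"
      using dY1 by (intro differentiable_Pair) auto
    have "smooth_function TM W (\<lambda>q. dir_deriv TM q (vert (Y q)) E)"
      using smooth_function_dir_deriv[OF W(1) smooth_function_mono[OF smooth_function_E W(3)] vector_field_vert[OF Y]] .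
    from dir_deriv_chart[OF C vector_field_tangent[OF X W(2)] smooth_function_differentiable[OF this C W(2)]]
    have "dir_deriv TM z (X z) (\<lambda>q. dir_deriv TM q (vert (Y q)) E) =
        fderiv ((\<lambda>q. dir_deriv TM q (vert (Y q)) E) \<circ> chart_inv C) (snd C z) (X z C)" .
    also have "\<dots> = fderiv (\<lambda>x. fderiv (E\<^sub>c C) x (0, fst (coord_rep C Y x))) (snd C z) (X z C)"
    proof (rule arg_cong[where f="\<lambda>g. g _"], rule fderiv_cong[OF OW q])
      fix x assume x: "x \<in> chart_image C W"
      show "((\<lambda>q. dir_deriv TM q (vert (Y q)) E) \<circ> chart_inv C) x = fderiv (E\<^sub>c C) x (0, fst (coord_rep C Y x))"
        using dir_deriv_vert[OF W(3) Y chart_imageD(1)[OF CT x] charts_at_chart_inv[OF CT x]]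
          chart_imageD(3)[OF CT x] by simp
    qed
    also have "\<dots> = fderiv (\<lambda>x. fderiv (E\<^sub>c C) x (0, fst (Y z C))) (snd C z) (X z C)
        + fderiv (E\<^sub>c C) (snd C z) (0, fst (fderiv (coord_rep C Y) (snd C z) (X z C)))"
      using fderiv_fderiv_apply_id[OF OW sE q dY2, of "X z C"] C
        fderiv_Pair_const[OF dY1, where 'c='e] fderiv_fst[OF dY] by simp
    finally show ?thesis .
  qed
  obtain X0 Y0 where ext: "X0 \<in> local_ext TM z u" "Y0 \<in> local_ext TM z w"
    using local_ext_ex z u w by blast
  show ?thesis
    unfolding Omega_def ext_deriv_def
  proof (rule the_constant2[OF ext])
    fix X Y assume X: "X \<in> local_ext TM z u" and Y: "Y \<in> local_ext TM z w"
    obtain W1 where W1: "open_in W1" "z \<in> W1" "W1 \<subseteq> U" "vector_field TM W1 X" "X z = u"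
      using local_ext_vector_field[OF X z] .
    obtain W2 where W2: "open_in W2" "z \<in> W2" "W2 \<subseteq> U" "vector_field TM W2 Y" "Y z = w"
      using local_ext_vector_field[OF Y z] .
    let ?W = "W1 \<inter> W2"
    have W: "open_in ?W" "z \<in> ?W" "?W \<subseteq> U" "vector_field TM ?W X" "vector_field TM ?W Y"
      using W1 W2 vector_field_mono by auto
    have "dir_deriv TM z (vert (bracket X Y z)) E = fderiv (E\<^sub>c C) (snd C z) (0, fst (bracket X Y z C))"
      using dir_deriv_vert[OF W(3) vector_field_lie_bracket[OF W(1,4,5)] W(2) C] .
    also have "bracket X Y z C =
        fderiv (coord_rep C Y) (snd C z) (X z C) - fderiv (coord_rep C X) (snd C z) (Y z C)"
      using C by (simp add: lie_bracket_chart br_def)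
    also have "fderiv (E\<^sub>c C) (snd C z) (0, fst \<dots>) =
      fderiv (E\<^sub>c C) (snd C z) (0, fst (fderiv (coord_rep C Y) (snd C z) (X z C)))
      - fderiv (E\<^sub>c C) (snd C z) (0, fst (fderiv (coord_rep C X) (snd C z) (Y z C)))"
      using linear_diff[OF linear_fderiv[OF smooth_E\<^sub>c[OF CT] chart_point[OF C z]],
          of "(0, fst (fderiv (coord_rep C Y) (snd C z) (X z C)))" "(0, fst (fderiv (coord_rep C X) (snd C z) (Y z C)))"]
      by simp
    finally show "dir_deriv TM z (X z) (\<lambda>q. dir_deriv TM q (vert (Y q)) E)
        - dir_deriv TM z (Y z) (\<lambda>q. dir_deriv TM q (vert (X q)) E)
        - dir_deriv TM z (vert (bracket X Y z)) E =
      fderiv (\<lambda>x. fderiv (E\<^sub>c C) x (0, fst (w C))) (snd C z) (u C)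
      - fderiv (\<lambda>x. fderiv (E\<^sub>c C) x (0, fst (u C))) (snd C z) (w C)"
      using step[OF W] step[OF W(1-3) W(5,4)] W1(5) W2(5) by simp
  qed
qed

section \<open>The canonical spray in coordinates\<close>

lemma spray_vert: "z \<in> U \<Longrightarrow> vert (S z) = liouville A z"
  using can_spray U_slit by (auto simp: canonical_spray_def spray_def)

lemma S_chart:
  assumes "z \<in> U" "C \<in> charts_at TM z"
  shows "S z C = (snd (snd C z), s\<^sub>c C (snd C z))"
proof -
  have "vert (S z) C = liouville A z C" using spray_vert[OF assms(1)] by simp
  then show ?thesis
    using assms by (simp add: vert_apply liouville_def prod_eq_iff)
qed

lemma fst_S_chart: "z \<in> U \<Longrightarrow> C \<in> charts_at TM z \<Longrightarrow> fst (S z C) = snd (snd C z)"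
  using S_chart by (metis fst_conv)

lemma energy_chart:
  assumes C: "C \<in> TM"
  shows "energy_chart (E\<^sub>c C) (s\<^sub>c C) (chart_image C U)"
proof
  show O: "open (chart_image C U)" using open_chart_image[OF open_U C] .
  show "smooth_on (E\<^sub>c C) (chart_image C U)" using smooth_E\<^sub>c[OF C] .
  show ss: "smooth_on (s\<^sub>c C) (chart_image C U)"
    by (rule smooth_on_snd[OF vector_field_smooth[OF vector_field_S C]])
  fix q assume q: "q \<in> chart_image C U"
  define z where "z = chart_inv C q"
  have z: "z \<in> U" "C \<in> charts_at TM z" "snd C z = q"
    using chart_imageD[OF C q] C by (auto simp: z_def charts_at_iff)
  have zq: "chart_inv C q = z" by (simp add: z_def)
  have z_slit: "z \<in> slit A" using z U_slit by blast
  have lv: "liouville A z \<in> tangent_space TM z"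
    using vert_tangent[OF vector_field_tangent[OF vector_field_S z(1)]] spray_vert[OF z(1)] by simp
  have lvC: "liouville A z' C = (0, snd (snd C z'))" if "C \<in> charts_at TM z'" for z'
    using that by (simp add: liouville_def)
  have "z \<in> carrier TM"
    using z C by (auto simp: carrier_def charts_at_iff)
  then have "dir_deriv TM z (liouville A z) E = 2 * E z"
    using energy by (simp add: finsler_energy_def)
  then show "fderiv (E\<^sub>c C) q (0, snd q) = 2 * E\<^sub>c C q"
    using dir_deriv_chart[OF z(2) lv smooth_function_differentiable[OF smooth_function_E z(2,1)]] z(3) lvC[OF z(2)]
    by (simp add: zq)
  show "fderiv (s\<^sub>c C) q (0, snd q) = 2 *\<^sub>R s\<^sub>c C q"
  proof -
    have "bracket (liouville A) S z = S z"
      using can_spray z_slit by (simp add: canonical_spray_def spray_def)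
    then have "br (coord_rep C (liouville A)) (coord_rep C S) q = S z C"
      using lie_bracket_chart[OF z(2), of "liouville A" S] z(3) by simp
    moreover have "br (coord_rep C (liouville A)) (coord_rep C S) q = br (\<lambda>x. (0, snd x)) (\<lambda>x. (snd x, s\<^sub>c C x)) q"
    proof (rule br_cong[OF O q])
      fix x assume x: "x \<in> chart_image C U"
      note xD = chart_imageD[OF C x] charts_at_chart_inv[OF C x]
      show "coord_rep C (liouville A) x = (0, snd x)"
        using lvC[OF xD(4)] xD by simp
      show "coord_rep C S x = (snd x, s\<^sub>c C x)"
        using S_chart[OF xD(1,4)] xD by simp
    qed
    moreover have "fderiv (\<lambda>x. (snd x, s\<^sub>c C x)) q (0, snd q) = (snd q, fderiv (s\<^sub>c C) q (0, snd q))"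
      using fderiv_Pair[OF smooth_on_differentiable[OF smooth_on_snd_id q] smooth_on_differentiable[OF ss q]]
        fderiv_eq[OF bounded_linear_imp_has_derivative[OF bounded_linear_snd], of q] by simp
    moreover have "fderiv (\<lambda>x. (0::'e, snd x)) q v = (0, snd v)" for v
      using fderiv_Pair_const[OF smooth_on_differentiable[OF smooth_on_snd_id q]]
        fderiv_eq[OF bounded_linear_imp_has_derivative[OF bounded_linear_snd], of q] by simp
    \<comment> \<open>The fiber component of [C, S] is ds(0, y) - s; equating it with s gives
      Euler's relation of degree 2.\<close>
    ultimately have "snd (S z C) = fderiv (s\<^sub>c C) q (0, snd q) - s\<^sub>c C q"
      by (simp add: br_def)
    moreover have "s\<^sub>c C q = snd (S z C)" by (simp add: zq)
    ultimately have "fderiv (s\<^sub>c C) q (0, snd q) - s\<^sub>c C q = s\<^sub>c C q" by metis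
    then show ?thesis by (simp add: scaleR_2 algebra_simps)
  qed
  fix a b
  define w where "w = tangent_lift C z (a, b)"
  have w: "w \<in> tangent_space TM z" "w C = (a, b)"
    using z(2) by (simp_all add: w_def tangent_lift_tangent tangent_lift_chart)
  have "Omega A E z (S z) w = - dir_deriv TM z w E"
    using can_spray z_slit w by (simp add: canonical_spray_def)
  then show "fderiv (\<lambda>x. fderiv (E\<^sub>c C) x (0, a)) q (snd q, s\<^sub>c C q)
      - fderiv (\<lambda>x. fderiv (E\<^sub>c C) x (0, snd q)) q (a, b) = - fderiv (E\<^sub>c C) q (a, b)"
    using Omega_chart[OF z(1,2) vector_field_tangent[OF vector_field_S z(1)] w(1)] S_chart[OF z(1,2)] z w
      dir_deriv_chart[OF z(2) w(1) smooth_function_differentiable[OF smooth_function_E z(2,1)]]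
    by simp
qed

lemma Omega_\<omega>:
  assumes "z \<in> U" "C \<in> charts_at TM z" "u \<in> tangent_space TM z" "w \<in> tangent_space TM z"
  shows "Omega A E z u w = energy_chart.\<omega> (E\<^sub>c C) (snd C z) (u C) (w C)"
  using Omega_chart[OF assms] energy_chart.\<omega>_def[OF energy_chart[OF chart_at_mem[OF assms(2)]]]
    energy_chart.hess_def[OF energy_chart[OF chart_at_mem[OF assms(2)]]] by simp

text \<open>In [JX, S] - J[X, S] the derivatives of X along S cancel and (a, b) is sent to (a, 2 N a
  - b). Hence h(a, b) = (a, N a) and v(a, b) = (0, b - N a). The third claim keeps the formula
  available for every extension, since brackets with the spray are later read off from it.\<close>

lemma barthel_props:
  assumes z: "z \<in> U" and u: "u \<in> tangent_space TM z"
  shows "barthel A S z u \<in> tangent_space TM z"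
    and "C \<in> charts_at TM z \<Longrightarrow> barthel A S z u C =
      (fst (u C), 2 *\<^sub>R N\<^sub>c C (snd C z) (fst (u C)) - snd (u C))"
    and "X \<in> local_ext TM z u \<Longrightarrow> barthel A S z u = bracket (\<lambda>q. vert (X q)) S z - vert (bracket X S z)"
proof -
  let ?F = "\<lambda>X. bracket (\<lambda>q. vert (X q)) S z - vert (bracket X S z)"
  have F: "?F X \<in> tangent_space TM z \<and> (\<forall>C\<in>charts_at TM z. ?F X C =
      (fst (u C), 2 *\<^sub>R N\<^sub>c C (snd C z) (fst (u C)) - snd (u C)))"
    if X: "X \<in> local_ext TM z u" for X
  proof
    obtain W where W: "open_in W" "z \<in> W" "W \<subseteq> U" "vector_field TM W X" "X z = u"
      using local_ext_vector_field[OF X z] .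
    have SW: "vector_field TM W S" using vector_field_mono[OF vector_field_S W(3)] .
    show "?F X \<in> tangent_space TM z"
      by (intro tangent_diff vert_tangent vector_field_tangent[OF vector_field_lie_bracket[OF W(1)] W(2)]
          vector_field_vert W(4) SW)
    show "\<forall>C\<in>charts_at TM z. ?F X C = (fst (u C), 2 *\<^sub>R N\<^sub>c C (snd C z) (fst (u C)) - snd (u C))"
    proof
      fix C assume C: "C \<in> charts_at TM z"
      note CT = chart_at_mem[OF C]
      note ec = energy_chart[OF CT]
      note q = chart_point[OF C z]
      have OU: "open (chart_image C U)" using open_chart_image[OF open_U CT] .
      have ss: "smooth_on (s\<^sub>c C) (chart_image C U)" using energy_chart.smooth_s[OF ec] .
      have "fderiv (coord_rep C S) (snd C z) = fderiv (\<lambda>x. (snd x, s\<^sub>c C x)) (snd C z)"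
      proof (rule fderiv_cong[OF OU q])
        fix x assume x: "x \<in> chart_image C U"
        show "coord_rep C S x = (snd x, s\<^sub>c C x)"
          using S_chart[OF chart_imageD(1)[OF CT x] charts_at_chart_inv[OF CT x]] chart_imageD(3)[OF CT x] by simp
      qed
      then have dS: "fderiv (coord_rep C S) (snd C z) v = (snd v, fderiv (s\<^sub>c C) (snd C z) v)" for v
        using fderiv_Pair[OF smooth_on_differentiable[OF smooth_on_snd_id q] smooth_on_differentiable[OF ss q]]
          fderiv_eq[OF bounded_linear_imp_has_derivative[OF bounded_linear_snd], of "snd C z"] by simp
      have dX: "coord_rep C X differentiable (at (snd C z))"
        using vector_field_differentiable[OF W(4) C W(2)] .
      then have dX1: "(\<lambda>x. fst (coord_rep C X x)) differentiable (at (snd C z))"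
        using smooth_on_differentiable[OF smooth_on_fst[OF vector_field_smooth[OF W(4) CT]] chart_point[OF C W(2)]] by simp
      have "fderiv (coord_rep C (\<lambda>q. vert (X q))) (snd C z) v = (0, fst (fderiv (coord_rep C X) (snd C z) v))" for v
        using fderiv_Pair_const[OF dX1, where 'c='e] fderiv_fst[OF dX] by (simp add: vert_apply)
      then show "?F X C = (fst (u C), 2 *\<^sub>R N\<^sub>c C (snd C z) (fst (u C)) - snd (u C))"
        using C dS W(5) energy_chart.N_def[OF ec] by (simp add: lie_bracket_chart br_def vert_apply)
    qed
  qed
  obtain X0 where X0: "X0 \<in> local_ext TM z u" using local_ext_ex[OF z u] by blast
  have F_eq: "?F X = ?F X0" if "X \<in> local_ext TM z u" for X
    by (rule tangent_ext[OF z]) (use F[OF that] F[OF X0] in \<open>simp_all only: simp_thms\<close>)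
  have eq: "barthel A S z u = ?F X0"
    unfolding barthel_def fn_bracket_def by (rule the_constant[OF X0 F_eq])
  then show "X \<in> local_ext TM z u \<Longrightarrow> barthel A S z u = ?F X"
    using F_eq by simp
  show "barthel A S z u \<in> tangent_space TM z"
    and "C \<in> charts_at TM z \<Longrightarrow> barthel A S z u C =
      (fst (u C), 2 *\<^sub>R N\<^sub>c C (snd C z) (fst (u C)) - snd (u C))"
    using F[OF X0] unfolding eq by auto
qed

section \<open>Horizontal and vertical projections and the almost complex structure\<close>

lemma hproj_tangent: "z \<in> U \<Longrightarrow> u \<in> tangent_space TM z \<Longrightarrow> hproj A S z u \<in> tangent_space TM z"
  and vproj_tangent: "z \<in> U \<Longrightarrow> u \<in> tangent_space TM z \<Longrightarrow> vproj A S z u \<in> tangent_space TM z"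
  using barthel_props(1) by (simp_all add: hproj_def vproj_def tangent_scaleR tangent_add tangent_diff)

lemma half_sum: "(1/2) *\<^sub>R (a + a) = (a :: 'v::real_vector)"
  by (simp add: scaleR_2[symmetric])

lemma hproj_chart:
  assumes "z \<in> U" "C \<in> charts_at TM z" "u \<in> tangent_space TM z"
  shows "hproj A S z u C = (fst (u C), N\<^sub>c C (snd C z) (fst (u C)))"
  using barthel_props(2)[OF assms(1,3,2)]
  by (simp add: hproj_def scaleR_fun_def prod_eq_iff half_sum)

lemma hproj_vproj: "hproj A S z u + vproj A S z u = u"
proof -
  have "hproj A S z u + vproj A S z u = (1/2) *\<^sub>R (u + u)"
    by (simp add: hproj_def vproj_def scaleR_add_right[symmetric])
  then show ?thesis by (simp only: half_sum)
qed

lemma vproj_eq: "vproj A S z u = u - hproj A S z u"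
  using hproj_vproj[of z u] by (metis add_diff_cancel_left')

lemma vproj_chart:
  assumes "z \<in> U" "C \<in> charts_at TM z" "u \<in> tangent_space TM z"
  shows "vproj A S z u C = (0, snd (u C) - N\<^sub>c C (snd C z) (fst (u C)))"
  using hproj_chart[OF assms] by (simp add: vproj_eq prod_eq_iff)

lemma linear_N\<^sub>c: "z \<in> U \<Longrightarrow> C \<in> charts_at TM z \<Longrightarrow> linear (N\<^sub>c C (snd C z))"
  using energy_chart.linear_N[OF energy_chart[OF chart_at_mem]] chart_point by blast

text \<open>The vectors in u = Ja + hb are determined only up to vertical vectors, but h and J
  annihilate those, so ha - Jb is determined by u; \<open>r_chart\<close> makes this explicit in
  coordinates.\<close>

lemma acs_props:
  assumes z: "z \<in> U" and u: "u \<in> tangent_space TM z"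
  shows "acs A S z u \<in> tangent_space TM z"
    and "C \<in> charts_at TM z \<Longrightarrow> acs A S z u C =
      (snd (u C) - N\<^sub>c C (snd C z) (fst (u C)),
       N\<^sub>c C (snd C z) (snd (u C) - N\<^sub>c C (snd C z) (fst (u C))) - fst (u C))"
proof -
  note vt = vproj_tangent[OF z u]
  have r_chart: "(hproj A S z a - vert b) C = (snd (u C) - N\<^sub>c C (snd C z) (fst (u C)),
       N\<^sub>c C (snd C z) (snd (u C) - N\<^sub>c C (snd C z) (fst (u C))) - fst (u C))"
    if ab: "a \<in> tangent_space TM z" "b \<in> tangent_space TM z" "u = vert a + hproj A S z b"
      and C: "C \<in> charts_at TM z" for a b C
  proof -
    have "u C = (fst (b C), fst (a C) + N\<^sub>c C (snd C z) (fst (b C)))"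
      using ab(3) hproj_chart[OF z C ab(2)] by (simp add: vert_apply)
    then show ?thesis
      using hproj_chart[OF z C ab(1)] by (simp add: vert_apply)
  qed
  obtain C0 where C0: "C0 \<in> charts_at TM z" using chart_at_ex[OF z] by blast
  \<comment> \<open>A preimage under J of the vertical part of u: its fiber component is moved to
    the base slot. Together with b = u it decomposes u.\<close>
  define a where "a = tangent_lift C0 z (snd (vproj A S z u C0), 0)"
  have a: "a \<in> tangent_space TM z" "a C0 = (snd (vproj A S z u C0), 0)"
    using C0 by (simp_all add: a_def tangent_lift_tangent tangent_lift_chart)
  have "vert a = vproj A S z u"
    by (rule tangent_eqI[OF vert_tangent[OF a(1)] vt C0]) (simp add: vert_apply a vproj_chart[OF z C0 u])
  then have dec: "u = vert a + hproj A S z u"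
    using hproj_vproj[of z u] by (simp add: add.commute)
  have r_tan: "hproj A S z a - vert b \<in> tangent_space TM z"
    if "a \<in> tangent_space TM z" "b \<in> tangent_space TM z" for a b
    using that by (intro tangent_diff hproj_tangent vert_tangent z)
  have "acs A S z u = hproj A S z a - vert u"
    unfolding acs_def
  proof (rule the_equality)
    show "\<exists>a'\<in>tangent_space TM z. \<exists>b\<in>tangent_space TM z. u = vert a' + hproj A S z b \<and>
        hproj A S z a - vert u = hproj A S z a' - vert b"
      using a(1) u dec by blast
    fix r assume "\<exists>a\<in>tangent_space TM z. \<exists>b\<in>tangent_space TM z. u = vert a + hproj A S z b \<and> r = hproj A S z a - vert b"
    then obtain a' b where *: "a' \<in> tangent_space TM z" "b \<in> tangent_space TM z"
      "u = vert a' + hproj A S z b" "r = hproj A S z a' - vert b" by blast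
    show "r = hproj A S z a - vert u"
      unfolding *(4)
      by (rule tangent_eqI[OF r_tan[OF *(1,2)] r_tan[OF a(1) u] C0])
        (simp only: r_chart[OF *(1-3) C0] r_chart[OF a(1) u dec C0])
  qed
  then show "acs A S z u \<in> tangent_space TM z"
    and "C \<in> charts_at TM z \<Longrightarrow> acs A S z u C =
      (snd (u C) - N\<^sub>c C (snd C z) (fst (u C)),
       N\<^sub>c C (snd C z) (snd (u C) - N\<^sub>c C (snd C z) (fst (u C))) - fst (u C))"
    using r_tan[OF a(1) u] r_chart[OF a(1) u dec] by simp_all
qed

lemmas acs_tangent = acs_props(1) and acs_chart = acs_props(2)

lemma hproj_scaleR:
  assumes "z \<in> U" "u \<in> tangent_space TM z"
  shows "hproj A S z (r *\<^sub>R u) = r *\<^sub>R hproj A S z u"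
  by (rule tangent_ext[OF assms(1)])
    (use assms in \<open>simp_all add: hproj_tangent tangent_scaleR hproj_chart linear_cmul[OF linear_N\<^sub>c]
      scaleR_tvec_apply\<close>)

lemma hproj_idem:
  assumes "z \<in> U" "u \<in> tangent_space TM z"
  shows "hproj A S z (hproj A S z u) = hproj A S z u"
  by (rule tangent_ext[OF assms(1)]) (use assms in \<open>simp_all add: hproj_tangent hproj_chart\<close>)

lemma acs_vert:
  assumes "z \<in> U" "u \<in> tangent_space TM z"
  shows "acs A S z (vert u) = hproj A S z u"
  by (rule tangent_ext[OF assms(1)])
    (use assms in \<open>simp_all add: hproj_tangent acs_tangent acs_chart vert_tangent vert_apply hproj_chart
      linear_0[OF linear_N\<^sub>c]\<close>)

text \<open>Through F every vertical field is J of a smooth field, the form in which the defining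
  formulas of the connection accept it.\<close>

lemma vert_acs_vproj:
  assumes "z \<in> U" "u \<in> tangent_space TM z"
  shows "vert (acs A S z (vproj A S z u)) = vproj A S z u"
  by (rule tangent_ext[OF assms(1)])
    (use assms in \<open>simp_all add: vproj_tangent acs_tangent acs_chart vert_tangent vert_apply vproj_chart
      linear_0[OF linear_N\<^sub>c]\<close>)

lemma acs_add:
  assumes "z \<in> U" "u \<in> tangent_space TM z" "w \<in> tangent_space TM z"
  shows "acs A S z (u + w) = acs A S z u + acs A S z w"
  by (rule tangent_ext[OF assms(1)])
    (use assms in \<open>simp_all add: acs_tangent tangent_add acs_chart linear_add[OF linear_N\<^sub>c] linear_diff[OF linear_N\<^sub>c]\<close>)

lemma acs_zero:
  assumes z: "z \<in> U"
  shows "acs A S z 0 = 0"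
  using acs_add[OF z tangent_zero tangent_zero] by simp

lemma acs_diff:
  assumes "z \<in> U" "u \<in> tangent_space TM z" "w \<in> tangent_space TM z"
  shows "acs A S z (u - w) = acs A S z u - acs A S z w"
  using acs_add[OF assms(1) tangent_diff[OF assms(2,3)] assms(3)] by (simp add: eq_diff_eq)

lemma energy_chart_domain:
  assumes "open_in W" "W \<subseteq> U" "C \<in> TM"
  shows "energy_chart (E\<^sub>c C) (s\<^sub>c C) (chart_image C W)"
  by (rule energy_chart_subset[OF energy_chart[OF assms(3)] open_chart_image[OF assms(1,3)]]) (use assms(2) in blast)

lemma vector_field_hproj:
  assumes "open_in W" "W \<subseteq> U" "vector_field TM W X"
  shows "vector_field TM W (\<lambda>q. hproj A S q (X q))"
proof (rule vector_fieldI)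
  show "hproj A S p (X p) \<in> tangent_space TM p" if "p \<in> W" for p
    using hproj_tangent vector_field_tangent[OF assms(3) that] assms(2) that by blast
  fix C assume C: "C \<in> TM"
  interpret ec: energy_chart "E\<^sub>c C" "s\<^sub>c C" "chart_image C W"
    using energy_chart_domain[OF assms(1,2) C] .
  have X1: "smooth_on (\<lambda>x. fst (coord_rep C X x)) (chart_image C W)"
    using smooth_on_fst[OF vector_field_smooth[OF assms(3) C]] .
  show "smooth_on (coord_rep C (\<lambda>q. hproj A S q (X q))) (chart_image C W)"
  proof (rule smooth_on_cong[OF ec.open_D smooth_on_Pair[OF X1 ec.smooth_N[OF X1]]])
    fix x assume x: "x \<in> chart_image C W"
    show "(fst (coord_rep C X x), N\<^sub>c C x (fst (coord_rep C X x))) = coord_rep C (\<lambda>q. hproj A S q (X q)) x"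
      using hproj_chart[OF _ charts_at_chart_inv[OF C x] vector_field_tangent[OF assms(3) chart_imageD(1)[OF C x]]]
        chart_imageD[OF C x] assms(2) by auto
  qed
qed

lemma vector_field_vproj:
  assumes "open_in W" "W \<subseteq> U" "vector_field TM W X"
  shows "vector_field TM W (\<lambda>q. vproj A S q (X q))"
  unfolding vproj_eq using vector_field_diff[OF assms(3) vector_field_hproj[OF assms]] .

lemma vector_field_acs:
  assumes "open_in W" "W \<subseteq> U" "vector_field TM W X"
  shows "vector_field TM W (\<lambda>q. acs A S q (X q))"
proof (rule vector_fieldI)
  show "acs A S p (X p) \<in> tangent_space TM p" if "p \<in> W" for p
    using acs_tangent vector_field_tangent[OF assms(3) that] assms(2) that by blast
  fix C assume C: "C \<in> TM"
  interpret ec: energy_chart "E\<^sub>c C" "s\<^sub>c C" "chart_image C W"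
    using energy_chart_domain[OF assms(1,2) C] .
  let ?a = "\<lambda>x. fst (coord_rep C X x)" and ?b = "\<lambda>x. snd (coord_rep C X x)"
  have a: "smooth_on ?a (chart_image C W)"
    using smooth_on_fst[OF vector_field_smooth[OF assms(3) C]] .
  have b: "smooth_on (\<lambda>x. ?b x - N\<^sub>c C x (?a x)) (chart_image C W)"
    by (rule smooth_on_diff[OF smooth_on_snd[OF vector_field_smooth[OF assms(3) C]] ec.smooth_N[OF a]])
  show "smooth_on (coord_rep C (\<lambda>q. acs A S q (X q))) (chart_image C W)"
  proof (rule smooth_on_cong[OF ec.open_D smooth_on_Pair[OF b smooth_on_diff[OF ec.smooth_N[OF b] a]]])
    fix x assume x: "x \<in> chart_image C W"
    show "(?b x - N\<^sub>c C x (?a x), N\<^sub>c C x (?b x - N\<^sub>c C x (?a x)) - ?a x) =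
        coord_rep C (\<lambda>q. acs A S q (X q)) x"
      using acs_chart[OF _ vector_field_tangent[OF assms(3) chart_imageD(1)[OF C x]] charts_at_chart_inv[OF C x]]
        chart_imageD[OF C x] assms(2) by auto
  qed
qed

section \<open>Brackets with the Liouville field and the Landsberg tensor on the spray\<close>

lemma bracket_horizontal_vertical_chart:
  assumes W: "open_in W" "z \<in> W" "W \<subseteq> U" and X: "vector_field TM W X" and Y: "vector_field TM W Y"
    and C: "C \<in> charts_at TM z"
  shows "bracket (\<lambda>q. hproj A S q (X q)) (\<lambda>q. vert (Y q)) z C =
    br (\<lambda>x. (fst (coord_rep C X x), N\<^sub>c C x (fst (coord_rep C X x)))) (\<lambda>x. (0, fst (coord_rep C Y x))) (snd C z)"
  unfolding lie_bracket_chart[OF C]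
proof (rule br_cong[OF open_chart_image[OF W(1) chart_at_mem[OF C]] chart_point[OF C W(2)]])
  fix x assume x: "x \<in> chart_image C W"
  note CT = chart_at_mem[OF C]
  show "coord_rep C (\<lambda>q. hproj A S q (X q)) x = (fst (coord_rep C X x), N\<^sub>c C x (fst (coord_rep C X x)))"
    using hproj_chart[OF _ charts_at_chart_inv[OF CT x] vector_field_tangent[OF X chart_imageD(1)[OF CT x]]]
      chart_imageD[OF CT x] W(3) by auto
qed (simp add: vert_apply)

lemma fst_rep_differentiable:
  assumes "vector_field TM W X" "C \<in> charts_at TM z" "z \<in> W"
  shows "(\<lambda>x. fst (coord_rep C X x)) differentiable (at (snd C z))"
  using smooth_on_differentiable[OF smooth_on_fst[OF vector_field_smooth[OF assms(1) chart_at_mem[OF assms(2)]]]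
    chart_point[OF assms(2,3)]] .

text \<open>The Liouville field is written as JS because the connection is prescribed on fields of
  the form JY. In a chart this is \<open>vertical_part_br_liouville\<close>.\<close>

lemma bracket_horizontal_liouville:
  assumes W: "open_in W" "z \<in> W" "W \<subseteq> U" and X: "vector_field TM W X"
  shows "vproj A S z (bracket (\<lambda>q. hproj A S q (X q)) (\<lambda>q. vert (S q)) z) = 0"
proof -
  have z: "z \<in> U" using W by blast
  have SW: "vector_field TM W S" using vector_field_mono[OF vector_field_S W(3)] .
  have B: "bracket (\<lambda>q. hproj A S q (X q)) (\<lambda>q. vert (S q)) z \<in> tangent_space TM z"
    by (rule vector_field_tangent[OF vector_field_lie_bracket[OF W(1) vector_field_hproj[OF W(1,3) X]
      vector_field_vert[OF SW]] W(2)])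
  show ?thesis
  proof (rule tangent_ext[OF z vproj_tangent[OF z B] tangent_zero])
    fix C assume C: "C \<in> charts_at TM z"
    note CT = chart_at_mem[OF C]
    interpret ec: energy_chart "E\<^sub>c C" "s\<^sub>c C" "chart_image C W"
      using energy_chart_domain[OF W(1,3) CT] .
    have q: "snd C z \<in> chart_image C W" using chart_point[OF C W(2)] .
    have "bracket (\<lambda>q. hproj A S q (X q)) (\<lambda>q. vert (S q)) z C =
        br (\<lambda>x. (fst (coord_rep C X x), N\<^sub>c C x (fst (coord_rep C X x)))) (\<lambda>x. (0, snd x)) (snd C z)"
      unfolding bracket_horizontal_vertical_chart[OF W X SW C]
    proof (rule br_cong[OF ec.open_D q])
      fix x assume x: "x \<in> chart_image C W"
      show "(0, fst (coord_rep C S x)) = (0, snd x)"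
        using fst_S_chart[OF _ charts_at_chart_inv[OF CT x]] chart_imageD[OF CT x] W(3) by auto
    qed simp
    then show "vproj A S z (bracket (\<lambda>q. hproj A S q (X q)) (\<lambda>q. vert (S q)) z) C = 0 C"
      using vproj_chart[OF z C B] ec.vertical_part_br_liouville[OF q fst_rep_differentiable[OF X C W(2)]]
      by (simp add: zero_prod_def)
  qed
qed

text \<open>Apply J to [JX, S] = GX + J[X, S], where G is the Barthel connection: J squared vanishes
  and JG = J.\<close>

lemma vert_bracket_vertical_spray:
  assumes W: "open_in W" "z \<in> W" "W \<subseteq> U" and X: "vector_field TM W X"
  shows "vert (bracket (\<lambda>q. vert (X q)) S z) = vert (X z)"
proof -
  have z: "z \<in> U" using W by blast
  have Xz: "X z \<in> tangent_space TM z" using vector_field_tangent[OF X W(2)] .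
  have "X \<in> local_ext TM z (X z)" using local_extI[OF W(1,2) X refl] .
  then have "barthel A S z (X z) = bracket (\<lambda>q. vert (X q)) S z - vert (bracket X S z)"
    using barthel_props(3)[OF z Xz] by blast
  then have "bracket (\<lambda>q. vert (X q)) S z = barthel A S z (X z) + vert (bracket X S z)"
    by simp
  then have "vert (bracket (\<lambda>q. vert (X q)) S z) = vert (barthel A S z (X z))"
    by (simp add: vert_add vert_vert)
  also have "\<dots> = vert (X z)"
    by (rule tangent_ext[OF z vert_tangent[OF barthel_props(1)[OF z Xz]] vert_tangent[OF Xz]])
      (simp add: vert_apply barthel_props(2)[OF z Xz])
  finally show ?thesis .
qed

lemma lie_deriv2_spray:
  assumes W: "open_in W" "z \<in> W" "W \<subseteq> U"
    and X: "vector_field TM W X" and Y: "vector_field TM W Y" and Z: "vector_field TM W Z"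
    and YS: "Y z = S z"
  shows "lie_deriv2 TM (\<lambda>q. hproj A S q (X q)) (finsler_metric A E S) (\<lambda>q. vert (Y q)) (\<lambda>q. vert (Z q)) z = 0"
proof -
  have z: "z \<in> U" using W by blast
  obtain C where C: "C \<in> charts_at TM z" using chart_at_ex[OF z] by blast
  note CT = chart_at_mem[OF C]
  interpret ec: energy_chart "E\<^sub>c C" "s\<^sub>c C" "chart_image C W"
    using energy_chart_domain[OF W(1,3) CT] .
  define q where "q = snd C z"
  have q: "q \<in> chart_image C W" using chart_point[OF C W(2)] by (simp add: q_def)
  define X1 Y1 Z1 where "X1 = (\<lambda>x. fst (coord_rep C X x))" and "Y1 = (\<lambda>x. fst (coord_rep C Y x))"
    and "Z1 = (\<lambda>x. fst (coord_rep C Z x))"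
  have d: "X1 differentiable (at q)" "Y1 differentiable (at q)" "Z1 differentiable (at q)"
    using fst_rep_differentiable[OF X C W(2)] fst_rep_differentiable[OF Y C W(2)]
      fst_rep_differentiable[OF Z C W(2)] by (simp_all add: X1_def Y1_def Z1_def q_def)
  have Y1q: "Y1 q = snd q"
    using fst_S_chart[OF z C] C YS by (simp add: Y1_def q_def)
  define hX where "hX = (\<lambda>x. (X1 x, ec.N x (X1 x)))"
  have T: "X z \<in> tangent_space TM z" "Y z \<in> tangent_space TM z" "Z z \<in> tangent_space TM z"
    using vector_field_tangent[OF _ W(2)] X Y Z by auto
  have hXz: "hproj A S z (X z) C = hX q"
    using hproj_chart[OF z C T(1)] C by (simp add: hX_def q_def X1_def)
  \<comment> \<open>Since FJw = hw, the metric with Jw in its second slot is g(u, Jw) =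
    \<open>Omega\<close> on u and hw.\<close>
  have g_vert: "finsler_metric A E S z' u (vert w) = ec.\<omega> (snd C z') (u C) (fst (w C), N\<^sub>c C (snd C z') (fst (w C)))"
    if "z' \<in> U" "C \<in> charts_at TM z'" "u \<in> tangent_space TM z'" "w \<in> tangent_space TM z'" for z' u w
    using that by (simp add: finsler_metric_def acs_vert Omega_\<omega> hproj_tangent hproj_chart)
  have metric: "((\<lambda>p. finsler_metric A E S p (vert (Y p)) (vert (Z p))) \<circ> chart_inv C) x =
      ec.hess x (0, Z1 x) (0, Y1 x)" if x: "x \<in> chart_image C W" for x
  proof -
    note xD = chart_imageD[OF CT x]
    have xU: "chart_inv C x \<in> U" using xD W(3) by blast
    have "ec.hess x (0, 0) v = 0" for v
      using linear_0[OF ec.linear_hess1[OF x, of v]] by (simp add: zero_prod_def)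
    then show ?thesis
      using g_vert[OF xU charts_at_chart_inv[OF CT x] vert_tangent[OF vector_field_tangent[OF Y xD(1)]]
          vector_field_tangent[OF Z xD(1)]] xD
      by (simp add: vert_apply ec.\<omega>_def Y1_def Z1_def)
  qed
  have "((\<lambda>p. finsler_metric A E S p (vert (Y p)) (vert (Z p))) \<circ> chart_inv C) differentiable (at q)"
  proof -
    obtain L where "((\<lambda>x. ec.hess x (0, Z1 x) (0, Y1 x)) has_derivative L) (at q)"
      using ec.differentiable_hess_apply2[OF q d(2,3)] by (auto simp: differentiable_def)
    then have "(((\<lambda>p. finsler_metric A E S p (vert (Y p)) (vert (Z p))) \<circ> chart_inv C) has_derivative L) (at q)"
      by (rule has_derivative_transform_within_open[OF _ ec.open_D q]) (rule metric[symmetric])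
    then show ?thesis by (auto simp: differentiable_def)
  qed
  then have "dir_deriv TM z (hproj A S z (X z)) (\<lambda>p. finsler_metric A E S p (vert (Y p)) (vert (Z p))) =
      fderiv ((\<lambda>p. finsler_metric A E S p (vert (Y p)) (vert (Z p))) \<circ> chart_inv C) q (hX q)"
    using dir_deriv_chart[OF C hproj_tangent[OF z T(1)]] hXz by (simp add: q_def)
  also have "\<dots> = fderiv (\<lambda>x. ec.hess x (0, Z1 x) (0, Y1 x)) q (hX q)"
    by (rule arg_cong[where f="\<lambda>g. g _"], rule fderiv_cong[OF ec.open_D q]) (rule metric)
  finally have 1: "dir_deriv TM z (hproj A S z (X z)) (\<lambda>p. finsler_metric A E S p (vert (Y p)) (vert (Z p))) =
      fderiv (\<lambda>x. ec.hess x (0, Z1 x) (0, Y1 x)) q (hX q)" .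
  have B: "bracket (\<lambda>q. hproj A S q (X q)) (\<lambda>q. vert (V q)) z \<in> tangent_space TM z"
    "bracket (\<lambda>q. hproj A S q (X q)) (\<lambda>q. vert (V q)) z C = br hX (\<lambda>x. (0, fst (coord_rep C V x))) q"
    if V: "vector_field TM W V" for V
    using vector_field_tangent[OF vector_field_lie_bracket[OF W(1) vector_field_hproj[OF W(1,3) X]
      vector_field_vert[OF V]] W(2)] bracket_horizontal_vertical_chart[OF W X V C]
    by (simp_all add: hX_def X1_def q_def)
  have 2: "finsler_metric A E S z (bracket (\<lambda>q. hproj A S q (X q)) (\<lambda>q. vert (Y q)) z) (vert (Z z)) =
      ec.\<omega> q (br hX (\<lambda>x. (0, Y1 x)) q) (Z1 q, ec.N q (Z1 q))"
    using g_vert[OF z C B(1)[OF Y] T(3)] B(2)[OF Y] C by (simp add: q_def Y1_def Z1_def)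
  have "ec.hess q (0, 0) v = 0" for v
    using linear_0[OF ec.linear_hess1[OF q, of v]] by (simp add: zero_prod_def)
  then have 3: "finsler_metric A E S z (vert (Y z)) (bracket (\<lambda>q. hproj A S q (X q)) (\<lambda>q. vert (Z q)) z) =
      ec.hess q (0, snd (br hX (\<lambda>x. (0, Z1 x)) q) - ec.N q (fst (br hX (\<lambda>x. (0, Z1 x)) q))) (0, Y1 q)"
    using Omega_\<omega>[OF z C vert_tangent[OF T(2)] acs_tangent[OF z B(1)[OF Z]]]
      acs_chart[OF z B(1)[OF Z] C] B(2)[OF Z] C
    by (simp add: finsler_metric_def ec.\<omega>_def vert_apply q_def Y1_def Z1_def)
  show ?thesis
    unfolding lie_deriv2_def 1 2 3
    using ec.lie_derivative_metric_spray[OF q d Y1q] by (simp add: hX_def)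
qed

lemma landsberg_spray_zero:
  assumes z: "z \<in> U" and u: "u \<in> tangent_space TM z"
  shows "landsberg A E S z u (S z) = 0"
proof -
  have Sz: "S z \<in> tangent_space TM z"
    using vector_field_tangent[OF vector_field_S z] .
  have zero: "lie_deriv2 TM (\<lambda>q. hproj A S q (X q)) (finsler_metric A E S) (\<lambda>q. vert (Y q)) (\<lambda>q. vert (Z q)) z = 0"
    if ext: "X \<in> local_ext TM z u" "Y \<in> local_ext TM z (S z)" "Z \<in> local_ext TM z t" for X Y Z t
  proof -
    obtain W1 where W1: "open_in W1" "z \<in> W1" "W1 \<subseteq> U" "vector_field TM W1 X" "X z = u"
      using local_ext_vector_field[OF ext(1) z] .
    obtain W2 where W2: "open_in W2" "z \<in> W2" "W2 \<subseteq> U" "vector_field TM W2 Y" "Y z = S z"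
      using local_ext_vector_field[OF ext(2) z] .
    obtain W3 where W3: "open_in W3" "z \<in> W3" "W3 \<subseteq> U" "vector_field TM W3 Z" "Z z = t"
      using local_ext_vector_field[OF ext(3) z] .
    let ?W = "W1 \<inter> W2 \<inter> W3"
    have "open_in ?W" "z \<in> ?W" "?W \<subseteq> U" using W1 W2 W3 by auto
    moreover have "vector_field TM ?W X" "vector_field TM ?W Y" "vector_field TM ?W Z"
      by (rule vector_field_mono[OF W1(4)] vector_field_mono[OF W2(4)] vector_field_mono[OF W3(4)], blast)+
    ultimately show ?thesis using lie_deriv2_spray W2(5) by blast
  qed
  obtain C where C: "C \<in> charts_at TM z" using chart_at_ex[OF z] by blast
  interpret ec: energy_chart "E\<^sub>c C" "s\<^sub>c C" "chart_image C U"
    using energy_chart[OF chart_at_mem[OF C]] .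
  have Omega0: "Omega A E z 0 t = 0" if "t \<in> tangent_space TM z" for t
    using Omega_\<omega>[OF z C tangent_zero that] linear_0[OF ec.linear_hess2[OF chart_point[OF C z]]]
      linear_0[OF ec.linear_hess1[OF chart_point[OF C z]]]
    by (simp add: ec.\<omega>_def zero_prod_def[symmetric])
  show ?thesis
    unfolding landsberg_def
  proof (rule the_equality)
    have "vert (0 :: ('m, 'e) ttvec) = 0"
      by (rule ext) (simp add: vert_apply zero_prod_def)
    then show "0 \<in> tangent_space TM z \<and> vert 0 = (0 :: ('m, 'e) ttvec) \<and> (\<forall>t\<in>tangent_space TM z.
         \<forall>X\<in>local_ext TM z u. \<forall>Y\<in>local_ext TM z (S z). \<forall>Z\<in>local_ext TM z t.
           Omega A E z 0 t = (1 / 2) * lie_deriv2 TM (\<lambda>q. hproj A S q (X q)) (finsler_metric A E S)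
               (\<lambda>q. vert (Y q)) (\<lambda>q. vert (Z q)) z)"
      using tangent_zero zero Omega0 by simp
    fix r assume r: "r \<in> tangent_space TM z \<and> vert r = 0 \<and> (\<forall>t\<in>tangent_space TM z.
         \<forall>X\<in>local_ext TM z u. \<forall>Y\<in>local_ext TM z (S z). \<forall>Z\<in>local_ext TM z t.
           Omega A E z r t = (1 / 2) * lie_deriv2 TM (\<lambda>q. hproj A S q (X q)) (finsler_metric A E S)
               (\<lambda>q. vert (Y q)) (\<lambda>q. vert (Z q)) z)"
    have "Omega A E z r t = 0" if t: "t \<in> tangent_space TM z" for t
    proof -
      obtain X Y Z where XYZ: "X \<in> local_ext TM z u" "Y \<in> local_ext TM z (S z)" "Z \<in> local_ext TM z t"
        using local_ext_ex[OF z u] local_ext_ex[OF z Sz] local_ext_ex[OF z t] by blast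
      have "Omega A E z r t = (1 / 2) * lie_deriv2 TM (\<lambda>q. hproj A S q (X q)) (finsler_metric A E S)
               (\<lambda>q. vert (Y q)) (\<lambda>q. vert (Z q)) z"
        using r t XYZ by blast
      then show ?thesis using zero[OF XYZ] by simp
    qed
    moreover have "z \<in> slit A" using z U_slit by blast
    ultimately show "r = 0"
      using energy r unfolding finsler_energy_def by blast
  qed
qed

end

section \<open>The Chern connection and its curvature\<close>

lemma the_constant3:
  "x\<^sub>0 \<in> L \<Longrightarrow> y\<^sub>0 \<in> M \<Longrightarrow> z\<^sub>0 \<in> N \<Longrightarrow>
    (\<And>x y z. x \<in> L \<Longrightarrow> y \<in> M \<Longrightarrow> z \<in> N \<Longrightarrow> F x y z = k) \<Longrightarrow>
    (THE r. \<forall>x\<in>L. \<forall>y\<in>M. \<forall>z\<in>N. r = F x y z) = k"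
  by (rule the_equality) auto

locale chern = finsler_domain A E S U
  for A :: "('m, 'e::euclidean_space) chart set" and E S U +
  fixes D :: "('m, 'e) tfield \<Rightarrow> ('m, 'e) tfield \<Rightarrow> ('m, 'e) tfield"
  assumes chern: "chern_connection A E S D"
begin

abbreviation "vf W X \<equiv> vector_field TM W X"
abbreviation "R \<equiv> curvature TM D"

section \<open>The connection on fields over open subsets of U\<close>

lemma connection: "linear_connection TM (slit A) D"
  using chern by (simp add: chern_connection_def)

lemma
  assumes W: "open_in W" "W \<subseteq> U" and X: "vf W X" and Y: "vf W Y"
  shows D_cong: "\<And>X' Y' p. (\<And>q. q \<in> W \<Longrightarrow> X' q = X q) \<Longrightarrow> (\<And>q. q \<in> W \<Longrightarrow> Y' q = Y q) \<Longrightarrow> p \<in> W \<Longrightarrow>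
      D X' Y' p = D X Y p"
    and vector_field_D: "vf W (D X Y)"
    and D_add1: "\<And>X' p. vf W X' \<Longrightarrow> p \<in> W \<Longrightarrow> D (\<lambda>q. X q + X' q) Y p = D X Y p + D X' Y p"
    and D_add2: "\<And>Y' p. vf W Y' \<Longrightarrow> p \<in> W \<Longrightarrow> D X (\<lambda>q. Y q + Y' q) p = D X Y p + D X Y' p"
    and D_scale1: "\<And>f p. smooth_function TM W f \<Longrightarrow> p \<in> W \<Longrightarrow> D (\<lambda>q. f q *\<^sub>R X q) Y p = f p *\<^sub>R D X Y p"
    and D_scale2: "\<And>f p. smooth_function TM W f \<Longrightarrow> p \<in> W \<Longrightarrow>
      D X (\<lambda>q. f q *\<^sub>R Y q) p = dir_deriv TM p (X p) f *\<^sub>R Y p + f p *\<^sub>R D X Y p"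
proof -
  have "W \<subseteq> slit A" using W(2) U_slit by blast
  note * = connection[unfolded linear_connection_def, rule_format, OF W(1) this X Y]
  show "D X' Y' p = D X Y p" if "\<And>q. q \<in> W \<Longrightarrow> X' q = X q" "\<And>q. q \<in> W \<Longrightarrow> Y' q = Y q" "p \<in> W" for X' Y' p
    using * that by blast
  show "vf W (D X Y)" using * by blast
  have plus: "(X + X') = (\<lambda>q. X q + X' q)" for X X' :: "('m, 'e) tfield"
    by (rule ext) simp
  show "D (\<lambda>q. X q + X' q) Y p = D X Y p + D X' Y p" if "vf W X'" "p \<in> W" for X' p
    using * that unfolding plus by blast
  show "D X (\<lambda>q. Y q + Y' q) p = D X Y p + D X Y' p" if "vf W Y'" "p \<in> W" for Y' p
    using * that unfolding plus by blast
  show "D (\<lambda>q. f q *\<^sub>R X q) Y p = f p *\<^sub>R D X Y p" if "smooth_function TM W f" "p \<in> W" for f p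
    using * that by blast
  show "D X (\<lambda>q. f q *\<^sub>R Y q) p = dir_deriv TM p (X p) f *\<^sub>R Y p + f p *\<^sub>R D X Y p"
    if "smooth_function TM W f" "p \<in> W" for f p
    using * that by blast
qed

lemma D_diff1:
  assumes W: "open_in W" "W \<subseteq> U" and X: "vf W X" "vf W X'" and Y: "vf W Y" and p: "p \<in> W"
  shows "D (\<lambda>q. X q - X' q) Y p = D X Y p - D X' Y p"
  using D_add1[OF W vector_field_diff[OF X] Y X(2) p] by simp

lemma D_diff2:
  assumes W: "open_in W" "W \<subseteq> U" and X: "vf W X" and Y: "vf W Y" "vf W Y'" and p: "p \<in> W"
  shows "D X (\<lambda>q. Y q - Y' q) p = D X Y p - D X Y' p"
  using D_add2[OF W X vector_field_diff[OF Y] Y(2) p] by simp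

lemma D_zero1:
  assumes W: "open_in W" "W \<subseteq> U" and Y: "vf W Y" and p: "p \<in> W" and Z: "\<And>q. q \<in> W \<Longrightarrow> Z q = 0"
  shows "D Z Y p = 0"
  using D_diff1[OF W Y Y Y p] D_cong[OF W vector_field_zero Y Z refl p] by simp

lemma D_zero2:
  assumes W: "open_in W" "W \<subseteq> U" and X: "vf W X" and p: "p \<in> W" and Z: "\<And>q. q \<in> W \<Longrightarrow> Z q = 0"
  shows "D X Z p = 0"
  using D_diff2[OF W X X X p] D_cong[OF W X vector_field_zero refl Z p] by simp

section \<open>Tensoriality of the curvature\<close>

lemma curvature_cong:
  assumes W: "open_in W" "W \<subseteq> U" and vf: "vf W X" "vf W Y" "vf W Z"
    and eq: "\<And>q. q \<in> W \<Longrightarrow> X' q = X q" "\<And>q. q \<in> W \<Longrightarrow> Y' q = Y q" "\<And>q. q \<in> W \<Longrightarrow> Z' q = Z q"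
    and p: "p \<in> W"
  shows "R X' Y' Z' p = R X Y Z p"
proof -
  have "D X' (D Y' Z') p = D X (D Y Z) p"
    by (rule D_cong[OF W vf(1) vector_field_D[OF W vf(2,3)] eq(1) D_cong[OF W vf(2,3) eq(2,3)] p])
  moreover have "D Y' (D X' Z') p = D Y (D X Z) p"
    by (rule D_cong[OF W vf(2) vector_field_D[OF W vf(1,3)] eq(2) D_cong[OF W vf(1,3) eq(1,3)] p])
  moreover have "D (bracket X' Y') Z' p = D (bracket X Y) Z p"
    by (rule D_cong[OF W vector_field_lie_bracket[OF W(1) vf(1,2)] vf(3) lie_bracket_cong[OF W(1)] eq(3) p])
      (simp_all add: eq)
  ultimately show ?thesis by (simp add: curvature_def)
qed

lemma curvature_add1:
  assumes W: "open_in W" "W \<subseteq> U" and vf: "vf W X" "vf W X'" "vf W Y" "vf W Z" and p: "p \<in> W"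
  shows "R (\<lambda>q. X q + X' q) Y Z p = R X Y Z p + R X' Y Z p"
proof -
  note B = vector_field_lie_bracket[OF W(1)]
  have "D Y (D (\<lambda>q. X q + X' q) Z) p = D Y (\<lambda>q. D X Z q + D X' Z q) p"
    by (rule D_cong[OF W vf(3) vector_field_add[OF vector_field_D[OF W vf(1,4)] vector_field_D[OF W vf(2,4)]]
      refl D_add1[OF W vf(1,4,2)] p])
  moreover have "D (bracket (\<lambda>q. X q + X' q) Y) Z p = D (\<lambda>q. bracket X Y q + bracket X' Y q) Z p"
    by (rule D_cong[OF W vector_field_add[OF B[OF vf(1,3)] B[OF vf(2,3)]] vf(4) lie_bracket_add[OF vf(1-3)] refl p])
  ultimately show ?thesis
    using D_add1[OF W vf(1) vector_field_D[OF W vf(3,4)] vf(2) p]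
      D_add2[OF W vf(3) vector_field_D[OF W vf(1,4)] vector_field_D[OF W vf(2,4)] p]
      D_add1[OF W B[OF vf(1,3)] vf(4) B[OF vf(2,3)] p]
    by (simp add: curvature_def)
qed

text \<open>The derivative of f along Y arises twice with opposite signs: from D_Y applied to f D_X
  Z, and from [fX, Y] = f[X, Y] - (Y f)X.\<close>

lemma curvature_scale1:
  assumes W: "open_in W" "W \<subseteq> U" and f: "smooth_function TM W f" and vf: "vf W X" "vf W Y" "vf W Z" and p: "p \<in> W"
  shows "R (\<lambda>q. f q *\<^sub>R X q) Y Z p = f p *\<^sub>R R X Y Z p"
proof -
  note B = vector_field_lie_bracket[OF W(1) vf(1,2)]
  note Yf = smooth_function_dir_deriv[OF W(1) f vf(2)]
  note DXZ = vector_field_D[OF W vf(1,3)]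
  have "D Y (D (\<lambda>q. f q *\<^sub>R X q) Z) p = D Y (\<lambda>q. f q *\<^sub>R D X Z q) p"
    by (rule D_cong[OF W vf(2) vector_field_scale[OF f DXZ] refl D_scale1[OF W vf(1,3) f] p])
  moreover have "D (bracket (\<lambda>q. f q *\<^sub>R X q) Y) Z p =
      D (\<lambda>q. f q *\<^sub>R bracket X Y q - dir_deriv TM q (Y q) f *\<^sub>R X q) Z p"
    by (rule D_cong[OF W vector_field_diff[OF vector_field_scale[OF f B] vector_field_scale[OF Yf vf(1)]] vf(3) _ refl p])
      (simp add: lie_bracket_scale[OF W(1) f vf(1,2)])
  ultimately show ?thesis
    using D_scale1[OF W vf(1) vector_field_D[OF W vf(2,3)] f p] D_scale2[OF W vf(2) DXZ f p]
      D_diff1[OF W vector_field_scale[OF f B] vector_field_scale[OF Yf vf(1)] vf(3) p]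
      D_scale1[OF W B vf(3) f p] D_scale1[OF W vf(1,3) Yf p]
    by (simp add: curvature_def scaleR_diff_right)
qed

lemma curvature_anticommute:
  assumes W: "open_in W" "W \<subseteq> U" and vf: "vf W X" "vf W Y" "vf W Z" and p: "p \<in> W"
  shows "R Y X Z p = - R X Y Z p"
proof -
  note B = vector_field_lie_bracket[OF W(1) vf(1,2)]
  have "D (bracket Y X) Z p = D (\<lambda>q. (-1) *\<^sub>R bracket X Y q) Z p"
    by (rule D_cong[OF W vector_field_scale[OF smooth_function_const B] vf(3) lie_bracket_anticommute refl p])
  then show ?thesis
    using D_scale1[OF W B vf(3) smooth_function_const p, of "-1"] by (simp add: curvature_def)
qed

lemma curvature_add3:
  assumes W: "open_in W" "W \<subseteq> U" and vf: "vf W X" "vf W Y" "vf W Z" "vf W Z'" and p: "p \<in> W"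
  shows "R X Y (\<lambda>q. Z q + Z' q) p = R X Y Z p + R X Y Z' p"
proof -
  have "D X (D Y (\<lambda>q. Z q + Z' q)) p = D X (D Y Z) p + D X (D Y Z') p" if vf: "vf W X" "vf W Y" for X Y
  proof -
    note D1 = vector_field_D[OF W vf(2) \<open>vf W Z\<close>] and D2 = vector_field_D[OF W vf(2) \<open>vf W Z'\<close>]
    have "D X (D Y (\<lambda>q. Z q + Z' q)) p = D X (\<lambda>q. D Y Z q + D Y Z' q) p"
      by (rule D_cong[OF W vf(1) vector_field_add[OF D1 D2] refl D_add2[OF W vf(2) \<open>vf W Z\<close> \<open>vf W Z'\<close>] p])
    then show ?thesis using D_add2[OF W vf(1) D1 D2 p] by simp
  qed
  from this[OF vf(1,2)] this[OF vf(2,1)] show ?thesis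
    using D_add2[OF W vector_field_lie_bracket[OF W(1) vf(1,2)] vf(3,4) p] by (simp add: curvature_def)
qed

text \<open>The terms with two derivatives of f combine to the derivative along [X, Y], which the
  last term of the curvature cancels; the terms with one derivative are symmetric in X and
  Y.\<close>

lemma curvature_scale3:
  assumes W: "open_in W" "W \<subseteq> U" and f: "smooth_function TM W f" and vf: "vf W X" "vf W Y" "vf W Z" and p: "p \<in> W"
  shows "R X Y (\<lambda>q. f q *\<^sub>R Z q) p = f p *\<^sub>R R X Y Z p"
proof -
  have step: "D X (D Y (\<lambda>q. f q *\<^sub>R Z q)) p =
      dir_deriv TM p (X p) (\<lambda>q. dir_deriv TM q (Y q) f) *\<^sub>R Z p + dir_deriv TM p (Y p) f *\<^sub>R D X Z p
      + (dir_deriv TM p (X p) f *\<^sub>R D Y Z p + f p *\<^sub>R D X (D Y Z) p)"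
    if vf: "vf W X" "vf W Y" for X Y
  proof -
    note Z = \<open>vf W Z\<close> and Yf = smooth_function_dir_deriv[OF W(1) f vf(2)]
    note DYZ = vector_field_D[OF W vf(2) Z]
    have "D X (D Y (\<lambda>q. f q *\<^sub>R Z q)) p = D X (\<lambda>q. dir_deriv TM q (Y q) f *\<^sub>R Z q + f q *\<^sub>R D Y Z q) p"
      by (rule D_cong[OF W vf(1) vector_field_add[OF vector_field_scale[OF Yf Z] vector_field_scale[OF f DYZ]]
        refl D_scale2[OF W vf(2) Z f] p])
    then show ?thesis
      using D_add2[OF W vf(1) vector_field_scale[OF Yf Z] vector_field_scale[OF f DYZ] p]
        D_scale2[OF W vf(1) Z Yf p] D_scale2[OF W vf(1) DYZ f p] by simp
  qed
  show ?thesis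
    using D_scale2[OF W vector_field_lie_bracket[OF W(1) vf(1,2)] vf(3) f p] step[OF vf(1,2)] step[OF vf(2,1)]
    by (simp add: curvature_def dir_deriv_lie_bracket[OF W(1) p f vf(1,2), symmetric] algebra_simps)
qed

text \<open>\<open>tensorial\<close> is applied to the first and the third argument. The second is
  moved to the first place by antisymmetry, which is why \<open>first\<close> and
  \<open>anti\<close> are stated for arbitrary vectors.\<close>

lemma curvature_tensorial:
  assumes z: "z \<in> U"
    and X: "X \<in> local_ext TM z u" "X' \<in> local_ext TM z u"
    and Y: "Y \<in> local_ext TM z w" "Y' \<in> local_ext TM z w"
    and Z: "Z \<in> local_ext TM z t" "Z' \<in> local_ext TM z t"
  shows "R X Y Z z = R X' Y' Z' z"
proof -
  have common: "\<exists>V. open_in V \<and> z \<in> V \<and> V \<subseteq> U \<and> vf V Y \<and> vf V Z"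
    if Y: "Y \<in> local_ext TM z w" and Z: "Z \<in> local_ext TM z t" for Y Z w t
  proof -
    obtain W1 where W1: "open_in W1" "z \<in> W1" "W1 \<subseteq> U" "vf W1 Y" "Y z = w"
      using local_ext_vector_field[OF Y z] .
    obtain W2 where W2: "open_in W2" "z \<in> W2" "W2 \<subseteq> U" "vf W2 Z" "Z z = t"
      using local_ext_vector_field[OF Z z] .
    show ?thesis
      by (rule exI[of _ "W1 \<inter> W2"])
        (use W1 W2 vector_field_mono[OF W1(4), of "W1 \<inter> W2"] vector_field_mono[OF W2(4), of "W1 \<inter> W2"] in auto)
  qed
  have first: "R X Y Z z = R X' Y Z z"
    if X: "X \<in> local_ext TM z u" "X' \<in> local_ext TM z u" and Y: "Y \<in> local_ext TM z w" and Z: "Z \<in> local_ext TM z t"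
    for X X' Y Z u w t
  proof -
    obtain V where V: "open_in V" "z \<in> V" "V \<subseteq> U" "vf V Y" "vf V Z" using common[OF Y Z] by blast
    have VW: "W \<subseteq> U" "vf W Y" "vf W Z" if "W \<subseteq> V" for W
      using V vector_field_mono that by (blast, metis, metis)
    show ?thesis
    proof (rule tensorial[OF V(1,2) _ _ _ X, of "\<lambda>X. R X Y Z z"])
      fix W P P' f assume W: "open_in W" "W \<subseteq> V" "z \<in> W" and P: "vf W P"
      show "R P Y Z z = R P' Y Z z" if "vf W P'" "\<And>q. q \<in> W \<Longrightarrow> P q = P' q"
        by (rule curvature_cong[OF W(1) VW(1)[OF W(2)] that(1) VW(2,3)[OF W(2)] that(2) refl refl W(3)])
      show "R (\<lambda>q. P q + P' q) Y Z z = R P Y Z z + R P' Y Z z" if "vf W P'"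
        by (rule curvature_add1[OF W(1) VW(1)[OF W(2)] P that VW(2,3)[OF W(2)] W(3)])
      show "R (\<lambda>q. f q *\<^sub>R P q) Y Z z = f z *\<^sub>R R P Y Z z" if "smooth_function TM W f"
        by (rule curvature_scale1[OF W(1) VW(1)[OF W(2)] that P VW(2,3)[OF W(2)] W(3)])
    qed
  qed
  have anti: "R X Y Z z = - R Y X Z z"
    if X: "X \<in> local_ext TM z u" and Y: "Y \<in> local_ext TM z w" and Z: "Z \<in> local_ext TM z t" for X Y Z u w t
  proof -
    obtain V where V: "open_in V" "z \<in> V" "V \<subseteq> U" "vf V Y" "vf V Z" using common[OF Y Z] by blast
    obtain W where W: "open_in W" "z \<in> W" "W \<subseteq> V" "vf W X" "X z = u" by (rule local_extE[OF X V(1,2)])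
    have WU: "W \<subseteq> U" using W V by blast
    show ?thesis
      by (rule curvature_anticommute[OF W(1) WU vector_field_mono[OF V(4) W(3)] W(4) vector_field_mono[OF V(5) W(3)] W(2)])
  qed
  have third: "R X Y Z z = R X Y Z' z"
  proof -
    obtain V where V: "open_in V" "z \<in> V" "V \<subseteq> U" "vf V X" "vf V Y" using common[OF X(1) Y(1)] by blast
    have VW: "W \<subseteq> U" "vf W X" "vf W Y" if "W \<subseteq> V" for W
      using V vector_field_mono that by (blast, metis, metis)
    show ?thesis
    proof (rule tensorial[OF V(1,2) _ _ _ Z, of "\<lambda>Z. R X Y Z z"])
      fix W P P' f assume W: "open_in W" "W \<subseteq> V" "z \<in> W" and P: "vf W P"
      show "R X Y P z = R X Y P' z" if "vf W P'" "\<And>q. q \<in> W \<Longrightarrow> P q = P' q"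
        by (rule curvature_cong[OF W(1) VW(1,2,3)[OF W(2)] that(1) refl refl that(2) W(3)])
      show "R X Y (\<lambda>q. P q + P' q) z = R X Y P z + R X Y P' z" if "vf W P'"
        by (rule curvature_add3[OF W(1) VW(1,2,3)[OF W(2)] P that W(3)])
      show "R X Y (\<lambda>q. f q *\<^sub>R P q) z = f z *\<^sub>R R X Y P z" if "smooth_function TM W f"
        by (rule curvature_scale3[OF W(1) VW(1)[OF W(2)] that VW(2,3)[OF W(2)] P W(3)])
    qed
  qed
  have "R X Y Z z = R X' Y Z' z"
    using third first[OF X Y(1) Z(2)] by simp
  also have "\<dots> = - R Y X' Z' z" by (rule anti[OF X(2) Y(1) Z(2)])
  also have "\<dots> = - R Y' X' Z' z" using first[OF Y X(2) Z(2)] by simp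
  also have "\<dots> = R X' Y' Z' z" by (rule anti[OF X(2) Y(2) Z(2), symmetric])
  finally show ?thesis .
qed

lemma local_ext_hproj:
  assumes "X \<in> local_ext TM z u" "z \<in> U"
  shows "(\<lambda>q. hproj A S q (X q)) \<in> local_ext TM z (hproj A S z u)"
proof -
  obtain W where W: "open_in W" "z \<in> W" "W \<subseteq> U" "vf W X" "X z = u"
    using local_ext_vector_field[OF assms] .
  show ?thesis
    by (rule local_extI[OF W(1,2) vector_field_hproj[OF W(1,3,4)]]) (simp add: W)
qed

lemma local_ext_vert:
  assumes "X \<in> local_ext TM z u" "z \<in> U"
  shows "(\<lambda>q. vert (X q)) \<in> local_ext TM z (vert u)"
proof -
  obtain W where W: "open_in W" "z \<in> W" "W \<subseteq> U" "vf W X" "X z = u"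
    using local_ext_vector_field[OF assms] .
  show ?thesis
    by (rule local_extI[OF W(1,2) vector_field_vert[OF W(4)]]) (simp add: W)
qed

lemma h_curvature_eq:
  assumes z: "z \<in> U" and ext: "X \<in> local_ext TM z u" "Y \<in> local_ext TM z w" "Z \<in> local_ext TM z t"
  shows "h_curvature A S D z u w t = R (\<lambda>q. hproj A S q (X q)) (\<lambda>q. hproj A S q (Y q)) (\<lambda>q. vert (Z q)) z"
  unfolding h_curvature_def
  by (rule the_constant3[OF ext], rule curvature_tensorial[OF z])
    (rule local_ext_hproj[OF _ z] local_ext_vert[OF _ z]; (assumption | rule ext))+

definition horizontal_field :: "('m, 'e) tpoint set \<Rightarrow> ('m, 'e) tfield \<Rightarrow> bool" where
  "horizontal_field W X \<longleftrightarrow> vf W X \<and> (\<forall>q\<in>W. hproj A S q (X q) = X q)"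

lemma h_curvature_horizontal:
  assumes W: "open_in W" "W \<subseteq> U" "z \<in> W" and X: "horizontal_field W X" and Y: "horizontal_field W Y" and Z: "vf W Z"
  shows "h_curvature A S D z (X z) (Y z) (Z z) = R X Y (\<lambda>q. vert (Z q)) z"
proof -
  have "h_curvature A S D z (X z) (Y z) (Z z) =
      R (\<lambda>q. hproj A S q (X q)) (\<lambda>q. hproj A S q (Y q)) (\<lambda>q. vert (Z q)) z"
    using W X Y Z local_extI[OF W(1,3)] by (intro h_curvature_eq) (auto simp: horizontal_field_def)
  also have "\<dots> = R X Y (\<lambda>q. vert (Z q)) z"
    using X Y by (intro curvature_cong[OF W(1,2) _ _ vector_field_vert[OF Z] _ _ _ W(3)]) (auto simp: horizontal_field_def)
  finally show ?thesis .
qed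

section \<open>The connection on the Liouville field and flat pairs\<close>

lemma
  assumes W: "open_in W" "W \<subseteq> U" and X: "vf W X" and Y: "vf W Y" and z: "z \<in> W"
  shows D_vert_vert: "D (\<lambda>q. vert (X q)) (\<lambda>q. vert (Y q)) z = vert (bracket (\<lambda>q. vert (X q)) Y z)"
    and D_hproj_vert: "D (\<lambda>q. hproj A S q (X q)) (\<lambda>q. vert (Y q)) z =
      vproj A S z (bracket (\<lambda>q. hproj A S q (X q)) (\<lambda>q. vert (Y q)) z) + landsberg A E S z (X z) (Y z)"
    and D_acs: "D X (\<lambda>q. acs A S q (Y q)) z = acs A S z (D X Y z)"
proof -
  have "W \<subseteq> slit A" using W(2) U_slit by blast
  from chern[unfolded chern_connection_def, THEN conjunct2, rule_format, OF W(1) this X Y z]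
  show "D (\<lambda>q. vert (X q)) (\<lambda>q. vert (Y q)) z = vert (bracket (\<lambda>q. vert (X q)) Y z)"
    and "D (\<lambda>q. hproj A S q (X q)) (\<lambda>q. vert (Y q)) z =
      vproj A S z (bracket (\<lambda>q. hproj A S q (X q)) (\<lambda>q. vert (Y q)) z) + landsberg A E S z (X z) (Y z)"
    and "D X (\<lambda>q. acs A S q (Y q)) z = acs A S z (D X Y z)" by blast+
qed

text \<open>Both summands in the prescription of D_hX JS vanish separately: v[hX, C] by homogeneity
  of the Barthel connection, and the Landsberg term on the spray.\<close>

lemma D_horizontal_liouville:
  assumes W: "open_in W" "W \<subseteq> U" and X: "horizontal_field W X" and z: "z \<in> W"
  shows "D X (\<lambda>q. vert (S q)) z = 0"
proof -
  have Xv: "vf W X" and SW: "vf W S"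
    using X vector_field_mono[OF vector_field_S W(2)] by (simp_all add: horizontal_field_def)
  have "D X (\<lambda>q. vert (S q)) z = D (\<lambda>q. hproj A S q (X q)) (\<lambda>q. vert (S q)) z"
    using X by (intro D_cong[OF W vector_field_hproj[OF W Xv] vector_field_vert[OF SW] _ refl z])
      (simp add: horizontal_field_def)
  also have "\<dots> = 0"
    using D_hproj_vert[OF W Xv SW z] bracket_horizontal_liouville[OF W(1) z W(2) Xv]
      landsberg_spray_zero[OF _ vector_field_tangent[OF Xv z]] z W(2) by auto
  finally show ?thesis .
qed

lemma D_vertical_liouville:
  assumes W: "open_in W" "W \<subseteq> U" and X: "vf W X" and z: "z \<in> W"
  shows "D (\<lambda>q. vert (X q)) (\<lambda>q. vert (S q)) z = vert (X z)"
  using D_vert_vert[OF W X vector_field_mono[OF vector_field_S W(2)] z]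
    vert_bracket_vertical_spray[OF W(1) z W(2) X] by simp

text \<open>The right-hand side is the curvature of the Barthel connection.\<close>

lemma curvature_liouville:
  assumes W: "open_in W" "W \<subseteq> U" and X: "horizontal_field W X" and Y: "horizontal_field W Y" and z: "z \<in> W"
  shows "R X Y (\<lambda>q. vert (S q)) z = - vproj A S z (bracket X Y z)"
proof -
  have vf: "vf W X" "vf W Y" using X Y by (simp_all add: horizontal_field_def)
  let ?C = "\<lambda>q. vert (S q)" and ?B = "bracket X Y"
  have C: "vf W ?C" by (rule vector_field_vert[OF vector_field_mono[OF vector_field_S W(2)]])
  have B: "vf W ?B" by (rule vector_field_lie_bracket[OF W(1) vf])
  have vB: "vf W (\<lambda>q. vproj A S q (?B q))" by (rule vector_field_vproj[OF W B])
  \<comment> \<open>The vertical part of [X, Y] has to appear as J of a field before the vertical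
    formula for D applies; F v[X, Y] is such a field.\<close>
  let ?Z = "\<lambda>q. acs A S q (vproj A S q (?B q))"
  have Z: "vf W ?Z" by (rule vector_field_acs[OF W vB])
  have vert_Z: "vert (?Z q) = vproj A S q (?B q)" if "q \<in> W" for q
    using vert_acs_vproj[OF _ vector_field_tangent[OF B that]] that W(2) by blast
  have hB: "horizontal_field W (\<lambda>q. hproj A S q (?B q))"
    using vector_field_hproj[OF W B] hproj_idem[OF _ vector_field_tangent[OF B]] W(2)
    by (auto simp: horizontal_field_def)
  have "D ?B ?C z = D (\<lambda>q. hproj A S q (?B q) + vert (?Z q)) ?C z"
    using vert_Z by (intro D_cong[OF W vector_field_add[OF vector_field_hproj[OF W B] vector_field_vert[OF Z]] C _ refl z])
      (simp add: hproj_vproj)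
  also have "\<dots> = vert (?Z z)"
    using D_add1[OF W vector_field_hproj[OF W B] C vector_field_vert[OF Z] z]
      D_horizontal_liouville[OF W hB z] D_vertical_liouville[OF W Z z] by simp
  finally have "D ?B ?C z = vproj A S z (?B z)" using vert_Z[OF z] by simp
  moreover have "D X (D Y ?C) z = 0" "D Y (D X ?C) z = 0"
    by (rule D_zero2[OF W vf(1) z], rule D_horizontal_liouville[OF W Y], assumption,
        rule D_zero2[OF W vf(2) z], rule D_horizontal_liouville[OF W X])
  ultimately show ?thesis by (simp add: curvature_def)
qed

lemma curvature_acs:
  assumes W: "open_in W" "W \<subseteq> U" and vf: "vf W X" "vf W Y" "vf W Z" and z: "z \<in> W"
  shows "R X Y (\<lambda>q. acs A S q (Z q)) z = acs A S z (R X Y Z z)"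
proof -
  have zU: "z \<in> U" using z W by blast
  have "D X (D Y (\<lambda>q. acs A S q (Z q))) z = acs A S z (D X (D Y Z) z)" if vf: "vf W X" "vf W Y" for X Y
  proof -
    note DY = vector_field_D[OF W vf(2) \<open>vf W Z\<close>]
    have "D X (D Y (\<lambda>q. acs A S q (Z q))) z = D X (\<lambda>q. acs A S q (D Y Z q)) z"
      by (rule D_cong[OF W vf(1) vector_field_acs[OF W DY] refl D_acs[OF W vf(2) \<open>vf W Z\<close>] z])
    then show ?thesis using D_acs[OF W vf(1) DY z] by simp
  qed
  note XY = this[OF vf(1,2)] and YX = this[OF vf(2,1)]
  note B = vector_field_lie_bracket[OF W(1) vf(1,2)]
  note T = vector_field_tangent[OF vector_field_D[OF W vf(1) vector_field_D[OF W vf(2,3)]] z]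
    vector_field_tangent[OF vector_field_D[OF W vf(2) vector_field_D[OF W vf(1,3)]] z]
    vector_field_tangent[OF vector_field_D[OF W B vf(3)] z]
  show ?thesis
    unfolding curvature_def XY YX D_acs[OF W B vf(3) z]
    using acs_diff[OF zU T(1,2)] acs_diff[OF zU tangent_diff[OF T(1,2)] T(3)] by simp
qed

text \<open>The curvature operator has to vanish on all fields over W, not only on vertical ones: in
  the Jacobi argument it acts on an arbitrary T and on derivatives such as D_X T.\<close>

definition flat_pair :: "('m, 'e) tpoint set \<Rightarrow> ('m, 'e) tfield \<Rightarrow> ('m, 'e) tfield \<Rightarrow> bool" where
  "flat_pair W X Y \<longleftrightarrow> (\<forall>Z. vf W Z \<longrightarrow> (\<forall>z\<in>W. R X Y Z z = 0))"

text \<open>Any field is Z = J(F vZ) + F(JZ), the second summand being hZ. The curvature commutes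
  with F because F is parallel, so its vanishing on fields of the form JZ spreads to both
  summands.\<close>

lemma flat_pair_vertI:
  assumes W: "open_in W" "W \<subseteq> U" and vf: "vf W X" "vf W Y"
    and vert: "\<And>Z z. vf W Z \<Longrightarrow> z \<in> W \<Longrightarrow> R X Y (\<lambda>q. vert (Z q)) z = 0"
  shows "flat_pair W X Y"
  unfolding flat_pair_def
proof (intro allI impI ballI)
  fix Z z assume Z: "vf W Z" and z: "z \<in> W"
  have zU: "z \<in> U" using z W by blast
  note hZ = vector_field_hproj[OF W Z] and vZ = vector_field_vert[OF Z]
  let ?V = "\<lambda>q. acs A S q (vproj A S q (Z q))"
  have V: "vf W ?V" by (rule vector_field_acs[OF W vector_field_vproj[OF W Z]])
  have tZ: "q \<in> U" "Z q \<in> tangent_space TM q" if "q \<in> W" for q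
    using that W(2) vector_field_tangent[OF Z] by blast+
  have "R X Y (\<lambda>q. hproj A S q (Z q)) z = R X Y (\<lambda>q. acs A S q (vert (Z q))) z"
    by (rule curvature_cong[OF W vf vector_field_acs[OF W vZ] refl refl _ z]) (simp add: acs_vert tZ)
  also have "\<dots> = 0"
    using curvature_acs[OF W vf vZ z] vert[OF Z z] acs_zero[OF zU] by simp
  finally have h0: "R X Y (\<lambda>q. hproj A S q (Z q)) z = 0" .
  have "R X Y Z z = R X Y (\<lambda>q. vert (?V q) + hproj A S q (Z q)) z"
    by (rule curvature_cong[OF W vf vector_field_add[OF vector_field_vert[OF V] hZ] refl refl _ z])
      (simp add: vert_acs_vproj tZ add.commute[of "vproj A S _ _"] hproj_vproj)
  also have "\<dots> = 0"
    using curvature_add3[OF W vf vector_field_vert[OF V] hZ z] vert[OF V z] h0 by simp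
  finally show "R X Y Z z = 0" .
qed

text \<open>The Jacobi identity of the operators \<open>D\<^sub>X\<close>, \<open>D\<^sub>Y\<close>, \<open>D\<^sub>Z\<close>; no torsion enters.\<close>

lemma curvature_bracket:
  assumes W: "open_in W" "W \<subseteq> U" and vf: "vf W X" "vf W Y" "vf W Z" "vf W T" and z: "z \<in> W"
    and flat: "flat_pair W X Y" "flat_pair W Y Z" "flat_pair W Z X"
  shows "R X (bracket Y Z) T z + R Y (bracket Z X) T z + R Z (bracket X Y) T z = 0"
proof -
  note B = vector_field_lie_bracket[OF W(1)]
  \<comment> \<open>Flatness turns D along the inner bracket into a commutator, which has to hold on
    all of W because it is differentiated once more.\<close>
  have commute: "D (bracket Y Z) T q = D Y (D Z T) q - D Z (D Y T) q"
    if "flat_pair W Y Z" "vf W T" "q \<in> W" for Y Z T q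
    using that by (auto simp: flat_pair_def curvature_def)
  have step: "R X (bracket Y Z) T z = D X (D Y (D Z T)) z - D X (D Z (D Y T)) z
      - (D Y (D Z (D X T)) z - D Z (D Y (D X T)) z) - D (bracket X (bracket Y Z)) T z"
    if vf': "vf W X" "vf W Y" "vf W Z" and fl: "flat_pair W Y Z" for X Y Z
  proof -
    have T: "vf W T" using vf by blast
    note D2 = vector_field_D[OF W vf'(2) vector_field_D[OF W vf'(3) T]]
      vector_field_D[OF W vf'(3) vector_field_D[OF W vf'(2) T]]
    have "D X (D (bracket Y Z) T) z = D X (\<lambda>q. D Y (D Z T) q - D Z (D Y T) q) z"
      by (rule D_cong[OF W vf'(1) vector_field_diff[OF D2] refl commute[OF fl T] z])
    also have "\<dots> = D X (D Y (D Z T)) z - D X (D Z (D Y T)) z"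
      by (rule D_diff2[OF W vf'(1) D2 z])
    finally show ?thesis
      using commute[OF fl vector_field_D[OF W vf'(1) T] z] by (simp add: curvature_def)
  qed
  note J = B[OF vf(1) B[OF vf(2,3)]] B[OF vf(2) B[OF vf(3,1)]] B[OF vf(3) B[OF vf(1,2)]]
  have "D (\<lambda>q. bracket X (bracket Y Z) q + bracket Y (bracket Z X) q + bracket Z (bracket X Y) q) T z = 0"
    using lie_bracket_Jacobi[OF W(1) _ vf(1-3)] by (intro D_zero1[OF W vf(4) z])
  then have J0: "D (bracket X (bracket Y Z)) T z + D (bracket Y (bracket Z X)) T z + D (bracket Z (bracket X Y)) T z = 0"
    using D_add1[OF W vector_field_add[OF J(1,2)] vf(4) J(3) z] D_add1[OF W J(1) vf(4) J(2) z] by simp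
  \<comment> \<open>The letters a to f are the six orders of composing D_X, D_Y, D_Z on T, each
    occurring twice with opposite signs; j, k, l come from the double brackets, whose sum vanishes
    by the Jacobi identity for fields.\<close>
  have cancel: "(a - b - (c - d) - j) + (c - e - (f - b) - k) + (f - d - (a - e) - l) = - (j + k + l)"
    for a b c d e f j k l :: "('m, 'e) ttvec"
    by (simp add: algebra_simps)
  show ?thesis
    unfolding step[OF vf(1,2,3) flat(2)] step[OF vf(2,3,1) flat(3)] step[OF vf(3,1,2) flat(1)] cancel J0
    by simp
qed

section \<open>Nullity fields and their brackets\<close>

lemma nullity_horizontal:
  assumes W: "W \<subseteq> U" and X: "section_of TM (nullity A S D) W X"
  shows "horizontal_field W X"
  unfolding horizontal_field_def
proof (intro conjI ballI)
  show "vf W X" using X by (simp add: section_of_def)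
  fix q assume q: "q \<in> W"
  then obtain u where "u \<in> tangent_space TM q" "X q = hproj A S q u"
    using X by (auto simp: section_of_def nullity_def horizontal_def)
  then show "hproj A S q (X q) = X q" using hproj_idem[of q u] q W by auto
qed

lemma horizontal_iff:
  assumes "z \<in> U"
  shows "u \<in> horizontal A S z \<longleftrightarrow> u \<in> tangent_space TM z \<and> hproj A S z u = u"
  unfolding horizontal_def image_iff using hproj_tangent[OF assms] hproj_idem[OF assms] by metis

lemma nullity_flat:
  assumes W: "open_in W" "W \<subseteq> U" and X: "section_of TM (nullity A S D) W X" and Y: "horizontal_field W Y"
  shows "flat_pair W X Y"
proof -
  note hX = nullity_horizontal[OF W(2) X]
  have vf: "vf W X" "vf W Y" using hX Y by (simp_all add: horizontal_field_def)
  show ?thesis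
  proof (rule flat_pair_vertI[OF W vf])
    fix Z z assume Z: "vf W Z" and z: "z \<in> W"
    have zU: "z \<in> U" using z W by blast
    have "Y z \<in> horizontal A S z"
      using Y z vector_field_tangent[OF vf(2) z] by (simp add: horizontal_iff[OF zU] horizontal_field_def)
    then have "h_curvature A S D z (X z) (Y z) (Z z) = 0"
      using X z vector_field_tangent[OF Z z] by (simp add: section_of_def nullity_def)
    then show "R X Y (\<lambda>q. vert (Z q)) z = 0"
      using h_curvature_horizontal[OF W z hX Y Z] by simp
  qed
qed

lemma nullity_bracket_horizontal:
  assumes W: "open_in W" "W \<subseteq> U" and X: "section_of TM (nullity A S D) W X" and Y: "horizontal_field W Y"
  shows "horizontal_field W (bracket X Y)"
  unfolding horizontal_field_def
proof (intro conjI ballI)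
  note hX = nullity_horizontal[OF W(2) X]
  show "vf W (bracket X Y)"
    using vector_field_lie_bracket[OF W(1)] hX Y by (simp add: horizontal_field_def)
  fix q assume q: "q \<in> W"
  have "R X Y (\<lambda>q. vert (S q)) q = 0"
    using nullity_flat[OF W X Y] vector_field_vert[OF vector_field_mono[OF vector_field_S W(2)]] q
    by (simp add: flat_pair_def)
  then show "hproj A S q (bracket X Y q) = bracket X Y q"
    using curvature_liouville[OF W hX Y q] hproj_vproj[of q "bracket X Y q"] by simp
qed

lemma section_of_mono: "section_of TM N W X \<Longrightarrow> V \<subseteq> W \<Longrightarrow> section_of TM N V X"
  using vector_field_mono by (auto simp: section_of_def)

lemma flat_pair_swap:
  assumes "open_in W" "W \<subseteq> U" "vf W X" "vf W Y" "flat_pair W X Y"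
  shows "flat_pair W Y X"
  using assms(5) curvature_anticommute[OF assms(1-4)] by (simp add: flat_pair_def)

lemma nullity_bracket_flat:
  assumes W: "open_in W" "W \<subseteq> U" and X: "section_of TM (nullity A S D) W X"
    and Y: "section_of TM (nullity A S D) W Y" and Z: "horizontal_field W Z" and T: "vf W T" and z: "z \<in> W"
  shows "R (bracket X Y) Z T z = 0"
proof -
  note hX = nullity_horizontal[OF W(2) X] and hY = nullity_horizontal[OF W(2) Y]
  have vf: "vf W X" "vf W Y" "vf W Z" using hX hY Z by (simp_all add: horizontal_field_def)
  note B = vector_field_lie_bracket[OF W(1)]
  \<comment> \<open>\<open>nullity_bracket_horizontal\<close> has the nullity field in first place,
    so it yields [X, Z]; the sign passes through h by linearity.\<close>
  have "horizontal_field W (bracket Z X)"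
    unfolding horizontal_field_def
  proof (intro conjI ballI)
    show "vf W (bracket Z X)" by (rule B[OF vf(3,1)])
    fix q assume q: "q \<in> W"
    have "q \<in> U" using q W by blast
    then show "hproj A S q (bracket Z X q) = bracket Z X q"
      using nullity_bracket_horizontal[OF W X Z] hproj_scaleR[OF _ vector_field_tangent[OF B[OF vf(1,3)] q], of "-1"] q
      by (simp add: lie_bracket_anticommute[of Z X] horizontal_field_def)
  qed
  then have "flat_pair W Y (bracket Z X)" by (rule nullity_flat[OF W Y])
  moreover have "flat_pair W X (bracket Y Z)"
    by (rule nullity_flat[OF W X nullity_bracket_horizontal[OF W Y Z]])
  moreover have "flat_pair W Z X"
    by (rule flat_pair_swap[OF W vf(1,3) nullity_flat[OF W X Z]])
  ultimately have "R Z (bracket X Y) T z = 0"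
    using curvature_bracket[OF W vf T z nullity_flat[OF W X hY] nullity_flat[OF W Y Z]] T z
    by (simp add: flat_pair_def)
  then show ?thesis
    using curvature_anticommute[OF W vf(3) B[OF vf(1,2)] T z] by simp
qed

lemma nullity_integrable: "completely_integrable TM U (nullity A S D)"
  unfolding completely_integrable_def
proof (intro allI impI)
  fix W X Y assume W: "open_in W" "W \<subseteq> U"
    and X: "section_of TM (nullity A S D) W X" and Y: "section_of TM (nullity A S D) W Y"
  have hB: "horizontal_field W (bracket X Y)"
    by (rule nullity_bracket_horizontal[OF W X nullity_horizontal[OF W(2) Y]])
  then have B: "vf W (bracket X Y)" by (simp add: horizontal_field_def)
  show "section_of TM (nullity A S D) W (bracket X Y)"
    unfolding section_of_def nullity_def
  proof (intro conjI B ballI CollectI)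
    fix z assume z: "z \<in> W"
    have zU: "z \<in> U" using z W by blast
    show "bracket X Y z \<in> horizontal A S z"
      using hB z vector_field_tangent[OF B z] by (simp add: horizontal_iff[OF zU] horizontal_field_def)
    fix w t assume w: "w \<in> horizontal A S z" and t: "t \<in> tangent_space TM z"
    have w': "w \<in> tangent_space TM z" "hproj A S z w = w" using w by (simp_all add: horizontal_iff[OF zU])
    obtain C where C: "C \<in> charts_at TM z" using chart_at_ex[OF zU] by blast
    \<comment> \<open>Nullity is a condition on vectors at z, flatness one on fields. So w and t are
      extended with constant components in a chart, and the extension of w is projected by h, which
      leaves its value at z unchanged since w is horizontal.\<close>
    let ?V = "W \<inter> fst C"
    have V: "open_in ?V" "?V \<subseteq> U" "z \<in> ?V"
      using W z C open_in_chart_domain[OF chart_at_mem[OF C]] by (auto simp: charts_at_iff)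
    have VW: "?V \<subseteq> W" by blast
    define w\<^sub>0 t\<^sub>0 where "w\<^sub>0 = (\<lambda>q. tangent_lift C q (w C))" and "t\<^sub>0 = (\<lambda>q. tangent_lift C q (t C))"
    have ext: "vf ?V w\<^sub>0" "w\<^sub>0 z = w" "vf ?V t\<^sub>0" "t\<^sub>0 z = t"
      using constant_extension[OF C w'(1)] constant_extension[OF C t] vector_field_mono[of "fst C" _ ?V]
      by (auto simp: w\<^sub>0_def t\<^sub>0_def)
    let ?Z = "\<lambda>q. hproj A S q (w\<^sub>0 q)"
    have Z: "horizontal_field ?V ?Z"
      using vector_field_hproj[OF V(1,2) ext(1)] hproj_idem[OF _ vector_field_tangent[OF ext(1)]] V(2)
      by (auto simp: horizontal_field_def)
    have hBV: "horizontal_field ?V (bracket X Y)"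
      using hB vector_field_mono[OF B VW] by (auto simp: horizontal_field_def)
    have "h_curvature A S D z (bracket X Y z) w t = R (bracket X Y) ?Z (\<lambda>q. vert (t\<^sub>0 q)) z"
      using h_curvature_horizontal[OF V hBV Z ext(3)] ext w' by simp
    also have "\<dots> = 0"
      by (rule nullity_bracket_flat[OF V(1,2) section_of_mono[OF X VW] section_of_mono[OF Y VW] Z
        vector_field_vert[OF ext(3)] V(3)])
    finally show "h_curvature A S D z (bracket X Y z) w t = 0" .
  qed
qed

end

theorem corollary3p10:
  fixes A :: "('m, 'e::euclidean_space) chart set"
    and E :: "('m, 'e) tpoint \<Rightarrow> real"
    and S :: "('m, 'e) tfield"
    and D :: "('m, 'e) tfield \<Rightarrow> ('m, 'e) tfield \<Rightarrow> ('m, 'e) tfield"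
    and U :: "('m, 'e) tpoint set"
    and n k :: nat
  assumes "smooth_manifold A" and "n = DIM('e)"
    and "finsler_energy A E"
    and "canonical_spray A E S"
    and "chern_connection A E S D"
    and "openin (manifold_topology (tangent_atlas A)) U" and "U \<subseteq> slit A"
    and "\<forall>z\<in>U. nullity_index A S D z = k" and "k \<noteq> 0" and "k \<noteq> n"
  shows "completely_integrable (tangent_atlas A) U (nullity A S D)"
proof -
  interpret chern A E S U D
    using assms by unfold_locales (simp_all add: smooth_manifold_def)
  show ?thesis by (rule nullity_integrable)
qed

end
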